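(* Let $X$ be a nonzero complex Banach space with open unit ball $\mathbb{B}$, and let $\Phi(\zeta)=1+B_1\zeta+B_2\zeta^2+B_3\zeta^3+\cdots$ be an admissible function (see context). Put $q_5=\dfrac{2B_2}{B_1}$ and $q_6=\dfrac{B_3-B_1^3}{B_1}$. Let $f:\mathbb{B}\to\mathbb{C}$ be holomorphic with $f(0)=1$, define $F(z)=zf(z)$ for $z\in\mathbb{B}$, and suppose that the mapping $z\mapsto(DF(z))^{-1}F(z)$ belongs to $\mathcal{M}_\Phi$. Then for every $z\in X\setminus\{0\}$ and $l_z\in T(z)$, $$|A_2A_3-A_4|\le\begin{cases}\dfrac{B_1}{3} & \text{if }(q_5,q_6)\in\Theta_1\cup\Theta_2\cup\{(2,1)\},\\[2mm] \dfrac13\left|B_3-B_1^3\right| & \text{if }(q_5,q_6)\in\bigcup_{i=3}^{7}\Theta_i,\\[2mm] \dfrac{2\sqrt3\,(B_1+2|B_2|)^{3/2}}{27\sqrt{B_1-B_1^3+B_3+2|B_2|}} & \text{if }(q_5,q_6)\in\Theta_8\cup\Theta_9,\end{cases}$$ where $$A_2=\frac{l_z(D^2F(0)(z^2))}{2!\,\|z\|^2},\quad A_3=\frac{l_z(D^3F(0)(z^3))}{3!\,\|z\|^3},\quad A_4=\frac{l_z(D^4F(0)(z^4))}{4!\,\|z\|^4}.$$ Moreover, the estimate is sharp (in each of the three cases).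
   Context: $\mathbb{U}=\{\zeta\in\mathbb{C}:|\zeta|<1\}$. For $z\in X\setminus\{0\}$, $T(z)=\{l_z\in L(X,\mathbb{C}): l_z(z)=\|z\|,\ \|l_z\|=1\}$, where $L(X,\mathbb{C})$ is the space of continuous linear functionals on $X$. $\mathcal{H}(\mathbb{B})$ is the set of holomorphic mappings $\mathbb{B}\to X$; $D^nF(0)$ is the $n$-th Fréchet derivative at $0$ (a bounded symmetric $n$-linear mapping) and $D^nF(0)(z^n)=D^nF(0)(z,\dots,z)$. Admissible function: $\Phi:\mathbb{U}\to\mathbb{C}$ is biholomorphic onto its image, $\Phi(0)=1$, $\operatorname{Re}\Phi(\zeta)>0$ on $\mathbb{U}$, $\Phi'(0)>0$, and $\Phi(\mathbb{U})$ is symmetric with respect to the real axis. Its Taylor coefficients $B_i$ are then real and $B_1>0$. $\mathcal{M}_\Phi$ is the set of $p\in\mathcal{H}(\mathbb{B})$ with $p(0)=0$, $Dp(0)=I$ and $\dfrac{\|z\|}{l_z(p(z))}\in\Phi(\mathbb{U})$ for all $z\in\mathbb{B}\setminus\{0\}$, $l_z\in T(z)$. The hypothesis $(DF(z))^{-1}F(z)\in\mathcal{M}_\Phi$ includes that $DF(z)$ is invertible with bounded inverse for every $z\in\mathbb{B}$. Subsets of $\mathbb{R}^2$ (points written $(a,b)$): $\Theta_1=\{|a|\le\frac12,\ |b|\le1\}$; $\Theta_2=\{\frac12\le|a|\le2,\ \frac4{27}(|a|+1)^3-(|a|+1)\le b\le1\}$; $\Theta_3=\{|a|\le\frac12,\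 b\le-1\}$; $\Theta_4=\{|a|\ge\frac12,\ b\le-\frac23(|a|+1)\}$; $\Theta_5=\{|a|\le2,\ b\ge1\}$; $\Theta_6=\{2\le|a|\le4,\ b\ge\frac1{12}(a^2+8)\}$; $\Theta_7=\{|a|\ge4,\ b\ge\frac23(|a|-1)\}$; $\Theta_8=\{\frac12\le|a|\le2,\ -\frac23(|a|+1)\le b\le\frac4{27}(|a|+1)^3-(|a|+1)\}$; $\Theta_9=\{|a|\ge2,\ -\frac23(|a|+1)\le b\le\frac{2|a|(|a|+1)}{a^2+2|a|+4}\}$. "Sharp" means: for each such $X$ and each such $\Phi$ falling under one of the three cases, there exist an $f$ satisfying all the hypotheses and a $z\in X\setminus\{0\}$, $l_z\in T(z)$ for which equality holds. *)

theory Defs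
  imports "HOL-Complex_Analysis.Complex_Analysis"
begin

class scaleC =
  fixes scaleC :: "complex \<Rightarrow> 'a \<Rightarrow> 'a"  (infixr "*\<^sub>C" 75)

class complex_normed_vector = real_normed_vector + scaleC +
  assumes scaleC_add_right: "a *\<^sub>C (x + y) = a *\<^sub>C x + a *\<^sub>C y"
    and scaleC_add_left: "(a + b) *\<^sub>C x = a *\<^sub>C x + b *\<^sub>C x"
    and scaleC_scaleC: "a *\<^sub>C (b *\<^sub>C x) = (a * b) *\<^sub>C x"
    and scaleR_scaleC: "r *\<^sub>R x = complex_of_real r *\<^sub>C x"
    and norm_scaleC: "norm (a *\<^sub>C x) = cmod a * norm x"

class cbanach = complex_normed_vector + banach

instantiation complex :: cbanach
begin

definition scaleC_complex :: "complex \<Rightarrow> complex \<Rightarrow> complex"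
  where "scaleC_complex a x = a * x"

instance
  by standard (auto simp: scaleC_complex_def algebra_simps scaleR_conv_of_real norm_mult)

end

definition bounded_clinear ::
  "('a::complex_normed_vector \<Rightarrow> 'b::complex_normed_vector) \<Rightarrow> bool"
  where "bounded_clinear A \<longleftrightarrow> bounded_linear A \<and> (\<forall>c x. A (c *\<^sub>C x) = c *\<^sub>C A x)"

definition support_functionals :: "'a::complex_normed_vector \<Rightarrow> ('a \<Rightarrow> complex) set"
  where "support_functionals z =
    {l. bounded_clinear l \<and> l z = complex_of_real (norm z) \<and> onorm l = 1}"

definition holomorphic_map_on ::
  "('a::complex_normed_vector \<Rightarrow> 'b::complex_normed_vector) \<Rightarrow> 'a set \<Rightarrow> bool"
  where "holomorphic_map_on f S \<longleftrightarrow>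
    (\<forall>z\<in>S. \<exists>f'. bounded_clinear f' \<and> (f has_derivative f') (at z))"

text \<open>
  The Frechet derivative of \<open>f\<close> as a map from points to bounded operators. Iterating it
  gives the higher derivatives, with values in nested operator spaces; for instance
  \<open>fderiv (fderiv f) z\<close> is the second derivative of \<open>f\<close> at \<open>z\<close>, as a bounded bilinear map in
  curried form. The real operator spaces suffice: the derivative of a holomorphic map is also
  its derivative over the reals, and real and complex operator norms agree.
\<close>

definition fderiv ::
  "('a::real_normed_vector \<Rightarrow> 'b::real_normed_vector) \<Rightarrow> 'a \<Rightarrow> 'a \<Rightarrow>\<^sub>L 'b"
  where "fderiv f z = Blinfun (frechet_derivative f (at z))"

definition D2_diag :: "('a::real_normed_vector \<Rightarrow> 'b::real_normed_vector) \<Rightarrow> 'a \<Rightarrow> 'b"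
  where "D2_diag F z = blinfun_apply (blinfun_apply (fderiv (fderiv F) 0) z) z"

definition D3_diag :: "('a::real_normed_vector \<Rightarrow> 'b::real_normed_vector) \<Rightarrow> 'a \<Rightarrow> 'b"
  where "D3_diag F z =
    blinfun_apply (blinfun_apply (blinfun_apply (fderiv (fderiv (fderiv F)) 0) z) z) z"

definition D4_diag :: "('a::real_normed_vector \<Rightarrow> 'b::real_normed_vector) \<Rightarrow> 'a \<Rightarrow> 'b"
  where "D4_diag F z =
    blinfun_apply (blinfun_apply (blinfun_apply (blinfun_apply
      (fderiv (fderiv (fderiv (fderiv F))) 0) z) z) z) z"

definition A2 :: "('a::complex_normed_vector \<Rightarrow> 'a) \<Rightarrow> ('a \<Rightarrow> complex) \<Rightarrow> 'a \<Rightarrow> complex"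
  where "A2 F l z = l (D2_diag F z) / (fact 2 * complex_of_real (norm z ^ 2))"

definition A3 :: "('a::complex_normed_vector \<Rightarrow> 'a) \<Rightarrow> ('a \<Rightarrow> complex) \<Rightarrow> 'a \<Rightarrow> complex"
  where "A3 F l z = l (D3_diag F z) / (fact 3 * complex_of_real (norm z ^ 3))"

definition A4 :: "('a::complex_normed_vector \<Rightarrow> 'a) \<Rightarrow> ('a \<Rightarrow> complex) \<Rightarrow> 'a \<Rightarrow> complex"
  where "A4 F l z = l (D4_diag F z) / (fact 4 * complex_of_real (norm z ^ 4))"

definition biholomorphic_onto_image :: "(complex \<Rightarrow> complex) \<Rightarrow> complex set \<Rightarrow> bool"
  where "biholomorphic_onto_image \<phi> S \<longleftrightarrow>
    \<phi> holomorphic_on S \<and> inj_on \<phi> S \<and> open (\<phi> ` S) \<and> inv_into S \<phi> holomorphic_on (\<phi> ` S)"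

definition admissible :: "(complex \<Rightarrow> complex) \<Rightarrow> bool"
  where "admissible \<Phi> \<longleftrightarrow>
    biholomorphic_onto_image \<Phi> (ball 0 1) \<and>
    \<Phi> 0 = 1 \<and>
    (\<forall>\<zeta>\<in>ball 0 1. Re (\<Phi> \<zeta>) > 0) \<and>
    deriv \<Phi> 0 \<in> \<real> \<and> Re (deriv \<Phi> 0) > 0 \<and>
    cnj ` (\<Phi> ` ball 0 1) = \<Phi> ` ball 0 1"

text \<open>
  The Taylor coefficients at 0 of an admissible function are real, so taking the real part
  loses nothing.
\<close>

definition taylor_coeff :: "(complex \<Rightarrow> complex) \<Rightarrow> nat \<Rightarrow> real"
  where "taylor_coeff \<Phi> n = Re ((deriv ^^ n) \<Phi> 0 / fact n)"

text \<open>
  Mappings on the unit ball are total functions whose values outside the ball are irrelevant.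
  If \<open>l (p z) = 0\<close>, the quotient below is 0, which is not in the image of the unit disc when
  \<open>\<Phi>\<close> is admissible; so membership forces \<open>l (p z) \<noteq> 0\<close>.
\<close>

definition class_M :: "(complex \<Rightarrow> complex) \<Rightarrow> ('a::complex_normed_vector \<Rightarrow> 'a) set"
  where "class_M \<Phi> =
    {p. holomorphic_map_on p (ball 0 1) \<and> p 0 = 0 \<and> fderiv p 0 = id_blinfun \<and>
        (\<forall>z\<in>ball 0 1 - {0}. \<forall>l\<in>support_functionals z.
           complex_of_real (norm z) / l (p z) \<in> \<Phi> ` ball 0 1)}"

definition boundedly_invertible :: "('a::real_normed_vector \<Rightarrow>\<^sub>L 'b::real_normed_vector) \<Rightarrow> bool"
  where "boundedly_invertible A \<longleftrightarrow>
    bij (blinfun_apply A) \<and> bounded_linear (inv (blinfun_apply A))"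

definition times_id :: "('a::complex_normed_vector \<Rightarrow> complex) \<Rightarrow> 'a \<Rightarrow> 'a"
  where "times_id f z = f z *\<^sub>C z"

definition class_S :: "(complex \<Rightarrow> complex) \<Rightarrow> ('a::complex_normed_vector \<Rightarrow> complex) set"
  where "class_S \<Phi> =
    {f. holomorphic_map_on f (ball 0 1) \<and> f 0 = 1 \<and>
        (\<forall>z\<in>ball 0 1. boundedly_invertible (fderiv (times_id f) z)) \<and>
        (\<lambda>z. inv (blinfun_apply (fderiv (times_id f) z)) (times_id f z)) \<in> class_M \<Phi>}"

definition Theta1 :: "(real \<times> real) set"
  where "Theta1 = {(a, b). \<bar>a\<bar> \<le> 1/2 \<and> \<bar>b\<bar> \<le> 1}"

definition Theta2 :: "(real \<times> real) set"
  where "Theta2 = {(a, b). 1/2 \<le> \<bar>a\<bar> \<and> \<bar>a\<bar> \<le> 2 \<and>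
    4/27 * (\<bar>a\<bar> + 1)^3 - (\<bar>a\<bar> + 1) \<le> b \<and> b \<le> 1}"

definition Theta3 :: "(real \<times> real) set"
  where "Theta3 = {(a, b). \<bar>a\<bar> \<le> 1/2 \<and> b \<le> -1}"

definition Theta4 :: "(real \<times> real) set"
  where "Theta4 = {(a, b). \<bar>a\<bar> \<ge> 1/2 \<and> b \<le> - (2/3) * (\<bar>a\<bar> + 1)}"

definition Theta5 :: "(real \<times> real) set"
  where "Theta5 = {(a, b). \<bar>a\<bar> \<le> 2 \<and> b \<ge> 1}"

definition Theta6 :: "(real \<times> real) set"
  where "Theta6 = {(a, b). 2 \<le> \<bar>a\<bar> \<and> \<bar>a\<bar> \<le> 4 \<and> b \<ge> 1/12 * (a^2 + 8)}"

definition Theta7 :: "(real \<times> real) set"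
  where "Theta7 = {(a, b). \<bar>a\<bar> \<ge> 4 \<and> b \<ge> 2/3 * (\<bar>a\<bar> - 1)}"

definition Theta8 :: "(real \<times> real) set"
  where "Theta8 = {(a, b). 1/2 \<le> \<bar>a\<bar> \<and> \<bar>a\<bar> \<le> 2 \<and>
    - (2/3) * (\<bar>a\<bar> + 1) \<le> b \<and> b \<le> 4/27 * (\<bar>a\<bar> + 1)^3 - (\<bar>a\<bar> + 1)}"

definition Theta9 :: "(real \<times> real) set"
  where "Theta9 = {(a, b). \<bar>a\<bar> \<ge> 2 \<and> - (2/3) * (\<bar>a\<bar> + 1) \<le> b \<and>
    b \<le> 2 * \<bar>a\<bar> * (\<bar>a\<bar> + 1) / (a^2 + 2 * \<bar>a\<bar> + 4)}"

end

theory Submission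
  imports Defs
begin

text \<open>
  Restriction to complex lines reduces the estimate to a coefficient problem in one variable.
  Let \<open>u\<close> be a unit vector, \<open>l\<close> a support functional of \<open>u\<close> and \<open>\<phi>(\<zeta>) = f(\<zeta>u)\<close>. The vector
  \<open>DF(z)z\<close> is the multiple \<open>f(z) + Df(z)z\<close> of \<open>z\<close>, so \<open>(DF(z))\<^sup>-\<^sup>1F(z) = f(z)/(f(z) + Df(z)z) \<cdot> z\<close>, and the
  hypothesis says that \<open>1 + \<zeta>\<phi>'(\<zeta>)/\<phi>(\<zeta>)\<close> takes its values in \<open>\<Phi>(U)\<close>. As \<open>\<Phi>\<close> is univalent this
  means \<open>\<zeta>\<phi>' = \<phi>(\<Phi> \<circ> \<omega> - 1)\<close> for a Schwarz function \<open>\<omega>(\<zeta>) = c\<^sub>1\<zeta> + c\<^sub>2\<zeta>\<^sup>2 + c\<^sub>3\<zeta>\<^sup>3 + \<dots>\<close>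
  (\<open>class_S_slice\<close>). The numbers \<open>A\<^sub>2, A\<^sub>3, A\<^sub>4\<close> are the first three Taylor coefficients of \<open>\<phi>\<close> after the
  constant one (\<open>A_eq_slice_coeffs\<close>). If \<open>p\<^sub>n\<close> are the coefficients of \<open>\<Phi> \<circ> \<omega>\<close>, the mixed terms cancel
  and \<open>A\<^sub>2A\<^sub>3 - A\<^sub>4 = (p\<^sub>1\<^sup>3 - p\<^sub>3)/3 = -(B\<^sub>1/3)(c\<^sub>3 + q\<^sub>5c\<^sub>1c\<^sub>2 + q\<^sub>6c\<^sub>1\<^sup>3)\<close> (\<open>starlike_coeff_relation\<close>).
\<close>

text \<open>
  What remains is the problem of Prokhorov and Szynal: maximise \<open>|c\<^sub>3 + \<mu>c\<^sub>1c\<^sub>2 + \<nu>c\<^sub>1\<^sup>3|\<close> over Schwarz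
  functions. Two steps of the Schur algorithm parametrise the coefficients by \<open>c = c\<^sub>1\<close>, \<open>x\<close>, \<open>y\<close> with
  \<open>|c| \<le> 1\<close>, \<open>|x| \<le> 1\<close>, \<open>|y| \<le> 1 - |x|\<^sup>2\<close> (\<open>schwarz_function_coeffs\<close>), and a rotation makes \<open>c\<close> real; the
  extremal problem becomes the elementary inequality \<open>schwarz_bound\<close> in \<open>c\<close> and \<open>x\<close>. The key case is
  \<open>\<Theta>\<^sub>8 \<union> \<Theta>\<^sub>9\<close> (\<open>schwarz_bound_extremal\<close>): there the worst \<open>x\<close> is \<open>-1\<close> (for \<open>\<mu> > 0\<close>), which leaves the
  maximum of the cubic \<open>(|\<mu>| + 1)t - (|\<mu>| + 1 + \<nu>)t\<^sup>3\<close>. A second computation settles the parabola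
  \<open>12\<nu> = \<mu>\<^sup>2 + 8\<close> (\<open>schwarz_bound_parabola\<close>). The left side of the inequality is a convex function of \<open>(\<mu>, \<nu>)\<close>
  and changes in a controlled way when \<open>(\<mu>, \<nu>)\<close> moves, so all other regions follow from these two
  families of boundary points.
\<close>

text \<open>
  The \<open>A\<^sub>n\<close> are defined through iterated Frechet derivatives, so one needs that a holomorphic map
  between complex Banach spaces is infinitely differentiable (\<open>holomorphic_map_on_fderiv\<close>). This is
  derived from the scalar Cauchy estimates by testing with functionals, which requires the
  Hahn-Banach theorem (\<open>Hahn_Banach_norming\<close>). The same theorem supplies the support functional \<open>l\<close>
  used for sharpness: given a Schwarz function \<open>\<omega>\<close>, the equation \<open>\<zeta>\<phi>' = \<phi>(\<Phi> \<circ> \<omega> - 1)\<close> is solved by an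
  exponential and \<open>f = \<phi> \<circ> l\<close> satisfies all hypotheses on the whole ball (\<open>extremal_mapping\<close>). The
  Schwarz functions \<open>\<zeta>\<^sup>3\<close>, \<open>\<zeta>\<close> and \<open>\<zeta>(t - \<sigma>\<zeta>)/(1 - \<sigma>t\<zeta>)\<close> with \<open>\<sigma> = \<plusminus>1\<close> give equality in the three cases.
\<close>

section \<open>The extremal problem for Schur parameters\<close>

text \<open>
  The supremum over \<open>|y| \<le> 1 - |x|\<^sup>2\<close> of the modulus of \<open>c\<^sub>3 + \<mu>c\<^sub>1c\<^sub>2 + \<nu>c\<^sub>1\<^sup>3\<close>, when \<open>c\<^sub>1 = c\<close> is real,
  \<open>c\<^sub>2 = (1 - c\<^sup>2)x\<close> and \<open>c\<^sub>3 = (1 - c\<^sup>2)(y - cx\<^sup>2)\<close>, is the left side of this inequality.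
\<close>

definition schwarz_bound :: "real \<Rightarrow> real \<Rightarrow> real \<Rightarrow> bool" where
  "schwarz_bound \<mu> \<nu> K \<longleftrightarrow> (\<forall>c x. 0 \<le> c \<and> c \<le> 1 \<and> cmod x \<le> 1 \<longrightarrow>
     (1 - c^2) * (1 - (cmod x)^2)
       + c * cmod (of_real (\<nu> * c^2) + of_real (1 - c^2) * (of_real \<mu> * x - x^2)) \<le> K)"

lemma schwarz_bound_uminus:
  assumes "schwarz_bound \<mu> \<nu> K" shows "schwarz_bound (- \<mu>) \<nu> K"
  unfolding schwarz_bound_def
proof (intro allI impI, elim conjE)
  fix c :: real and x assume "0 \<le> c" "c \<le> 1" "cmod x \<le> 1"
  then show "(1 - c^2) * (1 - (cmod x)^2)
       + c * cmod (of_real (\<nu> * c^2) + of_real (1 - c^2) * (of_real (- \<mu>) * x - x^2)) \<le> K"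
    using assms[unfolded schwarz_bound_def, rule_format, of c "- x"] by simp
qed

text \<open>
  The left side of the inequality is the modulus of an affine function of \<open>(\<mu>, \<nu>)\<close> plus a term that
  does not involve them, hence convex. This extends estimates from boundary points to regions.
\<close>

lemma schwarz_bound_convex:
  assumes 1: "schwarz_bound \<mu>1 \<nu>1 K1" and 2: "schwarz_bound \<mu>2 \<nu>2 K2"
    and u: "0 \<le> u" "0 \<le> v" "u + v = 1"
  shows "schwarz_bound (u * \<mu>1 + v * \<mu>2) (u * \<nu>1 + v * \<nu>2) (u * K1 + v * K2)"
  unfolding schwarz_bound_def
proof (intro allI impI, elim conjE)
  fix c :: real and x assume c: "0 \<le> c" "c \<le> 1" and x: "cmod x \<le> 1"
  define d where "d = 1 - c^2"
  define w1 where "w1 = of_real (\<nu>1 * c^2) + of_real d * (of_real \<mu>1 * x - x^2)"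
  define w2 where "w2 = of_real (\<nu>2 * c^2) + of_real d * (of_real \<mu>2 * x - x^2)"
  have v: "v = 1 - u" using u by simp
  have eq: "of_real ((u * \<nu>1 + v * \<nu>2) * c^2)
       + of_real d * (of_real (u * \<mu>1 + v * \<mu>2) * x - x^2) = of_real u * w1 + of_real v * w2"
    unfolding w1_def w2_def v by (simp add: algebra_simps)
  have "cmod (of_real u * w1 + of_real v * w2) \<le> u * cmod w1 + v * cmod w2"
    using norm_triangle_ineq[of "of_real u * w1" "of_real v * w2"] u by (simp add: norm_mult)
  then have "c * cmod (of_real u * w1 + of_real v * w2) \<le> c * (u * cmod w1 + v * cmod w2)"
    using c by (intro mult_left_mono)
  moreover have "d * (1 - (cmod x)^2) + c * cmod w1 \<le> K1"
    using 1[unfolded schwarz_bound_def, rule_format, of c x] c x by (simp add: d_def w1_def)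
  then have "u * (d * (1 - (cmod x)^2) + c * cmod w1) \<le> u * K1" using u by (intro mult_left_mono)
  moreover have "d * (1 - (cmod x)^2) + c * cmod w2 \<le> K2"
    using 2[unfolded schwarz_bound_def, rule_format, of c x] c x by (simp add: d_def w2_def)
  then have "v * (d * (1 - (cmod x)^2) + c * cmod w2) \<le> v * K2" using u by (intro mult_left_mono)
  moreover have "u * (d * (1 - (cmod x)^2)) + v * (d * (1 - (cmod x)^2)) = d * (1 - (cmod x)^2)"
    unfolding v by (simp add: algebra_simps)
  ultimately have "d * (1 - (cmod x)^2) + c * cmod (of_real u * w1 + of_real v * w2) \<le> u * K1 + v * K2"
    by (simp add: algebra_simps)
  then show "(1 - c^2) * (1 - (cmod x)^2)
       + c * cmod (of_real ((u * \<nu>1 + v * \<nu>2) * c^2)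
           + of_real (1 - c^2) * (of_real (u * \<mu>1 + v * \<mu>2) * x - x^2)) \<le> u * K1 + v * K2"
    using eq by (simp add: d_def)
qed

text \<open>
  Moving the parameters by \<open>(s, t)\<close> adds \<open>s c (1 - c\<^sup>2) x + t c\<^sup>3\<close> to the functional. With \<open>s = 0\<close> this is
  at most \<open>|t|\<close>, which is how the bound \<open>|\<nu>|\<close> propagates vertically away from a boundary curve.
\<close>

lemma schwarz_bound_shift:
  assumes b: "schwarz_bound \<mu> \<nu> K"
    and e: "\<And>c. 0 \<le> c \<Longrightarrow> c \<le> 1 \<Longrightarrow> \<bar>s\<bar> * c * (1 - c^2) + \<bar>t\<bar> * c^3 \<le> e"
  shows "schwarz_bound (\<mu> + s) (\<nu> + t) (K + e)"
  unfolding schwarz_bound_def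
proof (intro allI impI, elim conjE)
  fix c :: real and x assume c: "0 \<le> c" "c \<le> 1" and x: "cmod x \<le> 1"
  define d where "d = 1 - c^2"
  have d: "0 \<le> d" using c by (simp add: d_def power_le_one)
  define w where "w = of_real (\<nu> * c^2) + of_real d * (of_real \<mu> * x - x^2)"
  define h where "h = of_real (t * c^2) + of_real (d * s) * x"
  have eq: "of_real ((\<nu> + t) * c^2) + of_real d * (of_real (\<mu> + s) * x - x^2) = w + h"
    unfolding w_def h_def by (simp add: algebra_simps)
  have "cmod h \<le> cmod (of_real (t * c^2)) + cmod (of_real (d * s) * x)"
    unfolding h_def by (rule norm_triangle_ineq)
  also have "\<dots> = \<bar>t\<bar> * c^2 + d * \<bar>s\<bar> * cmod x"
    unfolding norm_mult norm_of_real using d c by (simp add: abs_mult)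
  also have "\<dots> \<le> \<bar>t\<bar> * c^2 + d * \<bar>s\<bar>" using d x by (simp add: mult_left_le)
  finally have "c * cmod h \<le> c * (\<bar>t\<bar> * c^2 + d * \<bar>s\<bar>)" using c by (intro mult_left_mono)
  also have "\<dots> \<le> e"
    using e[OF c] by (simp add: d_def algebra_simps power2_eq_square power3_eq_cube)
  finally have h: "c * cmod h \<le> e" .
  have "c * cmod (w + h) \<le> c * (cmod w + cmod h)"
    using c norm_triangle_ineq by (intro mult_left_mono)
  moreover have "d * (1 - (cmod x)^2) + c * cmod w \<le> K"
    using b[unfolded schwarz_bound_def, rule_format, of c x] c x by (simp add: d_def w_def)
  ultimately have "d * (1 - (cmod x)^2) + c * cmod (w + h) \<le> K + e"
    using h by (simp add: algebra_simps)
  then show "(1 - c^2) * (1 - (cmod x)^2) + c * cmod (of_real ((\<nu> + t) * c^2)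
           + of_real (1 - c^2) * (of_real (\<mu> + s) * x - x^2)) \<le> K + e"
    using eq by (simp add: d_def)
qed

text \<open>
  For positive \<open>m\<close> and \<open>m + n\<close>, the maximum over \<open>t \<ge> 0\<close> of the cubic \<open>m t - (m + n) t\<^sup>3\<close>, which is the value of the functional at \<open>c = t\<close>,
  \<open>x = -1\<close> up to sign, with \<open>m = \<mu> + 1\<close> and \<open>n = \<nu>\<close>. It is attained at \<open>t = sqrt (m / (3(m + n)))\<close>.
\<close>

definition extremal_value :: "real \<Rightarrow> real \<Rightarrow> real" where
  "extremal_value m n = 2/3 * m * sqrt (m / (3 * (m + n)))"

lemma extremal_cubic_le:
  fixes m n t :: real
  assumes "0 < m" "0 < m + n" "0 \<le> t"
  shows "m * t - (m + n) * t^3 \<le> extremal_value m n"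
proof -
  define s where "s = sqrt (m / (3 * (m + n)))"
  have s: "0 \<le> s" "m = 3 * (m + n) * s^2" using assms by (auto simp: s_def)
  \<comment> \<open>The difference vanishes to second order at the maximum point \<open>s\<close>.\<close>
  have "2/3 * m * s - (m * t - (m + n) * t^3) = (m + n) * ((t - s)^2 * (t + 2 * s))"
    by (subst (1 2) s(2)) (simp add: power2_eq_square power3_eq_cube algebra_simps)
  also have "\<dots> \<ge> 0" using assms s by simp
  finally show ?thesis by (simp add: s_def extremal_value_def)
qed

text \<open>
  The estimate along the negative ray \<open>x = -r\<close>, with the negative of the term inside the modulus,
  \<open>(1 - c\<^sup>2)(\<mu>r + r\<^sup>2) - \<nu>c\<^sup>2\<close>, in place of the modulus. The
  expression is quadratic in \<open>r\<close>. If its vertex lies beyond \<open>r = 1\<close> the maximum is the cubic at \<open>c\<close>.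
  Otherwise \<open>c < 2/(\<mu> + 2)\<close>, and the vertex value is a function of \<open>c\<close> that is at most \<open>1\<close> or else
  bounded by its value at \<open>c = 2/(\<mu> + 2)\<close>, where it meets the cubic.
\<close>

lemma negative_branch_le:
  fixes \<mu> \<nu> c r K :: real
  assumes mu: "0 \<le> \<mu>" "\<nu> \<le> \<mu>^2 / 4" and c: "0 \<le> c" "c \<le> 1" and r: "0 \<le> r" "r \<le> 1" and K: "1 \<le> K"
    and cubic: "\<And>t. 0 \<le> t \<Longrightarrow> (\<mu> + 1) * t - (\<mu> + 1 + \<nu>) * t^3 \<le> K"
  shows "(1 - c^2) * (1 - r^2) + c * ((1 - c^2) * (\<mu> * r + r^2) - \<nu> * c^2) \<le> K"
proof (cases "2 * (1 - c) \<le> c * \<mu>")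
  case True
  have d: "0 \<le> 1 - c^2" using c by (simp add: power_le_one)
  have "(1 - c) * (1 + r) \<le> (1 - c) * 2" using c r by (intro mult_left_mono) auto
  then have "0 \<le> (1 - c^2) * ((1 - r) * (c * \<mu> - (1 - c) * (1 + r)))"
    using d r True by (intro mult_nonneg_nonneg) auto
  moreover have "(\<mu> + 1) * c - (\<mu> + 1 + \<nu>) * c^3
      = (1 - c^2) * (1 - r^2) + c * ((1 - c^2) * (\<mu> * r + r^2) - \<nu> * c^2)
        + (1 - c^2) * ((1 - r) * (c * \<mu> - (1 - c) * (1 + r)))"
    by (simp add: power2_eq_square power3_eq_cube algebra_simps)
  ultimately show ?thesis using cubic[OF c(1)] by linarith
next
  case False
  define \<alpha> \<gamma> where "\<alpha> = \<mu>^2 / 4 - 1" and "\<gamma> = \<mu>^2 / 4 - \<nu>"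
  have g: "0 \<le> \<gamma>" using mu by (simp add: \<gamma>_def)
  \<comment> \<open>Completing the square in \<open>r\<close>: the left side is the vertex value.\<close>
  have "1 + c^2 * (\<alpha> + c * \<gamma>) = (1 - c^2) * (1 - r^2) + c * ((1 - c^2) * (\<mu> * r + r^2) - \<nu> * c^2)
        + (1 + c) * ((1 - c) * r - c * \<mu> / 2)^2"
    unfolding \<alpha>_def \<gamma>_def by (simp add: power2_eq_square power3_eq_cube algebra_simps)
  then have le: "(1 - c^2) * (1 - r^2) + c * ((1 - c^2) * (\<mu> * r + r^2) - \<nu> * c^2)
      \<le> 1 + c^2 * (\<alpha> + c * \<gamma>)" using c by simp
  show ?thesis
  proof (cases "\<alpha> + c * \<gamma> \<le> 0")
    case True
    then have "c^2 * (\<alpha> + c * \<gamma>) \<le> 0" by (simp add: mult_nonneg_nonpos)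
    with le K show ?thesis by linarith
  next
    case pos: False
    define t where "t = 2 / (\<mu> + 2)"
    have t: "\<mu> * t = 2 - 2 * t" "0 < t" using mu by (simp_all add: t_def field_simps)
    have ct: "c \<le> t" using False mu unfolding t_def by (simp add: field_simps)
    have "\<alpha> + c * \<gamma> \<le> \<alpha> + t * \<gamma>" using ct g by (simp add: mult_right_mono)
    then have "c^2 * (\<alpha> + c * \<gamma>) \<le> t^2 * (\<alpha> + t * \<gamma>)"
      using ct c pos by (intro mult_mono power_mono) auto
    moreover have "1 + t^2 * (\<alpha> + t * \<gamma>) = (\<mu> + 1) * t - (\<mu> + 1 + \<nu>) * t^3"
    proof -
      have "t^2 * \<mu>^2 = (2 - 2 * t)^2" using t(1) by (metis mult.commute power_mult_distrib)
      then have "1 + t^2 * (\<alpha> + t * \<gamma>) = 1 + (1 + t) * (2 - 2 * t)^2 / 4 - t^2 - \<nu> * t^3"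
        unfolding \<alpha>_def \<gamma>_def by (simp add: power2_eq_square power3_eq_cube) algebra
      also have "\<dots> = \<mu> * t * (1 - t^2) + t - t^3 - \<nu> * t^3"
        unfolding t(1) by (simp add: power2_eq_square power3_eq_cube field_simps)
      finally show ?thesis by (simp add: power2_eq_square power3_eq_cube algebra_simps)
    qed
    ultimately show ?thesis using cubic[of t] t(2) le by linarith
  qed
qed

lemma cmod_quadratic_sq:
  fixes A d \<mu> :: real
  shows "(cmod (of_real A + of_real d * (of_real \<mu> * x - x^2)))^2
    = A^2 + d^2 * (cmod x)^2 * (\<mu>^2 + (cmod x)^2 - 2 * \<mu> * Re x)
      + 2 * A * d * (\<mu> * Re x - 2 * (Re x)^2 + (cmod x)^2)"
  unfolding cmod_power2 by (simp add: power2_eq_square algebra_simps)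

text \<open>
  For fixed \<open>|x|\<close> the square of the modulus is a concave quadratic polynomial in \<open>Re x\<close>; the right side is
  its maximum over all real arguments, without the constraint \<open>|Re x| \<le> |x|\<close>.
\<close>

lemma cmod_quadratic_le_vertex:
  fixes A d \<mu> :: real
  assumes A: "0 < A" and d: "0 \<le> d"
  shows "cmod (of_real A + of_real d * (of_real \<mu> * x - x^2))
    \<le> (A + d * (cmod x)^2) * sqrt (1 + d * \<mu>^2 / (4 * A))"
proof (rule power2_le_imp_le)
  define p q where "p = Re x" and "q = (cmod x)^2"
  have "4 * A * ((A + d * q)^2 * (1 + d * \<mu>^2 / (4 * A))) = (A + d * q)^2 * (4 * A + d * \<mu>^2)"
    using A by (simp add: field_simps)
  moreover have "(A + d * q)^2 * (4 * A + d * \<mu>^2) - 4 * A * (A^2 + d^2 * q * (\<mu>^2 + q - 2 * \<mu> * p)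
      + 2 * A * d * (\<mu> * p - 2 * p^2 + q)) = d * (4 * A * p - \<mu> * (A - d * q))^2"
    by (simp add: power2_eq_square algebra_simps)
  moreover have "0 \<le> d * (4 * A * p - \<mu> * (A - d * q))^2" using d by simp
  ultimately have "4 * A * (A^2 + d^2 * q * (\<mu>^2 + q - 2 * \<mu> * p)
      + 2 * A * d * (\<mu> * p - 2 * p^2 + q)) \<le> 4 * A * ((A + d * q)^2 * (1 + d * \<mu>^2 / (4 * A)))"
    by linarith
  then have "A^2 + d^2 * q * (\<mu>^2 + q - 2 * \<mu> * p)
      + 2 * A * d * (\<mu> * p - 2 * p^2 + q) \<le> (A + d * q)^2 * (1 + d * \<mu>^2 / (4 * A))"
    using A by (simp add: mult_le_cancel_left)
  then show "(cmod (of_real A + of_real d * (of_real \<mu> * x - x^2)))^2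
    \<le> ((A + d * (cmod x)^2) * sqrt (1 + d * \<mu>^2 / (4 * A)))^2"
    unfolding cmod_quadratic_sq power_mult_distrib p_def q_def using A d by simp
  show "0 \<le> (A + d * (cmod x)^2) * sqrt (1 + d * \<mu>^2 / (4 * A))" using A d by simp
qed

text \<open>
  The assumption \<open>dom\<close> puts the vertex of that quadratic polynomial at or to the left of \<open>Re x = -|x|\<close>, so
  the modulus is largest at \<open>x = -|x|\<close>.
\<close>

lemma cmod_quadratic_le_negative:
  fixes A d \<mu> :: real
  assumes A: "0 < A" and d: "0 \<le> d" and mu: "0 < \<mu>"
    and dom: "A * (4 * cmod x + \<mu>) \<le> \<mu> * d * (cmod x)^2"
  shows "cmod (of_real A + of_real d * (of_real \<mu> * x - x^2)) \<le> d * (\<mu> * cmod x + (cmod x)^2) - A"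
proof (rule power2_le_imp_le)
  define p r where "p = Re x" and "r = cmod x"
  have pr: "\<bar>p\<bar> \<le> r" by (simp add: p_def r_def abs_Re_le_cmod)
  have D: "A * (4 * r + \<mu>) \<le> \<mu> * d * r^2" using dom by (simp add: r_def)
  have "0 \<le> (p + r) * (2 * d * (\<mu> * d * r^2 - A * (4 * r + \<mu>)) + 4 * A * d * (p + r))"
  proof -
    have "0 \<le> p + r" using pr by linarith
    moreover have "0 \<le> 2 * d * (\<mu> * d * r^2 - A * (4 * r + \<mu>))" using D d by simp
    ultimately show ?thesis using d A by simp
  qed
  moreover have "(d * (\<mu> * r + r^2) - A)^2 - (A^2 + d^2 * r^2 * (\<mu>^2 + r^2 - 2 * \<mu> * p)
      + 2 * A * d * (\<mu> * p - 2 * p^2 + r^2))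
     = (p + r) * (2 * d * (\<mu> * d * r^2 - A * (4 * r + \<mu>)) + 4 * A * d * (p + r))"
    by (simp add: power2_eq_square algebra_simps)
  ultimately show "(cmod (of_real A + of_real d * (of_real \<mu> * x - x^2)))^2
      \<le> (d * (\<mu> * cmod x + (cmod x)^2) - A)^2"
    unfolding cmod_quadratic_sq p_def r_def by linarith
  show "0 \<le> d * (\<mu> * cmod x + (cmod x)^2) - A"
  proof -
    have "0 \<le> r" using pr by linarith
    then have "A * \<mu> \<le> A * (4 * r + \<mu>)" using A by simp
    then have "\<mu> * A \<le> \<mu> * (d * r^2)" using D by (simp add: mult_ac)
    then have "A \<le> d * r^2" using mu by simp
    moreover have "0 \<le> d * (\<mu> * r)" using d mu \<open>0 \<le> r\<close> by simp
    ultimately show ?thesis by (simp add: r_def algebra_simps)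
  qed
qed

text \<open>
  When the vertex is exactly at \<open>Re x = -r\<close> the two preceding estimates agree. This is what allows one to
  pass from the unconstrained bound to the bound along the negative ray.
\<close>

lemma vertex_at_boundary:
  fixes A d \<mu> r :: real
  assumes A: "0 < A" and r: "0 < r" and mu: "0 < \<mu>" and eq: "A * (4 * r + \<mu>) = \<mu> * d * r^2"
  shows "(A + d * r^2) * sqrt (1 + d * \<mu>^2 / (4 * A)) = d * (\<mu> * r + r^2) - A"
proof -
  have "d * \<mu>^2 / (4 * A) = \<mu> * (4 * r + \<mu>) / (4 * r^2)"
  proof -
    have "d * \<mu>^2 * (4 * r^2) = \<mu> * (4 * r + \<mu>) * (4 * A)"
      using eq by (simp add: power2_eq_square) algebra
    then show ?thesis using A r by (simp add: frac_eq_eq)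
  qed
  then have "1 + d * \<mu>^2 / (4 * A) = ((2 * r + \<mu>) / (2 * r))^2"
    using r by (simp add: field_simps power2_eq_square)
  then have "sqrt (1 + d * \<mu>^2 / (4 * A)) = (2 * r + \<mu>) / (2 * r)"
    using r mu by simp
  moreover have "(A + d * r^2) * (2 * r + \<mu>) = (d * (\<mu> * r + r^2) - A) * (2 * r)"
    using eq by (simp add: power2_eq_square) algebra
  ultimately show ?thesis using r by (simp add: nonzero_divide_eq_eq)
qed

text \<open>
  The square of the unconstrained bound at \<open>|x| = 1\<close> as a function of \<open>s = c\<^sup>2\<close>. The assumption \<open>slope\<close> is
  the sign condition on its logarithmic derivative.
\<close>

lemma vertex_bound_in_square_antimono:
  fixes \<beta> \<nu> s0 s :: real
  assumes nu: "0 < \<nu>" and s0: "0 \<le> s0" "s0 \<le> s" "s \<le> 1"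
    and slope: "\<And>u. s0 \<le> u \<Longrightarrow> u \<le> 1 \<Longrightarrow> 2 * (\<nu> - 1) * \<beta> - (\<beta> - 1) \<le> 3 * (\<nu> - 1) * (\<beta> - 1) * u"
  shows "(1 + (\<nu> - 1) * s)^2 * (\<beta> - (\<beta> - 1) * s) \<le> (1 + (\<nu> - 1) * s0)^2 * (\<beta> - (\<beta> - 1) * s0)"
proof (rule DERIV_nonpos_imp_nonincreasing[OF s0(2)])
  fix u assume u: "s0 \<le> u" "u \<le> s"
  define g where "g = (1 + (\<nu> - 1) * u) * (2 * (\<nu> - 1) * \<beta> - (\<beta> - 1) - 3 * (\<nu> - 1) * (\<beta> - 1) * u)"
  have der: "((\<lambda>u. (1 + (\<nu> - 1) * u)^2 * (\<beta> - (\<beta> - 1) * u)) has_real_derivative g) (at u)"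
    unfolding g_def by (auto intro!: derivative_eq_intros simp: power2_eq_square algebra_simps)
  have "1 + (\<nu> - 1) * u = (1 - u) + \<nu> * u" by (simp add: algebra_simps)
  moreover have "0 \<le> \<nu> * u" using u s0 nu by simp
  ultimately have "0 \<le> 1 + (\<nu> - 1) * u" using u s0 by linarith
  then have "g \<le> 0" unfolding g_def using slope[of u] u s0 by (intro mult_nonneg_nonpos) auto
  with der show "\<exists>y. ((\<lambda>u. (1 + (\<nu> - 1) * u)^2 * (\<beta> - (\<beta> - 1) * u)) has_real_derivative y) (at u) \<and> y \<le> 0"
    by blast
qed

text \<open>
  Write \<open>d = 1 - c\<^sup>2\<close>, \<open>A = \<nu>c\<^sup>2\<close>, \<open>r = |x|\<close>. If \<open>A \<le> 0\<close>, or if \<open>A(4r + \<mu>) \<le> \<mu>dr\<^sup>2\<close>, the modulus is at most its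
  value on the negative ray and \<open>negative_branch_le\<close> applies. In the remaining case the unconstrained
  bound is used. Since \<open>\<nu> \<le> \<mu>\<^sup>2/4\<close> it is increasing in \<open>r\<close>, so \<open>r\<close> may be enlarged: for small \<open>c\<close> up to a radius
  at which the vertex reaches the negative ray, for large \<open>c\<close> up to \<open>r = 1\<close>. In the second case the
  bound decreases in \<open>c\<close>, and at the smallest such \<open>c\<close> it is again a value on the negative ray. The
  assumption \<open>nu\<close> is the condition under which this decrease holds; its quadratic alternative is the
  upper boundary of \<open>\<Theta>\<^sub>9\<close>.
\<close>

lemma schwarz_bound_extremal:
  fixes \<mu> \<nu> K :: real
  assumes mu: "0 < \<mu>" "\<nu> \<le> \<mu>^2 / 4" and K: "1 \<le> K"
    and cubic: "\<And>t. 0 \<le> t \<Longrightarrow> (\<mu> + 1) * t - (\<mu> + 1 + \<nu>) * t^3 \<le> K"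
    and nu: "\<nu> \<le> 1 \<or> \<nu> * (\<mu>^2 + 2 * \<mu> + 4) \<le> 2 * \<mu> * (\<mu> + 1)"
  shows "schwarz_bound \<mu> \<nu> K"
  unfolding schwarz_bound_def
proof (intro allI impI, elim conjE)
  fix c :: real and x assume c: "0 \<le> c" "c \<le> 1" and x: "cmod x \<le> 1"
  define d A r where "d = 1 - c^2" and "A = \<nu> * c^2" and "r = cmod x"
  define W where "W = of_real A + of_real d * (of_real \<mu> * x - x^2)"
  have d: "0 \<le> d" using c by (simp add: d_def power_le_one)
  have r: "0 \<le> r" "r \<le> 1" using x by (simp_all add: r_def)
  have branch: "d * (1 - t^2) + c * (d * (\<mu> * t + t^2) - A) \<le> K" if "0 \<le> t" "t \<le> 1" for t
    using negative_branch_le[OF _ mu(2) c that K cubic] mu by (simp add: d_def A_def)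
  have "d * (1 - r^2) + c * cmod W \<le> K"
  proof (cases "A \<le> 0")
    case True
    have "cmod W \<le> cmod (of_real A) + cmod (of_real d * (of_real \<mu> * x - x^2))"
      unfolding W_def by (rule norm_triangle_ineq)
    also have "\<dots> = d * cmod (of_real \<mu> * x - x^2) - A" using True d by (simp add: norm_mult)
    also have "cmod (of_real \<mu> * x - x^2) \<le> \<mu> * r + r^2"
      using norm_triangle_ineq4[of "of_real \<mu> * x" "x^2"] mu by (simp add: norm_mult norm_power r_def)
    finally have "cmod W \<le> d * (\<mu> * r + r^2) - A" using d by (simp add: mult_left_mono)
    then have "c * cmod W \<le> c * (d * (\<mu> * r + r^2) - A)" using c by (intro mult_left_mono)
    with branch[OF r] show ?thesis by linarith
  next
    case False
    then have A: "0 < A" by simp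
    then have nu0: "0 < \<nu>" and c0: "0 < c" using c by (auto simp: A_def zero_less_mult_iff)
    show ?thesis
    proof (cases "A * (4 * r + \<mu>) \<le> \<mu> * d * r^2")
      case True
      then have "cmod W \<le> d * (\<mu> * r + r^2) - A"
        using cmod_quadratic_le_negative[OF A d mu(1), of x] by (simp add: W_def r_def)
      then have "c * cmod W \<le> c * (d * (\<mu> * r + r^2) - A)" using c by (intro mult_left_mono)
      with branch[OF r] show ?thesis by linarith
    next
      case nd: False
      define S where "S = sqrt (1 + d * \<mu>^2 / (4 * A))"
      define \<beta> where "\<beta> = \<mu>^2 / (4 * \<nu>)"
      have beta: "1 \<le> \<beta>" using mu nu0 by (simp add: \<beta>_def field_simps)
      have cS: "c * S = sqrt (\<beta> - (\<beta> - 1) * c^2)"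
      proof -
        have "c^2 * (1 + d * \<mu>^2 / (4 * A)) = \<beta> - (\<beta> - 1) * c^2"
          using c0 nu0 unfolding \<beta>_def A_def d_def by (simp add: field_simps)
        then have "sqrt (c^2 * (1 + d * \<mu>^2 / (4 * A))) = sqrt (\<beta> - (\<beta> - 1) * c^2)" by simp
        then show ?thesis unfolding S_def real_sqrt_mult using c by simp
      qed
      have "1 \<le> \<beta> - (\<beta> - 1) * c^2"
      proof -
        have "(\<beta> - 1) * c^2 \<le> \<beta> - 1" using beta c by (simp add: mult_left_le power_le_one)
        then show ?thesis by linarith
      qed
      then have cS1: "1 \<le> c * S" unfolding cS by simp
      have W: "cmod W \<le> (A + d * r^2) * S"
        using cmod_quadratic_le_vertex[OF A d] by (simp add: W_def r_def S_def)
      have up: "d * (1 - r^2) + c * cmod W \<le> d * (1 - t^2) + c * ((A + d * t^2) * S)" if "r \<le> t" for t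
      proof -
        have "c * cmod W \<le> c * ((A + d * r^2) * S)" using W c by (intro mult_left_mono)
        moreover have "0 \<le> d * (t^2 - r^2) * (c * S - 1)"
          using d cS1 that r by (intro mult_nonneg_nonneg) (auto simp: power_mono)
        ultimately show ?thesis by (simp add: algebra_simps)
      qed
      show ?thesis
      proof (cases "A * (4 + \<mu>) \<le> \<mu> * d")
        case True
        have "\<exists>t\<ge>r. t \<le> 1 \<and> \<mu> * d * t^2 - A * (4 * t + \<mu>) = 0"
          using nd True r by (intro IVT') (auto intro!: continuous_intros)
        then obtain t where t: "r \<le> t" "t \<le> 1" "A * (4 * t + \<mu>) = \<mu> * d * t^2" by auto
        have "t \<noteq> 0" using t(3) A mu by auto
        then have "0 < t" using t r by simp
        from vertex_at_boundary[OF A this mu(1) t(3)] up[OF t(1)] branch[of t] t r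
        show ?thesis by (simp add: S_def)
      next
        case big: False
        \<comment> \<open>At \<open>c\<^sup>2 = s0\<close> and \<open>r = 1\<close> the vertex is exactly at \<open>x = -1\<close>.\<close>
        define s0 where "s0 = \<mu> / (\<nu> * (4 + \<mu>) + \<mu>)"
        have den: "0 < \<nu> * (4 + \<mu>) + \<mu>" using nu0 mu by (simp add: add_pos_pos)
        have s0: "0 < s0" "s0 \<le> 1" "\<nu> * s0 * (4 + \<mu>) = \<mu> * (1 - s0)"
          using den mu nu0 by (simp_all add: s0_def field_simps)
        have "s0 \<le> c^2"
        proof -
          have "\<mu> < c^2 * (\<nu> * (4 + \<mu>) + \<mu>)" using big by (simp add: A_def d_def algebra_simps)
          then show ?thesis using den by (simp add: s0_def field_simps)
        qed
        have slope: "2 * (\<nu> - 1) * \<beta> - (\<beta> - 1) \<le> 3 * (\<nu> - 1) * (\<beta> - 1) * u" if u: "s0 \<le> u" "u \<le> 1" for u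
        proof (cases "\<nu> \<le> 1")
          case True
          have "0 \<le> (\<beta> - 1) * ((1 - \<nu>) * (1 - u) * 3 + \<nu>) + 2 * (1 - \<nu>)"
            using beta True u nu0 by (intro add_nonneg_nonneg mult_nonneg_nonneg) auto
          then show ?thesis by (simp add: algebra_simps)
        next
          case False
          \<comment> \<open>At \<open>u = s0\<close> the condition factors into \<open>\<nu>(\<mu> + 2)\<close> times the defining inequality of \<open>nu\<close>.\<close>
          have "0 \<le> \<nu> * (\<mu> + 2) * (2 * (2 * \<mu> * (\<mu> + 1) - \<nu> * (\<mu>^2 + 2 * \<mu> + 4)))"
            using nu False mu nu0 by (intro mult_nonneg_nonneg) auto
          also have "\<dots> = 3 * (\<nu> - 1) * (\<mu>^2 - 4 * \<nu>) * \<mu>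
              - (2 * (\<nu> - 1) * \<mu>^2 - (\<mu>^2 - 4 * \<nu>)) * (\<nu> * (4 + \<mu>) + \<mu>)"
            by (simp add: power2_eq_square algebra_simps)
          finally have "(2 * (\<nu> - 1) * \<mu>^2 - (\<mu>^2 - 4 * \<nu>)) * (\<nu> * (4 + \<mu>) + \<mu>)
              \<le> 3 * (\<nu> - 1) * (\<mu>^2 - 4 * \<nu>) * \<mu>" by simp
          then have "2 * (\<nu> - 1) * \<mu>^2 - (\<mu>^2 - 4 * \<nu>) \<le> 3 * (\<nu> - 1) * (\<mu>^2 - 4 * \<nu>) * s0"
            using den by (simp add: s0_def pos_le_divide_eq)
          moreover have mb: "\<mu>^2 = 4 * \<nu> * \<beta>" using nu0 by (simp add: \<beta>_def)
          ultimately have "4 * \<nu> * (2 * (\<nu> - 1) * \<beta> - (\<beta> - 1)) \<le> 4 * \<nu> * (3 * (\<nu> - 1) * (\<beta> - 1) * s0)"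
            unfolding mb by (simp add: algebra_simps)
          then have "2 * (\<nu> - 1) * \<beta> - (\<beta> - 1) \<le> 3 * (\<nu> - 1) * (\<beta> - 1) * s0"
            using nu0 by simp
          also have "\<dots> \<le> 3 * (\<nu> - 1) * (\<beta> - 1) * u" using u False beta by (intro mult_left_mono) auto
          finally show ?thesis .
        qed
        define c1 where "c1 = sqrt s0"
        define d1 A1 where "d1 = 1 - s0" and "A1 = \<nu> * s0"
        have c1: "0 < c1" "c1^2 = s0" using s0 by (simp_all add: c1_def)
        have A1: "0 < A1" using nu0 s0 by (simp add: A1_def)
        have eq1: "A1 * (4 * 1 + \<mu>) = \<mu> * d1 * 1^2" using s0(3) by (simp add: A1_def d1_def)
        have c1S: "c1 * sqrt (1 + d1 * \<mu>^2 / (4 * A1)) = sqrt (\<beta> - (\<beta> - 1) * s0)"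
        proof -
          have "s0 * (1 + d1 * \<mu>^2 / (4 * A1)) = \<beta> - (\<beta> - 1) * s0"
            using s0 nu0 unfolding \<beta>_def A1_def d1_def by (simp add: field_simps)
          then show ?thesis unfolding c1_def by (simp flip: real_sqrt_mult)
        qed
        have "c * ((A + d * 1^2) * S) = (1 + (\<nu> - 1) * c^2) * (c * S)"
          by (simp add: A_def d_def algebra_simps)
        also have "\<dots> \<le> (1 + (\<nu> - 1) * s0) * sqrt (\<beta> - (\<beta> - 1) * s0)"
        proof (rule power2_le_imp_le)
          have "1 + (\<nu> - 1) * s0 = (1 - s0) + \<nu> * s0" by (simp add: algebra_simps)
          moreover have "0 \<le> \<nu> * s0" using s0 nu0 by simp
          ultimately have p: "0 \<le> 1 + (\<nu> - 1) * s0" using s0 by linarith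
          have "(\<beta> - 1) * s0 \<le> \<beta> - 1" using beta s0 by (simp add: mult_left_le)
          then have q: "0 \<le> \<beta> - (\<beta> - 1) * s0" by linarith
          show "0 \<le> (1 + (\<nu> - 1) * s0) * sqrt (\<beta> - (\<beta> - 1) * s0)" using p q by simp
          show "((1 + (\<nu> - 1) * c^2) * (c * S))^2 \<le> ((1 + (\<nu> - 1) * s0) * sqrt (\<beta> - (\<beta> - 1) * s0))^2"
            unfolding power_mult_distrib[of _ "c * S"] power_mult_distrib[of _ "sqrt _"] cS
            using vertex_bound_in_square_antimono[OF nu0 _ \<open>s0 \<le> c^2\<close> _ slope] s0 c q
              \<open>1 \<le> \<beta> - (\<beta> - 1) * c^2\<close> by (simp add: power_le_one)
        qed
        also have "\<dots> = (A1 + d1 * 1^2) * (c1 * sqrt (1 + d1 * \<mu>^2 / (4 * A1)))"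
          unfolding c1S by (simp add: A1_def d1_def algebra_simps)
        also have "\<dots> = c1 * (d1 * (\<mu> * 1 + 1^2) - A1)"
          using vertex_at_boundary[OF A1 _ mu(1) eq1] by simp
        also have "\<dots> = (\<mu> + 1) * c1 - (\<mu> + 1 + \<nu>) * c1^3"
          unfolding d1_def A1_def c1(2)[symmetric] by (simp add: power2_eq_square power3_eq_cube algebra_simps)
        also have "\<dots> \<le> K" using cubic c1 by simp
        finally show ?thesis using up[OF r(2)] by simp
      qed
    qed
  qed
  then show "(1 - c^2) * (1 - (cmod x)^2)
       + c * cmod (of_real (\<nu> * c^2) + of_real (1 - c^2) * (of_real \<mu> * x - x^2)) \<le> K"
    by (simp add: d_def r_def W_def A_def)
qed

section \<open>The Prokhorov-Szynal bounds in the parameter regions\<close>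

lemma schwarz_bound_abs:
  assumes "schwarz_bound \<bar>\<mu>\<bar> \<nu> K" shows "schwarz_bound \<mu> \<nu> K"
  using assms schwarz_bound_uminus[OF assms] by (cases "0 \<le> \<mu>") auto

lemma schwarz_bound_Theta8:
  assumes "(\<mu>, \<nu>) \<in> Theta8"
  shows "schwarz_bound \<mu> \<nu> (extremal_value (\<bar>\<mu>\<bar> + 1) \<nu>)"
proof (rule schwarz_bound_abs, rule schwarz_bound_extremal)
  define m where "m = \<bar>\<mu>\<bar> + 1"
  have m: "3/2 \<le> m" "m \<le> 3" "- (2/3) * m \<le> \<nu>" "\<nu> \<le> 4/27 * m^3 - m"
    using assms by (auto simp: Theta8_def m_def)
  show "0 < \<bar>\<mu>\<bar>" using m by (simp add: m_def)
  have cubic: "m * t - (m + \<nu>) * t^3 \<le> extremal_value m \<nu>" if "0 \<le> t" for t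
    using that m by (intro extremal_cubic_le) auto
  then show "(\<bar>\<mu>\<bar> + 1) * t - (\<bar>\<mu>\<bar> + 1 + \<nu>) * t^3 \<le> extremal_value (\<bar>\<mu>\<bar> + 1) \<nu>" if "0 \<le> t" for t
    using that by (simp add: m_def)
  \<comment> \<open>The upper boundary of \<open>\<Theta>\<^sub>8\<close> lies below the parabola \<open>\<nu> = \<mu>\<^sup>2/4\<close> and below \<open>\<nu> = 1\<close>; all three meet at \<open>m = 3\<close>.\<close>
  have "(m - 3) * (4/27 * m^2 + 7/36 * m + 1/12) \<le> 0"
    using m by (intro mult_nonpos_nonneg) auto
  moreover have "(m - 3) * (4/27 * m^2 + 7/36 * m + 1/12) = 4/27 * m^3 - m - (m - 1)^2 / 4"
    by (simp add: power2_eq_square power3_eq_cube field_simps)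
  ultimately have "4/27 * m^3 - m \<le> (m - 1)^2 / 4" by linarith
  then show "\<nu> \<le> \<bar>\<mu>\<bar>^2 / 4" using m by (simp add: m_def)
  have "(m - 3) * (4/27 * m^2 + 4/9 * m + 1/3) \<le> 0"
    using m by (intro mult_nonpos_nonneg) auto
  moreover have "(m - 3) * (4/27 * m^2 + 4/9 * m + 1/3) = 4/27 * m^3 - m - 1"
    by (simp add: power2_eq_square power3_eq_cube field_simps)
  ultimately have "4/27 * m^3 - m \<le> 1" by linarith
  then show "\<nu> \<le> 1 \<or> \<nu> * (\<bar>\<mu>\<bar>^2 + 2 * \<bar>\<mu>\<bar> + 4) \<le> 2 * \<bar>\<mu>\<bar> * (\<bar>\<mu>\<bar> + 1)" using m by simp
  \<comment> \<open>On that boundary the cubic has its maximum \<open>1\<close>, at \<open>t = 3/(2m)\<close>.\<close>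
  have "(m + \<nu>) * (3 / (2 * m))^3 \<le> 4/27 * m^3 * (3 / (2 * m))^3"
    using m by (intro mult_right_mono) auto
  also have "\<dots> = 1/2" using m by (simp add: power3_eq_cube field_simps)
  finally have "1 \<le> m * (3 / (2 * m)) - (m + \<nu>) * (3 / (2 * m))^3" using m by simp
  also have "\<dots> \<le> extremal_value m \<nu>" using m by (intro cubic) auto
  finally show "1 \<le> extremal_value (\<bar>\<mu>\<bar> + 1) \<nu>" by (simp add: m_def)
qed

lemma schwarz_bound_Theta9:
  assumes "(\<mu>, \<nu>) \<in> Theta9"
  shows "schwarz_bound \<mu> \<nu> (extremal_value (\<bar>\<mu>\<bar> + 1) \<nu>)"
proof (rule schwarz_bound_abs, rule schwarz_bound_extremal)
  define a where "a = \<bar>\<mu>\<bar>"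
  have a: "2 \<le> a" "- (2/3) * (a + 1) \<le> \<nu>" "\<nu> \<le> 2 * a * (a + 1) / (a^2 + 2 * a + 4)"
    using assms by (auto simp: Theta9_def a_def)
  have pos: "0 < a^2 + 2 * a + 4" using a by (simp add: add_pos_pos)
  have nu: "\<nu> * (a^2 + 2 * a + 4) \<le> 2 * a * (a + 1)" using a(3) pos by (simp add: pos_le_divide_eq)
  then show "\<nu> \<le> 1 \<or> \<nu> * (\<bar>\<mu>\<bar>^2 + 2 * \<bar>\<mu>\<bar> + 4) \<le> 2 * \<bar>\<mu>\<bar> * (\<bar>\<mu>\<bar> + 1)" by (simp add: a_def)
  show "0 < \<bar>\<mu>\<bar>" using a by (simp add: a_def)
  have cubic: "(a + 1) * t - (a + 1 + \<nu>) * t^3 \<le> extremal_value (a + 1) \<nu>" if "0 \<le> t" for t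
  proof (rule extremal_cubic_le)
    show "0 < a + 1 + \<nu>" using a(1,2) by (simp add: field_simps)
  qed (use that a in auto)
  then show "(\<bar>\<mu>\<bar> + 1) * t - (\<bar>\<mu>\<bar> + 1 + \<nu>) * t^3 \<le> extremal_value (\<bar>\<mu>\<bar> + 1) \<nu>" if "0 \<le> t" for t
    using that by (simp add: a_def)
  have "0 \<le> (a - 2) * (a^2 + 4 * a + 4)" using a by (intro mult_nonneg_nonneg) auto
  then have "0 \<le> a * ((a - 2) * (a^2 + 4 * a + 4))" using a by simp
  then have "2 * a * (a + 1) \<le> a^2 / 4 * (a^2 + 2 * a + 4)"
    by (simp add: power2_eq_square algebra_simps)
  with nu have "\<nu> * (a^2 + 2 * a + 4) \<le> a^2 / 4 * (a^2 + 2 * a + 4)" by linarith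
  then have le: "\<nu> \<le> a^2 / 4" using pos by (simp only: mult_le_cancel_right_pos)
  then show "\<nu> \<le> \<bar>\<mu>\<bar>^2 / 4" by (simp add: a_def)
  \<comment> \<open>Because \<open>\<nu> \<le> a\<^sup>2/4\<close>, the value of the cubic at this point is at least \<open>2 - 2t\<close>, hence at least \<open>1\<close>.\<close>
  define t where "t = 2 / (a + 2)"
  have t: "0 < t" "t \<le> 1/2" "a = 2 / t - 2" using a by (simp_all add: t_def field_simps)
  have "(a + 1 + \<nu>) * t^3 \<le> (a + 1 + a^2 / 4) * t^3" using le t by (intro mult_right_mono) auto
  also have "\<dots> = t" unfolding t(3) using t(1) by (simp add: power2_eq_square power3_eq_cube field_simps)
  finally have "a * t \<le> (a + 1) * t - (a + 1 + \<nu>) * t^3" by (simp add: algebra_simps)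
  moreover have "a * t = 2 - 2 * t" unfolding t(3) using t(1) by (simp add: field_simps)
  ultimately have "1 \<le> extremal_value (a + 1) \<nu>" using cubic[of t] t by linarith
  then show "1 \<le> extremal_value (\<bar>\<mu>\<bar> + 1) \<nu>" by (simp add: a_def)
qed

text \<open>
  On the parabola \<open>12\<nu> = \<mu>\<^sup>2 + 8\<close>, the lower boundary of \<open>\<Theta>\<^sub>6\<close>, the unconstrained bound already suffices:
  it is largest at \<open>|x| = 1\<close>, where with \<open>e = (1 - c\<^sup>2)(\<nu> - 1)/\<nu>\<close> it equals \<open>\<nu>(1 - e) sqrt (1 + 2e)\<close>, and \<open>(1 - e)\<^sup>2(1 + 2e) \<le> 1\<close>. The points
  \<open>(\<plusminus>2, 1)\<close> and \<open>(\<plusminus>4, 2)\<close> on it are the corners from which other regions are reached.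
\<close>

lemma schwarz_bound_parabola:
  fixes \<mu> \<nu> :: real
  assumes nu: "1 \<le> \<nu>" and mu: "\<mu>^2 = 12 * \<nu> - 8"
  shows "schwarz_bound \<mu> \<nu> \<nu>"
  unfolding schwarz_bound_def
proof (intro allI impI, elim conjE)
  fix c :: real and x assume c: "0 \<le> c" "c \<le> 1" and x: "cmod x \<le> 1"
  define d A r e where "d = 1 - c^2" and "A = \<nu> * c^2" and "r = cmod x" and "e = d * (\<nu> - 1) / \<nu>"
  define W where "W = of_real A + of_real d * (of_real \<mu> * x - x^2)"
  have d: "0 \<le> d" "d \<le> 1" using c by (auto simp: d_def power_le_one)
  have r: "r^2 \<le> 1" using x by (simp add: r_def power_le_one)
  have "d * (1 - r^2) + c * cmod W \<le> \<nu>"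
  proof (cases "c = 0")
    case True
    then have "d * (1 - r^2) + c * cmod W \<le> 1" using d r by (simp add: mult_le_one)
    then show ?thesis using nu by simp
  next
    case False
    then have c0: "0 < c" using c by simp
    then have A: "0 < A" using nu by (simp add: A_def)
    define S where "S = sqrt (1 + d * \<mu>^2 / (4 * A))"
    have "d * (\<nu> - 1) \<le> 1 * (\<nu> - 1)" using d nu by (intro mult_right_mono) auto
    then have e: "0 \<le> e" "e \<le> 1" using d nu by (simp_all add: e_def)
    have cS: "c * S = sqrt (1 + 2 * e)"
    proof -
      have "c^2 * (1 + d * \<mu>^2 / (4 * A)) = 1 + 2 * e"
        unfolding mu e_def A_def d_def using c0 nu by (simp add: field_simps)
      then have "sqrt (c^2 * (1 + d * \<mu>^2 / (4 * A))) = sqrt (1 + 2 * e)" by simp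
      then show ?thesis unfolding S_def real_sqrt_mult using c by simp
    qed
    have "cmod W \<le> (A + d * r^2) * S"
      using cmod_quadratic_le_vertex[OF A d(1)] by (simp add: W_def r_def S_def)
    then have "c * cmod W \<le> c * ((A + d * r^2) * S)" using c by (intro mult_left_mono)
    also have "\<dots> = (A + d * r^2) * (c * S)" by simp
    finally have "d * (1 - r^2) + c * cmod W \<le> d * (1 - r^2) + (A + d * r^2) * (c * S)" by simp
    also have "\<dots> \<le> d * (1 - r^2) * (c * S) + (A + d * r^2) * (c * S)"
    proof -
      have "1 \<le> c * S" unfolding cS using e by simp
      then have "d * (1 - r^2) * 1 \<le> d * (1 - r^2) * (c * S)" using d r by (intro mult_left_mono) auto
      then show ?thesis by simp
    qed
    also have "\<dots> = (A + d) * (c * S)" by (simp add: algebra_simps)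
    also have "A + d = \<nu> * (1 - e)" unfolding A_def e_def d_def using nu by (simp add: field_simps)
    also have "\<nu> * (1 - e) * (c * S) = \<nu> * ((1 - e) * sqrt (1 + 2 * e))" unfolding cS by simp
    also have "\<dots> \<le> \<nu> * 1"
    proof (intro mult_left_mono)
      have "1 - (1 - e)^2 * (1 + 2 * e) = e^2 * (3 - 2 * e)"
        by (simp add: power2_eq_square algebra_simps)
      also have "\<dots> \<ge> 0" using e by simp
      finally have "((1 - e) * sqrt (1 + 2 * e))^2 \<le> 1^2" using e by (simp add: power_mult_distrib)
      then show "(1 - e) * sqrt (1 + 2 * e) \<le> 1" by (rule power2_le_imp_le) simp
    qed (use nu in simp)
    finally show ?thesis by simp
  qed
  then show "(1 - c^2) * (1 - (cmod x)^2)
       + c * cmod (of_real (\<nu> * c^2) + of_real (1 - c^2) * (of_real \<mu> * x - x^2)) \<le> \<nu>"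
    by (simp add: d_def r_def W_def A_def)
qed

lemma schwarz_bound_vertical_segment:
  assumes "schwarz_bound \<mu> \<nu>1 1" "schwarz_bound \<mu> \<nu>2 1" "\<nu>1 \<le> \<nu>" "\<nu> \<le> \<nu>2"
  shows "schwarz_bound \<mu> \<nu> 1"
proof (cases "\<nu>1 = \<nu>2")
  case False
  then have d: "0 < \<nu>2 - \<nu>1" using assms by simp
  define v where "v = (\<nu> - \<nu>1) / (\<nu>2 - \<nu>1)"
  have "v * (\<nu>2 - \<nu>1) = \<nu> - \<nu>1" using d by (simp add: v_def)
  then have "\<nu> = (1 - v) * \<nu>1 + v * \<nu>2" by (simp add: algebra_simps)
  moreover have "0 \<le> v" "v \<le> 1" using assms d by (simp_all add: v_def)
  ultimately have v: "0 \<le> v" "v \<le> 1" "\<nu> = (1 - v) * \<nu>1 + v * \<nu>2" by auto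
  have "(1 - v) * \<mu> + v * \<mu> = \<mu>" "(1 - v) * 1 + v * 1 = (1::real)" by (simp_all add: algebra_simps)
  then show ?thesis
    using schwarz_bound_convex[OF assms(1,2), of "1 - v" v] v by simp
qed (use assms in auto)

lemma schwarz_bound_horizontal_segment:
  assumes "schwarz_bound k \<nu> 1" "0 < k" "\<bar>\<mu>\<bar> \<le> k"
  shows "schwarz_bound \<mu> \<nu> 1"
proof -
  define v where "v = (k - \<mu>) / (2 * k)"
  have v: "0 \<le> v" "v \<le> 1" "\<mu> = (1 - v) * k + v * (- k)"
    using assms by (simp_all add: v_def field_simps)
  have "(1 - v) * \<nu> + v * \<nu> = \<nu>" "(1 - v) * 1 + v * 1 = (1::real)" by (simp_all add: algebra_simps)
  then show ?thesis
    using schwarz_bound_convex[OF assms(1) schwarz_bound_uminus[OF assms(1)], of "1 - v" v] v by simp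
qed

lemma schwarz_bound_1_top:
  assumes "\<bar>\<mu>\<bar> \<le> 2" shows "schwarz_bound \<mu> 1 1"
  using schwarz_bound_horizontal_segment[OF schwarz_bound_parabola[of 1 2]] assms by simp

lemma boundary_curve_ge:
  fixes m :: real
  assumes m: "3/2 \<le> m"
  shows "- (2/3) * m \<le> 4/27 * m^3 - m"
proof -
  have "(3/2)^2 \<le> m^2" using m by (intro power_mono) auto
  then have "(3/2)^2 * m \<le> m^2 * m" using m by (intro mult_right_mono) auto
  then show ?thesis by (simp add: power2_eq_square power3_eq_cube)
qed

lemma schwarz_bound_1_lower_curve:
  assumes "1/2 \<le> \<bar>\<mu>\<bar>" "\<bar>\<mu>\<bar> \<le> 2"
  shows "schwarz_bound \<mu> (4/27 * (\<bar>\<mu>\<bar> + 1)^3 - (\<bar>\<mu>\<bar> + 1)) 1"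
proof -
  define m where "m = \<bar>\<mu>\<bar> + 1"
  have m: "3/2 \<le> m" using assms by (simp add: m_def)
  have "- (2/3) * m \<le> 4/27 * m^3 - m" by (rule boundary_curve_ge[OF m])
  then have "(\<mu>, 4/27 * m^3 - m) \<in> Theta8"
    using assms unfolding Theta8_def m_def by simp
  moreover have "extremal_value m (4/27 * m^3 - m) = 1"
  proof -
    have "m / (3 * (m + (4/27 * m^3 - m))) = (3 / (2 * m))^2"
      using m by (simp add: power2_eq_square power3_eq_cube field_simps)
    then have "sqrt (m / (3 * (m + (4/27 * m^3 - m)))) = 3 / (2 * m)" using m by simp
    then show ?thesis unfolding extremal_value_def using m by simp
  qed
  ultimately show ?thesis using schwarz_bound_Theta8[of \<mu> "4/27 * m^3 - m"] by (simp add: m_def)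
qed

text \<open>
  \<open>\<Theta>\<^sub>1\<close> and \<open>\<Theta>\<^sub>2\<close> are covered by vertical segments between the line \<open>\<nu> = 1\<close>, \<open>|\<mu>| \<le> 2\<close>, and the curve where
  \<open>extremal_value\<close> equals \<open>1\<close>, continued by the segment \<open>\<nu> = -1\<close>, \<open>|\<mu>| \<le> 1/2\<close>.
\<close>

lemma schwarz_bound_1:
  assumes "(\<mu>, \<nu>) \<in> Theta1 \<union> Theta2 \<union> {(2, 1)}"
  shows "schwarz_bound \<mu> \<nu> 1"
proof -
  consider "\<bar>\<mu>\<bar> \<le> 1/2" "\<bar>\<nu>\<bar> \<le> 1" | "(\<mu>, \<nu>) \<in> Theta2" | "\<mu> = 2" "\<nu> = 1"
    using assms by (auto simp: Theta1_def)
  then show ?thesis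
  proof cases
    case 1
    have "schwarz_bound \<mu> (- 1) 1"
      using schwarz_bound_horizontal_segment[OF schwarz_bound_1_lower_curve[of "1/2"]] 1
      by (simp add: power3_eq_cube)
    then show ?thesis
      using schwarz_bound_vertical_segment[OF _ schwarz_bound_1_top] 1 by simp
  next
    case 2
    then show ?thesis
      using schwarz_bound_vertical_segment[OF schwarz_bound_1_lower_curve schwarz_bound_1_top]
      by (simp add: Theta2_def)
  next
    case 3
    then show ?thesis using schwarz_bound_1_top by simp
  qed
qed

lemma schwarz_bound_shift_vertical:
  assumes "schwarz_bound \<mu> \<nu>0 K" "K + \<bar>\<nu> - \<nu>0\<bar> = K'"
  shows "schwarz_bound \<mu> \<nu> K'"
proof -
  have "\<bar>0\<bar> * c * (1 - c^2) + \<bar>\<nu> - \<nu>0\<bar> * c^3 \<le> \<bar>\<nu> - \<nu>0\<bar>" if "0 \<le> c" "c \<le> 1" for c :: real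
    using that by (simp add: mult_left_le power_le_one)
  from schwarz_bound_shift[OF assms(1) this] show ?thesis using assms(2) by simp
qed

text \<open>
  In each region \<open>\<nu>\<close> is moved vertically to a boundary curve on which the bound \<open>|\<nu>|\<close> is known. On the
  upper boundary of \<open>\<Theta>\<^sub>4\<close> the cubic has its maximum at \<open>t = 1\<close>, where it equals \<open>-\<nu>\<close>; the lower boundary of \<open>\<Theta>\<^sub>7\<close>
  is a half-line that starts at the corner \<open>(4, 2)\<close>.
\<close>

lemma schwarz_bound_abs_nu:
  assumes "(\<mu>, \<nu>) \<in> Theta3 \<union> Theta4 \<union> Theta5 \<union> Theta6 \<union> Theta7"
  shows "schwarz_bound \<mu> \<nu> \<bar>\<nu>\<bar>"
proof -
  define a where "a = \<bar>\<mu>\<bar>"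
  consider "a \<le> 1/2" "\<nu> \<le> -1" | "1/2 \<le> a" "\<nu> \<le> - (2/3) * (a + 1)" | "a \<le> 2" "1 \<le> \<nu>"
    | "2 \<le> a" "1/12 * (a^2 + 8) \<le> \<nu>" | "4 \<le> a" "2/3 * (a - 1) \<le> \<nu>"
    using assms by (auto simp: Theta3_def Theta4_def Theta5_def Theta6_def Theta7_def a_def)
  then have "schwarz_bound a \<nu> \<bar>\<nu>\<bar>"
  proof cases
    case 1
    have "schwarz_bound a (-1) 1" using 1 by (intro schwarz_bound_1) (auto simp: Theta1_def a_def)
    then show ?thesis by (rule schwarz_bound_shift_vertical) (use 1 in simp)
  next
    case 2
    have a: "0 \<le> a" using 2 by simp
    have "extremal_value (a + 1) (- (2/3) * (a + 1)) = 2/3 * (a + 1)"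
    proof -
      have "(a + 1) / (3 * ((a + 1) + (- (2/3) * (a + 1)))) = 1" using a by (simp add: field_simps)
      then show ?thesis unfolding extremal_value_def by (simp only: real_sqrt_one mult_1_right)
    qed
    moreover have "(a, - (2/3) * (a + 1)) \<in> Theta8 \<union> Theta9"
    proof (cases "a \<le> 2")
      case True
      define m where "m = a + 1"
      have m: "3/2 \<le> m" using 2 by (simp add: m_def)
      have "- (2/3) * m \<le> 4/27 * m^3 - m" by (rule boundary_curve_ge[OF m])
      then show ?thesis using True 2 a by (simp add: Theta8_def m_def)
    next
      case False
      have "- (2/3) * (a + 1) \<le> 0" using a by simp
      also have "0 \<le> 2 * a * (a + 1) / (a^2 + 2 * a + 4)" using a by simp
      finally show ?thesis using False a by (simp add: Theta9_def)
    qed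
    ultimately have "schwarz_bound a (- (2/3) * (a + 1)) (2/3 * (a + 1))"
      using schwarz_bound_Theta8 schwarz_bound_Theta9 a by (metis Un_iff abs_of_nonneg)
    then show ?thesis
    proof (rule schwarz_bound_shift_vertical)
      have "\<nu> \<le> 0" using 2 by (simp add: field_simps)
      then show "2/3 * (a + 1) + \<bar>\<nu> - - (2/3) * (a + 1)\<bar> = \<bar>\<nu>\<bar>"
        using 2 by (subst (1 2) abs_of_nonpos) simp_all
    qed
  next
    case 3
    have "schwarz_bound a 1 1" using 3 by (intro schwarz_bound_1_top) (auto simp: a_def)
    then show ?thesis by (rule schwarz_bound_shift_vertical) (use 3 in simp)
  next
    case 4
    define n where "n = 1/12 * (a^2 + 8)"
    have "2^2 \<le> a^2" using 4 by (intro power_mono) auto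
    then have n1: "1 \<le> n" by (simp add: n_def)
    have "12 * n = a^2 + 8" by (simp add: n_def)
    then have "a^2 = 12 * n - 8" by linarith
    with n1 have "schwarz_bound a n n" by (rule schwarz_bound_parabola)
    moreover have "n + \<bar>\<nu> - n\<bar> = \<bar>\<nu>\<bar>"
      using 4 n1 unfolding n_def[symmetric] by linarith
    ultimately show ?thesis by (rule schwarz_bound_shift_vertical)
  next
    case 5
    have "schwarz_bound 4 2 2" by (rule schwarz_bound_parabola) auto
    moreover have "\<bar>a - 4\<bar> * c * (1 - c^2) + \<bar>2/3 * (a - 4)\<bar> * c^3 \<le> 2/3 * (a - 4)"
      if "0 \<le> c" "c \<le> 1" for c
    proof -
      define s where "s = a - 4"
      have s: "0 \<le> s" using 5 by (simp add: s_def)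
      \<comment> \<open>That is, \<open>c(1 - c\<^sup>2) + 2/3 c\<^sup>3 \<le> 2/3\<close> along the direction \<open>(1, 2/3)\<close> of the half-line.\<close>
      have "2/3 * s - (s * c * (1 - c^2) + 2/3 * s * c^3) = s / 3 * ((1 - c)^2 * (2 + c))"
        by (simp add: power2_eq_square power3_eq_cube field_simps)
      also have "\<dots> \<ge> 0" using s that by simp
      finally show ?thesis using s by (simp flip: s_def)
    qed
    ultimately have b: "schwarz_bound (4 + (a - 4)) (2 + 2/3 * (a - 4)) (2 + 2/3 * (a - 4))"
      by (rule schwarz_bound_shift)
    have e: "4 + (a - 4) = a" "2 + 2/3 * (a - 4) = 2/3 * (a - 1)" by (simp_all add: field_simps)
    have "schwarz_bound a (2/3 * (a - 1)) (2/3 * (a - 1))" using b unfolding e .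
    then show ?thesis by (rule schwarz_bound_shift_vertical) (use 5 in simp)
  qed
  then show ?thesis unfolding a_def by (rule schwarz_bound_abs)
qed

text \<open>
  Rotating the variable reduces complex \<open>c\<close> to \<open>|c|\<close>: if \<open>c = |c|\<tau>\<close>, replace \<open>x\<close> by \<open>x\<close> times the square of the conjugate of
  \<open>\<tau>\<close> and factor out \<open>\<tau>\<^sup>3\<close>.
\<close>

lemma schur_parameter_functional_le:
  fixes c x y :: complex and \<mu> \<nu> K :: real
  assumes b: "schwarz_bound \<mu> \<nu> K"
    and c: "cmod c \<le> 1" and x: "cmod x \<le> 1" and y: "cmod y \<le> 1 - (cmod x)^2"
  defines "d \<equiv> of_real (1 - (cmod c)^2) :: complex"
  shows "cmod (d * (y - cnj c * x^2) + of_real \<mu> * c * (d * x) + of_real \<nu> * c^3) \<le> K"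
proof -
  define \<tau> where "\<tau> = cis (Arg c)"
  have \<tau>: "cmod \<tau> = 1" "of_real (cmod c) * \<tau> = c"
    unfolding \<tau>_def by (rule norm_cis) (rule rcis_cmod_Arg[unfolded rcis_def])
  have tt: "\<tau> * cnj \<tau> = 1" using \<tau>(1) by (simp add: complex_norm_square[symmetric])
  define r where "r = cmod c"
  define x' where "x' = x * cnj \<tau>^2"
  have x': "cmod x' = cmod x" by (simp add: x'_def norm_mult norm_power \<tau>(1))
  define W where "W = of_real (\<nu> * r^2) + of_real (1 - r^2) * (of_real \<mu> * x' - x'^2)"
  have 1: "\<tau>^3 * x' = \<tau> * x"
  proof -
    have "\<tau>^3 * x' = \<tau> * x * (\<tau> * cnj \<tau>)^2" unfolding x'_def by (simp add: power2_eq_square power3_eq_cube)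
    then show ?thesis by (simp add: tt)
  qed
  have 2: "\<tau>^3 * x'^2 = cnj \<tau> * x^2"
  proof -
    have "\<tau>^3 * x'^2 = cnj \<tau> * x^2 * (\<tau> * cnj \<tau>)^3"
      unfolding x'_def by (simp add: power2_eq_square power3_eq_cube)
    then show ?thesis by (simp add: tt)
  qed
  have rc: "of_real r * \<tau> = c" using \<tau>(2) by (simp only: r_def)
  have "of_real r * \<tau>^3 * W = of_real \<nu> * (of_real r * \<tau>)^3
      + of_real r * of_real (1 - r^2) * (of_real \<mu> * (\<tau>^3 * x') - \<tau>^3 * x'^2)"
    unfolding W_def by (simp add: power2_eq_square power3_eq_cube algebra_simps)
  also have "\<dots> = of_real \<nu> * (of_real r * \<tau>)^3
      + of_real (1 - r^2) * (of_real \<mu> * (of_real r * \<tau>) * x - cnj (of_real r * \<tau>) * x^2)"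
    unfolding 1 2 by (simp add: algebra_simps)
  also have "\<dots> = of_real \<nu> * c^3 + d * (of_real \<mu> * c * x - cnj c * x^2)"
    unfolding rc by (simp add: d_def r_def)
  finally have eq: "d * (y - cnj c * x^2) + of_real \<mu> * c * (d * x) + of_real \<nu> * c^3
      = d * y + of_real r * \<tau>^3 * W"
    by (simp add: algebra_simps)
  have dn: "cmod d = 1 - r^2"
    unfolding d_def norm_of_real using c by (simp add: r_def power_le_one)
  have "cmod (d * y + of_real r * \<tau>^3 * W) \<le> cmod (d * y) + cmod (of_real r * \<tau>^3 * W)"
    by (rule norm_triangle_ineq)
  also have "\<dots> = (1 - r^2) * cmod y + r * cmod W"
    by (simp add: norm_mult norm_power \<tau>(1) dn) (simp add: r_def)
  also have "\<dots> \<le> (1 - r^2) * (1 - (cmod x')^2) + r * cmod W"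
    unfolding x' using y c by (intro add_right_mono mult_left_mono) (auto simp: r_def power_le_one)
  also have "\<dots> \<le> K"
    using b[unfolded schwarz_bound_def, rule_format, of r x'] c x x' by (simp add: r_def W_def)
  finally show ?thesis unfolding eq .
qed

section \<open>Coefficients of Schwarz functions\<close>

text \<open>
  One step of the Schur algorithm, written without division so that it also covers a unimodular constant
  \<open>g\<close>; there \<open>k = 0\<close> satisfies the equation.
\<close>

lemma schur_step:
  assumes hol: "g holomorphic_on ball 0 1" and le: "\<And>z. cmod z < 1 \<Longrightarrow> cmod (g z) \<le> 1"
  obtains k where "k holomorphic_on ball 0 1" "\<And>z. cmod z < 1 \<Longrightarrow> cmod (k z) \<le> 1"
    "\<And>z. cmod z < 1 \<Longrightarrow> g z * (1 + cnj (g 0) * (z * k z)) = g 0 + z * k z"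
proof (cases "\<exists>z. cmod z < 1 \<and> cmod (g z) = 1")
  case True
  then obtain z0 where z0: "cmod z0 < 1" "cmod (g z0) = 1" by blast
  have "g constant_on ball 0 1"
    by (rule maximum_modulus_principle[OF hol, where U = "ball 0 1" and \<xi> = z0]) (use z0 le in auto)
  then obtain b where b: "\<And>z. cmod z < 1 \<Longrightarrow> g z = b" by (auto simp: constant_on_def)
  show ?thesis by (rule that[of "\<lambda>_. 0"]) (simp_all add: b)
next
  case False
  then have lt: "cmod (g z) < 1" if "cmod z < 1" for z using le[OF that] that by fastforce
  define a where "a = g 0"
  have a: "cmod a < 1" using lt[of 0] by (simp add: a_def)
  define G where "G = (\<lambda>z. Moebius_function 0 a (g z))"
  have "Moebius_function 0 a \<circ> g holomorphic_on ball 0 1"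
    by (rule holomorphic_on_compose_gen[OF hol Moebius_function_holomorphic[OF a]]) (use lt in auto)
  then have G: "G holomorphic_on ball 0 1" by (simp add: G_def o_def)
  have G0: "G 0 = 0" by (simp add: G_def a_def Moebius_function_eq_zero)
  have G1: "cmod (G z) < 1" if "cmod z < 1" for z
    unfolding G_def by (rule Moebius_function_norm_lt_1[OF a lt[OF that]])
  obtain k where k: "k holomorphic_on ball 0 1" "\<And>z. cmod z < 1 \<Longrightarrow> G z = z * k z" "deriv G 0 = k 0"
    using Schwarz3[OF G G0] by blast
  show ?thesis
  proof (rule that[OF k(1)])
    fix z :: complex assume z: "cmod z < 1"
    show "cmod (k z) \<le> 1"
    proof (cases "z = 0")
      case True
      then show ?thesis using Schwarz_Lemma(2)[OF G G0 G1, of 0] k(3) by simp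
    next
      case False
      have "cmod z * cmod (k z) \<le> cmod z * 1"
        using Schwarz_Lemma(1)[OF G G0 G1 z] k(2)[OF z] by (simp add: norm_mult)
      then show ?thesis using False by simp
    qed
    have "cmod (cnj a * g z) < 1"
      using a lt[OF z] mult_strict_mono[of "cmod a" 1 "cmod (g z)" 1] by (simp add: norm_mult)
    then have "1 - cnj a * g z \<noteq> 0" by (metis less_irrefl norm_one right_minus_eq)
    moreover have "z * k z = (g z - a) / (1 - cnj a * g z)"
      using k(2)[OF z] by (simp add: G_def Moebius_function_simple)
    ultimately have "z * k z * (1 - cnj a * g z) = g z - a" by simp
    then show "g z * (1 + cnj (g 0) * (z * k z)) = g 0 + z * k z"
      by (simp add: a_def algebra_simps)
  qed
qed

lemma fps_eq_of_eventually_eq: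
  fixes f g :: "complex \<Rightarrow> complex"
  assumes "f has_fps_expansion F" "g has_fps_expansion G" "\<forall>\<^sub>F z in nhds 0. f z = g z"
  shows "F = G"
  using assms has_fps_expansion_cong[OF assms(3) refl, of F] fps_expansion_unique_complex by blast

lemma schur_step_coeffs:
  assumes hol: "g holomorphic_on ball 0 1" and k: "k holomorphic_on ball 0 1"
    and eq: "\<And>z. cmod z < 1 \<Longrightarrow> g z * (1 + cnj (g 0) * (z * k z)) = g 0 + z * k z"
    and G: "g has_fps_expansion G" and K: "k has_fps_expansion K"
  shows "fps_nth G 1 = of_real (1 - (cmod (g 0))^2) * fps_nth K 0"
    and "fps_nth G 2 = of_real (1 - (cmod (g 0))^2) * (fps_nth K 1 - cnj (g 0) * fps_nth K 0 ^ 2)"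
proof -
  define a where "a = g 0"
  have "(\<lambda>z. g z * (1 + cnj a * (z * k z))) has_fps_expansion G * (1 + fps_const (cnj a) * (fps_X * K))"
    by (intro fps_expansion_intros G K)
  moreover have "(\<lambda>z. a + z * k z) has_fps_expansion fps_const a + fps_X * K"
    by (intro fps_expansion_intros K)
  moreover have "\<forall>\<^sub>F z in nhds 0. g z * (1 + cnj a * (z * k z)) = a + z * k z"
    using eventually_nhds_in_open[of "ball 0 1" "0::complex"]
    by (rule eventually_mono) (auto simp: a_def eq)
  ultimately have "G * (1 + fps_const (cnj a) * (fps_X * K)) = fps_const a + fps_X * K"
    by (rule fps_eq_of_eventually_eq)
  then have E: "G + fps_const (cnj a) * (fps_X * (G * K)) = fps_const a + fps_X * K"
    by (simp add: algebra_simps)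
  have G0: "fps_nth G 0 = a" using has_fps_expansion_imp_0_eq_fps_nth_0[OF G] by (simp add: a_def)
  have d: "of_real (1 - (cmod a)^2) = 1 - cnj a * a"
    by (simp only: of_real_diff of_real_1 complex_norm_square mult.commute)
  from arg_cong[OF E, of "\<lambda>f. fps_nth f 1"] have 1: "fps_nth G 1 = (1 - cnj a * a) * fps_nth K 0"
    by (simp add: G0 algebra_simps)
  from arg_cong[OF E, of "\<lambda>f. fps_nth f 2"]
  have 2: "fps_nth G 2 + cnj a * (a * fps_nth K 1 + fps_nth G 1 * fps_nth K 0) = fps_nth K 1"
    by (simp add: G0 numeral_2_eq_2 fps_mult_nth sum.atLeast0_atMost_Suc)
  show "fps_nth G 1 = of_real (1 - (cmod (g 0))^2) * fps_nth K 0"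
    using 1 d by (simp add: a_def)
  have "fps_nth G 2 = (1 - cnj a * a) * (fps_nth K 1 - cnj a * fps_nth K 0 ^ 2)"
  proof -
    have "fps_nth G 2 = fps_nth K 1 - cnj a * (a * fps_nth K 1 + fps_nth G 1 * fps_nth K 0)"
      using 2 by (simp only: eq_diff_eq)
    then show ?thesis unfolding 1 by (simp add: power2_eq_square algebra_simps)
  qed
  then show "fps_nth G 2 = of_real (1 - (cmod (g 0))^2) * (fps_nth K 1 - cnj (g 0) * fps_nth K 0 ^ 2)"
    using d by (simp add: a_def)
qed

lemma holomorphic_on_unit_ball_fps:
  assumes "f holomorphic_on ball 0 1" obtains F where "f has_fps_expansion F"
  using assms analytic_at_imp_has_fps_expansion_0[of f] analytic_at_ball
  by (metis analytic_at centre_in_ball open_ball zero_less_one)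

text \<open>
  Apply the Schur step to \<open>g(z) = \<omega>(z)/z\<close> and to the function \<open>k\<close> that it yields; then \<open>x = k(0)\<close> and \<open>y = k'(0)\<close>,
  and the second step is the Schwarz-Pick bound for \<open>y\<close>.
\<close>

lemma schwarz_function_coeffs:
  assumes hol: "\<omega> holomorphic_on ball 0 1" and 0: "\<omega> 0 = 0"
    and lt: "\<And>z. cmod z < 1 \<Longrightarrow> cmod (\<omega> z) < 1" and W: "\<omega> has_fps_expansion W"
  obtains x y where "cmod (fps_nth W 1) \<le> 1" "cmod x \<le> 1" "cmod y \<le> 1 - (cmod x)^2"
    "fps_nth W 2 = of_real (1 - (cmod (fps_nth W 1))^2) * x"
    "fps_nth W 3 = of_real (1 - (cmod (fps_nth W 1))^2) * (y - cnj (fps_nth W 1) * x^2)"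
proof -
  obtain g where g: "g holomorphic_on ball 0 1" "\<And>z. cmod z < 1 \<Longrightarrow> \<omega> z = z * g z" "deriv \<omega> 0 = g 0"
    using Schwarz3[OF hol 0] by blast
  have g1: "cmod (g z) \<le> 1" if z: "cmod z < 1" for z
  proof (cases "z = 0")
    case True
    then show ?thesis using Schwarz_Lemma(2)[OF hol 0 lt, of 0] g(3) by simp
  next
    case False
    have "cmod z * cmod (g z) \<le> cmod z * 1"
      using Schwarz_Lemma(1)[OF hol 0 lt z] g(2)[OF z] by (simp add: norm_mult)
    then show ?thesis using False by simp
  qed
  obtain k where k: "k holomorphic_on ball 0 1" "\<And>z. cmod z < 1 \<Longrightarrow> cmod (k z) \<le> 1"
    "\<And>z. cmod z < 1 \<Longrightarrow> g z * (1 + cnj (g 0) * (z * k z)) = g 0 + z * k z"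
    using schur_step[OF g(1) g1] by blast
  obtain h where h: "h holomorphic_on ball 0 1" "\<And>z. cmod z < 1 \<Longrightarrow> cmod (h z) \<le> 1"
    "\<And>z. cmod z < 1 \<Longrightarrow> k z * (1 + cnj (k 0) * (z * h z)) = k 0 + z * h z"
    using schur_step[OF k(1,2)] by blast
  obtain G K H where F: "g has_fps_expansion G" "k has_fps_expansion K" "h has_fps_expansion H"
    using holomorphic_on_unit_ball_fps g(1) k(1) h(1) by metis
  have zero: "fps_nth G 0 = g 0" "fps_nth K 0 = k 0" "fps_nth H 0 = h 0"
    using F by (simp_all add: has_fps_expansion_imp_0_eq_fps_nth_0)
  have "(\<lambda>z. z * g z) has_fps_expansion fps_X * G" by (intro fps_expansion_intros F)
  moreover have "\<forall>\<^sub>F z in nhds 0. \<omega> z = z * g z"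
    using eventually_nhds_in_open[of "ball 0 1" "0::complex"]
    by (rule eventually_mono) (auto simp: g(2))
  ultimately have WG: "W = fps_X * G" by (rule fps_eq_of_eventually_eq[OF W])
  then have w: "fps_nth W 1 = g 0" "fps_nth W 2 = fps_nth G 1" "fps_nth W 3 = fps_nth G 2"
    by (simp_all add: zero)
  note gk = schur_step_coeffs[OF g(1) k(1,3) F(1,2)] and kh = schur_step_coeffs[OF k(1) h(1,3) F(2,3)]
  show ?thesis
  proof (rule that[of "k 0" "fps_nth K 1"])
    have "cmod (fps_nth K 1) = (1 - (cmod (k 0))^2) * cmod (h 0)"
    proof -
      have "cmod (fps_nth K 1) = \<bar>1 - (cmod (k 0))^2\<bar> * cmod (h 0)"
        using arg_cong[OF kh(1), of cmod] by (simp only: norm_mult norm_of_real zero)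
      moreover have "(cmod (k 0))^2 \<le> 1" using k(2)[of 0] by (simp add: power_le_one)
      ultimately show ?thesis by (simp only: abs_of_nonneg diff_ge_0_iff_ge)
    qed
    also have "\<dots> \<le> (1 - (cmod (k 0))^2) * 1"
      using k(2)[of 0] h(2)[of 0] by (intro mult_left_mono) (auto simp: power_le_one)
    finally show "cmod (fps_nth K 1) \<le> 1 - (cmod (k 0))^2" by simp
    show "cmod (fps_nth W 1) \<le> 1" "cmod (k 0) \<le> 1" unfolding w by (rule g1 k(2), simp)+
    show "fps_nth W 2 = of_real (1 - (cmod (fps_nth W 1))^2) * k 0"
      "fps_nth W 3 = of_real (1 - (cmod (fps_nth W 1))^2) * (fps_nth K 1 - cnj (fps_nth W 1) * (k 0)^2)"
      unfolding w by (rule gk[unfolded zero], assumption)+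
  qed
qed

text \<open>
  If \<open>q\<^sub>n\<close> are the coefficients of \<open>P \<circ> W\<close>, the equation gives \<open>F\<^sub>1 = q\<^sub>1\<close>, \<open>2F\<^sub>2 = q\<^sub>2 + q\<^sub>1\<^sup>2\<close> and
  \<open>3F\<^sub>3 = q\<^sub>3 + q\<^sub>1q\<^sub>2 + F\<^sub>2q\<^sub>1\<close>, so that \<open>q\<^sub>1q\<^sub>2\<close> cancels in \<open>F\<^sub>1F\<^sub>2 - F\<^sub>3 = (q\<^sub>1\<^sup>3 - q\<^sub>3)/3\<close>.
\<close>

lemma starlike_coeff_relation:
  fixes P W F :: "complex fps"
  assumes F0: "fps_nth F 0 = 1" and P0: "fps_nth P 0 = 1" and W0: "fps_nth W 0 = 0"
    and eq: "fps_X * fps_deriv F = F * (fps_compose P W - 1)"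
  shows "fps_nth F 1 * fps_nth F 2 - fps_nth F 3 =
    - (fps_nth P 1 * fps_nth W 3 + 2 * fps_nth P 2 * fps_nth W 1 * fps_nth W 2
        + (fps_nth P 3 - fps_nth P 1 ^ 3) * fps_nth W 1 ^ 3) / 3"
proof -
  define Q where "Q = fps_compose P W"
  note calc = fps_mult_nth sum.atLeast0_atMost_Suc numeral_2_eq_2 numeral_3_eq_3 W0
  have Q: "fps_nth Q 0 = 1" "fps_nth Q 1 = fps_nth P 1 * fps_nth W 1"
    "fps_nth Q 2 = fps_nth P 1 * fps_nth W 2 + fps_nth P 2 * fps_nth W 1 ^ 2"
    "fps_nth Q 3 = fps_nth P 1 * fps_nth W 3 + 2 * fps_nth P 2 * fps_nth W 1 * fps_nth W 2
       + fps_nth P 3 * fps_nth W 1 ^ 3"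
    unfolding Q_def fps_compose_nth by (simp_all add: calc P0 algebra_simps)
  have E: "fps_X * fps_deriv F = F * (Q - 1)" using eq by (simp add: Q_def)
  from arg_cong[OF E, of "\<lambda>f. fps_nth f 1"] have 1: "fps_nth F 1 = fps_nth Q 1"
    by (simp add: calc F0 Q)
  from arg_cong[OF E, of "\<lambda>f. fps_nth f 2"] have 2: "2 * fps_nth F 2 = fps_nth Q 2 + fps_nth F 1 * fps_nth Q 1"
    using Q(1) by (simp add: calc F0)
  from arg_cong[OF E, of "\<lambda>f. fps_nth f 3"]
  have 3: "3 * fps_nth F 3 = fps_nth Q 3 + fps_nth F 1 * fps_nth Q 2 + fps_nth F 2 * fps_nth Q 1"
    using Q(1) by (simp add: calc F0)
  have "3 * (fps_nth F 1 * fps_nth F 2 - fps_nth F 3) = fps_nth Q 1 ^ 3 - fps_nth Q 3"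
  proof -
    have f2: "fps_nth F 2 = (fps_nth Q 2 + fps_nth Q 1 ^ 2) / 2"
      using 2 unfolding 1 by (simp add: power2_eq_square field_simps)
    have f3: "fps_nth F 3 = (fps_nth Q 3 + fps_nth Q 1 * fps_nth Q 2 + fps_nth F 2 * fps_nth Q 1) / 3"
      using 3 unfolding 1 by (simp add: field_simps)
    show ?thesis unfolding f3 f2 1 by (simp add: power2_eq_square power3_eq_cube field_simps)
  qed
  then show ?thesis unfolding Q by (simp add: field_simps)
qed

section \<open>The Hahn-Banach theorem\<close>

text \<open>
  A partial functional dominated by the norm is represented by its graph, a linear subspace of
  \<open>X \<times> \<real>\<close>. Single-valuedness need not be required, since \<open>(0, a)\<close> and \<open>(0, -a)\<close> in the graph force \<open>a = 0\<close>; thus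
  unions of chains need no separate treatment of domains.
\<close>

definition dominated_graph :: "('a::real_normed_vector \<times> real) set \<Rightarrow> bool" where
  "dominated_graph G \<longleftrightarrow> subspace G \<and> (\<forall>(x, a)\<in>G. a \<le> norm x)"

lemma dominated_graph_unique:
  assumes G: "dominated_graph G" and "(x, a) \<in> G" "(x, b) \<in> G"
  shows "a = b"
proof -
  have "(x, a) - (x, b) \<in> G" "(x, b) - (x, a) \<in> G"
    using assms by (simp_all only: dominated_graph_def subspace_diff)
  then have "a - b \<le> norm (0::'a)" "b - a \<le> norm (0::'a)"
    using G by (auto simp: dominated_graph_def)
  then show ?thesis by simp
qed

text \<open>
  The admissible values \<open>c\<close> at \<open>x0\<close> are those between all \<open>a - |x - x0|\<close> and all \<open>|y + x0| - b\<close>, for \<open>(x, a)\<close> and \<open>(y, b)\<close>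
  in the graph. The triangle inequality separates the two families, and \<open>c\<close> is the supremum of the first.
\<close>

lemma dominated_graph_extend:
  fixes x0 :: "'a::real_normed_vector"
  assumes G: "dominated_graph G"
  obtains c where "dominated_graph {g + t *\<^sub>R (x0, c) | g t. g \<in> G}"
proof -
  have sub: "subspace G" and dom: "\<And>x a. (x, a) \<in> G \<Longrightarrow> a \<le> norm x"
    using G by (auto simp: dominated_graph_def)
  define L where "L = {a - norm (x - x0) | x a. (x, a) \<in> G}"
  have zero: "(0, 0) \<in> G" using subspace_0[OF sub] by (simp add: zero_prod_def)
  have upper: "l \<le> norm (y + x0) - b" if l: "l \<in> L" and y: "(y, b) \<in> G" for l y b
  proof -
    obtain x a where xa: "(x, a) \<in> G" "l = a - norm (x - x0)" using l by (auto simp: L_def)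
    have "(x, a) + (y, b) \<in> G" using subspace_add[OF sub xa(1) y] .
    then have "a + b \<le> norm (x + y)" using dom by simp
    also have "\<dots> \<le> norm (x - x0) + norm (y + x0)"
      using norm_triangle_ineq[of "x - x0" "y + x0"] by simp
    finally show ?thesis using xa by simp
  qed
  have ne: "L \<noteq> {}" using zero by (auto simp: L_def)
  have bdd: "bdd_above L" using upper[OF _ zero] by (intro bdd_aboveI) blast
  define c where "c = Sup L"
  have c1: "a - norm (x - x0) \<le> c" if "(x, a) \<in> G" for x a
    unfolding c_def by (rule cSup_upper[OF _ bdd]) (use that in \<open>auto simp: L_def\<close>)
  have c2: "c \<le> norm (y + x0) - b" if "(y, b) \<in> G" for y b
    unfolding c_def by (rule cSup_least[OF ne]) (rule upper[OF _ that])
  have bound: "a + t * c \<le> norm (x + t *\<^sub>R x0)" if xa: "(x, a) \<in> G" for x a t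
  proof -
    consider "t = 0" | "0 < t" | "t < 0" by linarith
    then show ?thesis
    proof cases
      case 1
      then show ?thesis using dom[OF xa] by simp
    next
      case 2
      have "(1 / t) *\<^sub>R (x, a) \<in> G" using subspace_scale[OF sub xa] .
      then have "c \<le> norm ((1 / t) *\<^sub>R x + x0) - a / t" using c2 by simp
      then have "t * c \<le> t * (norm ((1 / t) *\<^sub>R x + x0) - a / t)" using 2 by simp
      also have "\<dots> = t * norm ((1 / t) *\<^sub>R x + x0) - a" using 2 by (simp add: right_diff_distrib)
      also have "t * norm ((1 / t) *\<^sub>R x + x0) = norm (t *\<^sub>R ((1 / t) *\<^sub>R x + x0))" using 2 by simp
      also have "t *\<^sub>R ((1 / t) *\<^sub>R x + x0) = x + t *\<^sub>R x0" using 2 by (simp add: scaleR_right_distrib)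
      finally show ?thesis by simp
    next
      case 3
      define s where "s = - t"
      have s: "0 < s" using 3 by (simp add: s_def)
      have "(1 / s) *\<^sub>R (x, a) \<in> G" using subspace_scale[OF sub xa] .
      then have "a / s - norm ((1 / s) *\<^sub>R x - x0) \<le> c" using c1 by simp
      then have "s * (a / s - norm ((1 / s) *\<^sub>R x - x0)) \<le> s * c" using s by simp
      moreover have "s * (a / s - norm ((1 / s) *\<^sub>R x - x0)) = a - s * norm ((1 / s) *\<^sub>R x - x0)"
        using s by (simp add: right_diff_distrib)
      moreover have "s * norm ((1 / s) *\<^sub>R x - x0) = norm (s *\<^sub>R ((1 / s) *\<^sub>R x - x0))" using s by simp
      moreover have "s *\<^sub>R ((1 / s) *\<^sub>R x - x0) = x + t *\<^sub>R x0"
        using s by (simp add: scaleR_right_diff_distrib) (simp add: s_def)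
      ultimately have "a - norm (x + t *\<^sub>R x0) \<le> s * c" by metis
      then show ?thesis by (simp add: s_def)
    qed
  qed
  have "{g + t *\<^sub>R (x0, c) | g t. g \<in> G} = {x + y | x y. x \<in> G \<and> y \<in> span {(x0, c)}}"
    unfolding span_singleton by blast
  then have "subspace {g + t *\<^sub>R (x0, c) | g t. g \<in> G}"
    using subspace_sums[OF sub subspace_span, of "{(x0, c)}"] by simp
  then have "dominated_graph {g + t *\<^sub>R (x0, c) | g t. g \<in> G}"
    unfolding dominated_graph_def by (auto intro: bound)
  then show ?thesis by (rule that)
qed

lemma Hahn_Banach_norming:
  fixes u :: "'a::real_normed_vector"
  obtains g where "linear g" "g u = norm u" "\<And>x. g x \<le> norm x"
proof -
  define \<A> where "\<A> = {G. dominated_graph G \<and> (u, norm u) \<in> G}"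
  have "dominated_graph (span {(u, norm u)})"
    unfolding dominated_graph_def
  proof (intro conjI ballI)
    fix p assume "p \<in> span {(u, norm u)}"
    then obtain t where p: "p = (t *\<^sub>R u, t * norm u)" by (auto simp: span_singleton)
    show "case p of (x, a) \<Rightarrow> a \<le> norm x" by (simp add: p mult_right_mono)
  qed (rule subspace_span)
  then have "span {(u, norm u)} \<in> \<A>" by (simp add: \<A>_def span_base)
  then have ne: "\<A> \<noteq> {}" by blast
  have chain: "\<Union>\<C> \<in> \<A>" if C: "\<C> \<noteq> {}" "subset.chain \<A> \<C>" for \<C>
  proof -
    have CA: "dominated_graph G" "(u, norm u) \<in> G" if "G \<in> \<C>" for G
      using that C by (auto simp: subset_chain_def \<A>_def)
    have "subspace (\<Union>\<C>)"
    proof (rule subspaceI)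
      show "0 \<in> \<Union>\<C>"
        using C(1) CA(1) subspace_0 unfolding dominated_graph_def by blast
      show "t *\<^sub>R p \<in> \<Union>\<C>" if "p \<in> \<Union>\<C>" for t p
        using that CA(1) subspace_scale unfolding dominated_graph_def by blast
      show "p + q \<in> \<Union>\<C>" if pq: "p \<in> \<Union>\<C>" "q \<in> \<Union>\<C>" for p q
      proof -
        obtain G H where GH: "G \<in> \<C>" "H \<in> \<C>" "p \<in> G" "q \<in> H" using pq by blast
        then have "G \<subseteq> H \<or> H \<subseteq> G" using C by (auto simp: subset_chain_def)
        then obtain M where "M \<in> \<C>" "p \<in> M" "q \<in> M" using GH by blast
        then show ?thesis using CA by (meson UnionI dominated_graph_def subspace_add)
      qed
    qed
    moreover have "(u, norm u) \<in> \<Union>\<C>" using C(1) CA(2) by blast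
    ultimately show ?thesis using CA(1) unfolding \<A>_def dominated_graph_def by blast
  qed
  from subset_Zorn_nonempty[OF ne chain] obtain G
    where G: "G \<in> \<A>" and max: "\<forall>H\<in>\<A>. G \<subseteq> H \<longrightarrow> H = G" by blast
  have dG: "dominated_graph G" and uG: "(u, norm u) \<in> G" using G by (auto simp: \<A>_def)
  have sub: "subspace G" using dG by (simp add: dominated_graph_def)
  have total: "\<exists>a. (x, a) \<in> G" for x
  proof -
    obtain c where c: "dominated_graph {g + t *\<^sub>R (x, c) | g t. g \<in> G}" (is "dominated_graph ?H")
      using dominated_graph_extend[OF dG] .
    have GH: "G \<subseteq> ?H"
    proof
      fix p assume "p \<in> G"
      then show "p \<in> ?H" by (intro CollectI exI[of _ p] exI[of _ "0::real"]) (simp add: zero_prod_def[symmetric])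
    qed
    have "?H \<in> \<A>" unfolding \<A>_def using c subsetD[OF GH uG] by blast
    then have "?H = G" using max GH by blast
    moreover have "(x, c) \<in> ?H"
      using subspace_0[OF sub] by (intro CollectI exI[of _ 0] exI[of _ "1::real"]) simp
    ultimately show ?thesis by blast
  qed
  define g where "g x = (THE a. (x, a) \<in> G)" for x
  have gG: "(x, g x) \<in> G" for x
    unfolding g_def using total dominated_graph_unique[OF dG] by (metis theI)
  have eq: "g x = a" if "(x, a) \<in> G" for x a using dominated_graph_unique[OF dG gG that] .
  show ?thesis
  proof
    show "linear g"
    proof
      show "g (x + y) = g x + g y" for x y
        by (rule eq) (use subspace_add[OF sub gG[of x] gG[of y]] in simp)
      show "g (t *\<^sub>R x) = t *\<^sub>R g x" for t x
        by (rule eq) (use subspace_scale[OF sub gG[of x]] in simp)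
    qed
    show "g u = norm u" by (rule eq[OF uG])
    show "g x \<le> norm x" for x using gG[of x] dG by (auto simp: dominated_graph_def)
  qed
qed

lemma bounded_bilinear_scaleC: "bounded_bilinear ((*\<^sub>C) :: complex \<Rightarrow> 'a::complex_normed_vector \<Rightarrow> 'a)"
proof
  fix a a' :: complex and r :: real and b b' :: 'a
  show "(a + a') *\<^sub>C b = a *\<^sub>C b + a' *\<^sub>C b" by (rule scaleC_add_left)
  show "a *\<^sub>C (b + b') = a *\<^sub>C b + a *\<^sub>C b'" by (rule scaleC_add_right)
  show "(r *\<^sub>R a) *\<^sub>C b = r *\<^sub>R (a *\<^sub>C b)"
    by (simp add: scaleR_scaleC scaleC_scaleC scaleC_complex_def)
  show "a *\<^sub>C (r *\<^sub>R b) = r *\<^sub>R (a *\<^sub>C b)"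
    by (simp add: scaleR_scaleC scaleC_scaleC mult.commute)
  show "\<exists>K. \<forall>a b. norm (a *\<^sub>C (b::'a)) \<le> norm a * norm b * K"
    by (rule exI[of _ 1]) (simp add: norm_scaleC)
qed

interpretation scaleC: bounded_bilinear "(*\<^sub>C) :: complex \<Rightarrow> 'a::complex_normed_vector \<Rightarrow> 'a"
  by (rule bounded_bilinear_scaleC)

lemma scaleC_one [simp]: "1 *\<^sub>C (x::'a::complex_normed_vector) = x"
  using scaleR_scaleC[of 1 x] by simp

text \<open>
  A real functional \<open>g\<close> is the real part of the complex functional \<open>g(x) - i g(ix)\<close>. To bound the latter at
  \<open>x\<close>, rotate \<open>x\<close> so that its value becomes real and hence equal to a value of \<open>g\<close>.
\<close>

lemma complexify_functional:
  fixes g :: "'a::complex_normed_vector \<Rightarrow> real"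
  assumes g: "linear g" and le: "\<And>x. g x \<le> norm x"
  defines "l \<equiv> \<lambda>x. of_real (g x) - \<i> * of_real (g (\<i> *\<^sub>C x))"
  shows "bounded_clinear l" and "\<And>x. cmod (l x) \<le> norm x"
proof -
  have add: "g (x + y) = g x + g y" and scale: "g (t *\<^sub>R x) = t * g x" for x y t
    using g by (simp_all add: linear_add linear_scale)
  have decomp: "c *\<^sub>C x = Re c *\<^sub>R x + Im c *\<^sub>R (\<i> *\<^sub>C x)" for c and x :: 'a
    unfolding scaleR_scaleC scaleC_scaleC
    by (metis complex_eq mult.commute scaleC_add_left)
  have ii: "\<i> *\<^sub>C \<i> *\<^sub>C x = - x" for x :: 'a
    using decomp[of "-1" x] by (simp add: scaleC_scaleC)
  have gdiff: "g (x - y) = g x - g y" for x y using g by (simp add: linear_diff)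
  have gneg: "g (- x) = - g x" for x using scale[of "-1" x] by simp
  have clin: "l (c *\<^sub>C x) = c * l x" for c x
    unfolding l_def decomp[of c x]
    by (simp add: add scale gneg gdiff ii scaleC_add_right scaleC.scaleR_right complex_eq_iff)
  have ladd: "l (x + y) = l x + l y" for x y
    by (simp add: l_def add scaleC_add_right algebra_simps)
  show bound: "cmod (l x) \<le> norm x" for x
  proof -
    define \<tau> where "\<tau> = cis (- Arg (l x))"
    have "l x = of_real (cmod (l x)) * cis (Arg (l x))" using rcis_cmod_Arg[of "l x"] by (simp add: rcis_def)
    moreover have "\<tau> * cis (Arg (l x)) = 1" by (simp add: \<tau>_def cis_mult)
    ultimately have "\<tau> * l x = of_real (cmod (l x))" by (metis mult.left_commute mult_1_right)
    then have "cmod (l x) = Re (l (\<tau> *\<^sub>C x))" by (simp add: clin)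
    also have "\<dots> = g (\<tau> *\<^sub>C x)" by (simp add: l_def)
    also have "\<dots> \<le> norm (\<tau> *\<^sub>C x)" by (rule le)
    finally show ?thesis by (simp add: norm_scaleC \<tau>_def)
  qed
  have "bounded_linear l"
    by (rule bounded_linear_intro[where K = 1])
       (use bound ladd clin in \<open>simp_all add: scaleR_scaleC scaleC_complex_def\<close>)
  then show "bounded_clinear l" by (simp add: bounded_clinear_def clin scaleC_complex_def)
qed

lemma support_functionals_nonempty:
  fixes u :: "'a::complex_normed_vector"
  assumes u: "u \<noteq> 0"
  obtains l where "l \<in> support_functionals u"
proof -
  obtain g where g: "linear g" "g u = norm u" "\<And>x. g x \<le> norm x" 
    using Hahn_Banach_norming[of u] by blast
  define l where "l = (\<lambda>x. of_real (g x) - \<i> * of_real (g (\<i> *\<^sub>C x)))"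
  have l: "bounded_clinear l" "\<And>x. cmod (l x) \<le> norm x"
    using complexify_functional[OF g(1,3)] by (simp_all add: l_def)
  have bl: "bounded_linear l" using l(1) by (simp add: bounded_clinear_def)
  have Re: "Re (l u) = norm u" by (simp add: l_def g)
  have "(Re (l u))^2 + (Im (l u))^2 \<le> (norm u)^2"
    using power_mono[OF l(2)[of u] norm_ge_zero, of 2] by (simp add: cmod_power2)
  then have lu: "l u = of_real (norm u)" using Re by (simp add: complex_eq_iff)
  have "onorm l \<le> 1" by (rule onorm_bound) (use l in auto)
  moreover have "1 \<le> onorm l"
    using le_onorm[OF bl, of u] u by (simp add: lu)
  ultimately have "l \<in> support_functionals u" using l lu by (simp add: support_functionals_def)
  then show ?thesis by (rule that)
qed

lemma norm_le_by_functionals: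
  fixes y :: "'a::complex_normed_vector"
  assumes "\<And>l. bounded_clinear l \<Longrightarrow> (\<And>x. cmod (l x) \<le> norm x) \<Longrightarrow> cmod (l y) \<le> C" and "0 \<le> C"
  shows "norm y \<le> C"
proof (cases "y = 0")
  case False
  obtain l where l: "l \<in> support_functionals y" using support_functionals_nonempty[OF False] .
  then have bl: "bounded_clinear l" "onorm l = 1" "l y = of_real (norm y)"
    by (auto simp: support_functionals_def)
  then have "cmod (l x) \<le> norm x" for x
    using onorm[of l x] by (simp add: bounded_clinear_def)
  then have "cmod (l y) \<le> C" using assms(1) bl by blast
  then show ?thesis using bl by simp
qed (use assms in simp)

section \<open>Holomorphic maps are infinitely differentiable\<close>

text \<open>
  With this scalar multiplication the derivative of a holomorphic map is a map into a complex Banach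
  space again, so differentiability can be iterated.
\<close>

instantiation blinfun :: (real_normed_vector, complex_normed_vector) complex_normed_vector
begin

lift_definition scaleC_blinfun :: "complex \<Rightarrow> 'a \<Rightarrow>\<^sub>L 'b \<Rightarrow> 'a \<Rightarrow>\<^sub>L 'b"
  is "\<lambda>c A x. c *\<^sub>C A x"
  by (rule bounded_linear_compose[OF scaleC.bounded_linear_right])

instance
proof
  fix a b :: complex and r :: real and A B :: "'a \<Rightarrow>\<^sub>L 'b"
  show "a *\<^sub>C (A + B) = a *\<^sub>C A + a *\<^sub>C B"
    by (rule blinfun_eqI) (simp add: scaleC_blinfun.rep_eq blinfun.add_left scaleC_add_right)
  show "(a + b) *\<^sub>C A = a *\<^sub>C A + b *\<^sub>C A"
    by (rule blinfun_eqI) (simp add: scaleC_blinfun.rep_eq blinfun.add_left scaleC_add_left)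
  show "a *\<^sub>C b *\<^sub>C A = (a * b) *\<^sub>C A"
    by (rule blinfun_eqI) (simp add: scaleC_blinfun.rep_eq scaleC_scaleC)
  show "r *\<^sub>R A = complex_of_real r *\<^sub>C A"
    by (rule blinfun_eqI) (simp add: scaleC_blinfun.rep_eq blinfun.scaleR_left scaleR_scaleC)
  have le: "norm (c *\<^sub>C C) \<le> cmod c * norm C" for c and C :: "'a \<Rightarrow>\<^sub>L 'b"
    by (rule norm_blinfun_bound)
       (simp_all add: scaleC_blinfun.rep_eq norm_scaleC mult.assoc mult_left_mono norm_blinfun)
  show "norm (a *\<^sub>C A) = cmod a * norm A"
  proof (cases "a = 0")
    case True
    then show ?thesis using le[of 0 A] by simp
  next
    case False
    have "inverse a *\<^sub>C a *\<^sub>C A = A"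
      by (rule blinfun_eqI) (simp add: scaleC_blinfun.rep_eq scaleC_scaleC False)
    then have "norm A \<le> cmod (inverse a) * norm (a *\<^sub>C A)" using le[of "inverse a" "a *\<^sub>C A"] by simp
    then have "norm A \<le> norm (a *\<^sub>C A) / cmod a" by (simp add: norm_inverse divide_inverse mult.commute)
    then have "cmod a * norm A \<le> norm (a *\<^sub>C A)" using False by (simp add: pos_le_divide_eq mult.commute)
    then show ?thesis using le[of a A] by simp
  qed
qed

end

instance blinfun :: (real_normed_vector, cbanach) cbanach ..

lemma bounded_clinear_bounded_linear: "bounded_clinear A \<Longrightarrow> bounded_linear A"
  by (simp add: bounded_clinear_def)

lemma bounded_clinear_scaleC: "bounded_clinear A \<Longrightarrow> A (c *\<^sub>C x) = c *\<^sub>C A x"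
  by (simp add: bounded_clinear_def)

lemma bounded_clinear_compose:
  "bounded_clinear A \<Longrightarrow> bounded_clinear B \<Longrightarrow> bounded_clinear (\<lambda>x. A (B x))"
  by (simp add: bounded_clinear_def bounded_linear_compose)

lemma bounded_clinear_eval: "bounded_clinear (\<lambda>A :: 'a::real_normed_vector \<Rightarrow>\<^sub>L 'b::complex_normed_vector. blinfun_apply A x)"
  by (simp add: bounded_clinear_def scaleC_blinfun.rep_eq blinfun.bounded_linear_left)

lemma fderiv_eq:
  assumes "(f has_derivative f') (at z)" shows "blinfun_apply (fderiv f z) = f'"
proof -
  have "frechet_derivative f (at z) = f'" using frechet_derivative_at[OF assms] by simp
  then show ?thesis
    unfolding fderiv_def using has_derivative_bounded_linear[OF assms] by (simp add: bounded_linear_Blinfun_apply)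
qed

lemma holomorphic_map_onD:
  assumes "holomorphic_map_on f S" "z \<in> S"
  shows "(f has_derivative blinfun_apply (fderiv f z)) (at z)" "bounded_clinear (blinfun_apply (fderiv f z))"
proof -
  obtain f' where f': "bounded_clinear f'" "(f has_derivative f') (at z)"
    using assms unfolding holomorphic_map_on_def by blast
  then show "(f has_derivative blinfun_apply (fderiv f z)) (at z)" "bounded_clinear (blinfun_apply (fderiv f z))"
    using fderiv_eq[OF f'(2)] by simp_all
qed

lemma has_field_derivative_slice:
  assumes f: "(f has_derivative f') (at (z + \<zeta> *\<^sub>C w))" and f': "bounded_clinear f'" and l: "bounded_clinear l"
  shows "((\<lambda>\<zeta>. l (f (z + \<zeta> *\<^sub>C w)) :: complex) has_field_derivative l (f' w)) (at \<zeta>)"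
proof -
  have "((\<lambda>\<zeta>. z + \<zeta> *\<^sub>C w) has_derivative (\<lambda>\<xi>. \<xi> *\<^sub>C w)) (at \<zeta>)"
    by (rule has_derivative_eq_rhs,
        rule has_derivative_add[OF has_derivative_const bounded_linear_imp_has_derivative[OF scaleC.bounded_linear_left]])
       simp
  from has_derivative_compose[OF this f]
  have "((\<lambda>\<zeta>. f (z + \<zeta> *\<^sub>C w)) has_derivative (\<lambda>\<xi>. f' (\<xi> *\<^sub>C w))) (at \<zeta>)" .
  from bounded_linear.has_derivative[OF bounded_clinear_bounded_linear[OF l] this]
  have "((\<lambda>\<zeta>. l (f (z + \<zeta> *\<^sub>C w))) has_derivative (\<lambda>\<xi>. l (f' (\<xi> *\<^sub>C w)))) (at \<zeta>)" .
  moreover have "(\<lambda>\<xi>. l (f' (\<xi> *\<^sub>C w))) = (*) (l (f' w))"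
    by (rule ext) (simp add: bounded_clinear_scaleC[OF f'] bounded_clinear_scaleC[OF l] scaleC_complex_def)
  ultimately show ?thesis unfolding has_field_derivative_def by simp
qed

text \<open>
  The second derivative on the closed unit disc is estimated by Cauchy's inequality on discs of radius
  \<open>\<rho>/4\<close>, which stay inside the disc of radius \<open>\<rho>\<close> because \<open>1 + \<rho>/4 < \<rho>\<close>. This produces the constant \<open>32\<close>.
\<close>

lemma Taylor_remainder_le:
  assumes hol: "\<phi> holomorphic_on ball 0 \<rho>" and le: "\<And>\<zeta>. cmod \<zeta> < \<rho> \<Longrightarrow> cmod (\<phi> \<zeta>) \<le> M" and \<rho>: "2 \<le> \<rho>"
  shows "cmod (\<phi> 1 - \<phi> 0 - deriv \<phi> 0) \<le> 32 * M / \<rho>^2"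
proof -
  have b2: "cmod ((deriv ^^ 2) \<phi> \<zeta>) \<le> 32 * M / \<rho>^2" if \<zeta>: "\<zeta> \<in> cball 0 1" for \<zeta>
  proof -
    have sub: "cball \<zeta> (\<rho> / 4) \<subseteq> ball 0 \<rho>"
    proof
      fix x assume "x \<in> cball \<zeta> (\<rho> / 4)"
      then have "cmod (x - \<zeta>) \<le> \<rho> / 4" by (simp add: dist_norm norm_minus_commute)
      then show "x \<in> ball 0 \<rho>" using \<zeta> \<rho> norm_triangle_ineq2[of x \<zeta>] by simp
    qed
    have "cmod ((deriv ^^ 2) \<phi> \<zeta>) \<le> fact 2 * M / (\<rho> / 4)^2"
    proof (rule Cauchy_inequality)
      show "\<phi> holomorphic_on ball \<zeta> (\<rho> / 4)"
        using hol sub ball_subset_cball by (meson holomorphic_on_subset subset_trans)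
      show "continuous_on (cball \<zeta> (\<rho> / 4)) \<phi>"
        using hol sub by (meson holomorphic_on_imp_continuous_on holomorphic_on_subset)
      show "cmod (\<phi> x) \<le> M" if "cmod (\<zeta> - x) = \<rho> / 4" for x
      proof -
        have "x \<in> cball \<zeta> (\<rho> / 4)" using that by (simp add: dist_norm)
        then have "x \<in> ball 0 \<rho>" using sub by blast
        then show ?thesis by (intro le) simp
      qed
    qed (use \<rho> in simp)
    then show ?thesis by (simp add: fact_numeral power_divide)
  qed
  have "cmod ((deriv ^^ 0) \<phi> 1 - (\<Sum>i\<le>1. (deriv ^^ i) \<phi> 0 * (1 - 0) ^ i / fact i))
      \<le> 32 * M / \<rho>^2 * cmod (1 - 0) ^ Suc 1 / fact 1"
  proof (rule complex_Taylor[where S = "cball 0 1"])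
    show "((deriv ^^ i) \<phi> has_field_derivative (deriv ^^ Suc i) \<phi> x) (at x within cball 0 1)"
      if "x \<in> cball 0 1" for i x
    proof -
      have "(deriv ^^ i) \<phi> holomorphic_on ball 0 \<rho>" using hol by (intro holomorphic_higher_deriv) auto
      moreover have "x \<in> ball 0 \<rho>" using that \<rho> by simp
      ultimately have "((deriv ^^ i) \<phi> has_field_derivative deriv ((deriv ^^ i) \<phi>) x) (at x)"
        by (intro holomorphic_derivI) auto
      then show ?thesis by (simp add: has_field_derivative_at_within)
    qed
    show "cmod ((deriv ^^ Suc 1) \<phi> x) \<le> 32 * M / \<rho>^2" if "x \<in> cball 0 1" for x
      using b2[OF that] by (simp add: numeral_2_eq_2)
  qed auto
  then show ?thesis by (simp add: atMost_Suc algebra_simps)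
qed

text \<open>
  By the Hahn-Banach theorem it suffices to estimate \<open>\<phi>(\<zeta>) = l(f(z + \<zeta>h))\<close> for functionals \<open>l\<close> of norm at most
  one. This function is holomorphic in the disc of radius \<open>R/|h|\<close> and bounded by \<open>M\<close> there.
\<close>

lemma cauchy_estimates:
  fixes f :: "'a::complex_normed_vector \<Rightarrow> 'b::complex_normed_vector"
  assumes hol: "holomorphic_map_on f (ball z R)" and le: "\<And>x. x \<in> ball z R \<Longrightarrow> norm (f x) \<le> M"
    and R: "0 < R"
  shows "norm (blinfun_apply (fderiv f z) h) \<le> M / R * norm h"
    and "norm h \<le> R / 2 \<Longrightarrow> norm (f (z + h) - f z - blinfun_apply (fderiv f z) h) \<le> 32 * M / R^2 * norm h ^ 2"
proof -
  have M: "0 \<le> M" using order_trans[OF norm_ge_zero le[of z]] R by simp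
  have main: "cmod (l (blinfun_apply (fderiv f z) h)) \<le> M / R * norm h \<and>
     (norm h \<le> R / 2 \<longrightarrow> cmod (l (f (z + h) - f z - blinfun_apply (fderiv f z) h)) \<le> 32 * M / R^2 * norm h ^ 2)"
    if l: "bounded_clinear l" "\<And>x. cmod (l x) \<le> norm x" for l
  proof (cases "h = 0")
    case True
    have "l 0 = 0" using l(2)[of 0] by simp
    then show ?thesis by (simp add: True blinfun.zero_right)
  next
    case False
    define \<rho> where "\<rho> = R / norm h"
    have \<rho>: "0 < \<rho>" using R False by (simp add: \<rho>_def)
    define \<phi> where "\<phi> \<zeta> = l (f (z + \<zeta> *\<^sub>C h))" for \<zeta>
    have inb: "z + \<zeta> *\<^sub>C h \<in> ball z R" if "cmod \<zeta> < \<rho>" for \<zeta>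
      using that False by (simp add: dist_norm norm_scaleC \<rho>_def pos_less_divide_eq)
    have der: "(\<phi> has_field_derivative l (blinfun_apply (fderiv f (z + \<zeta> *\<^sub>C h)) h)) (at \<zeta>)" if "cmod \<zeta> < \<rho>" for \<zeta>
      unfolding \<phi>_def by (rule has_field_derivative_slice[OF holomorphic_map_onD[OF hol inb[OF that]] l(1)])
    have hol\<phi>: "\<phi> holomorphic_on ball 0 \<rho>"
      unfolding holomorphic_on_open[OF open_ball] using der by (meson mem_ball_0)
    have le\<phi>: "cmod (\<phi> \<zeta>) \<le> M" if "cmod \<zeta> < \<rho>" for \<zeta>
      unfolding \<phi>_def using l(2) le[OF inb[OF that]] order_trans by blast
    have d0: "deriv \<phi> 0 = l (blinfun_apply (fderiv f z) h)"
      using der[of 0] \<rho> by (simp add: DERIV_imp_deriv scaleC.zero_left)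
    have "cmod (deriv \<phi> 0) \<le> M / r" if r: "0 < r" "r < \<rho>" for r
    proof -
      have "cmod ((deriv ^^ 1) \<phi> 0) \<le> fact 1 * M / r ^ 1"
      proof (rule Cauchy_inequality)
        show "\<phi> holomorphic_on ball 0 r" using hol\<phi> by (rule holomorphic_on_subset) (use r in auto)
        show "continuous_on (cball 0 r) \<phi>"
          using hol\<phi> by (intro holomorphic_on_imp_continuous_on) (rule holomorphic_on_subset, use r in auto)
      qed (use r le\<phi> in auto)
      then show ?thesis by simp
    qed
    then have "cmod (deriv \<phi> 0) * r \<le> M" if "0 < r" "r < \<rho>" for r
      using that by (simp add: pos_le_divide_eq)
    then have "cmod (deriv \<phi> 0) * \<rho> \<le> M"
      by (intro tendsto_upperbound[of "\<lambda>r. cmod (deriv \<phi> 0) * r" _ "at_left \<rho>"])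
         (auto intro!: tendsto_eq_intros eventually_at_leftI[OF _ \<rho>])
    then have 1: "cmod (l (blinfun_apply (fderiv f z) h)) \<le> M / R * norm h"
      using R False by (simp add: d0 \<rho>_def field_simps)
    have "cmod (l (f (z + h) - f z - blinfun_apply (fderiv f z) h)) \<le> 32 * M / R^2 * norm h ^ 2" if "norm h \<le> R / 2"
    proof -
      have "2 \<le> \<rho>" using that False by (simp add: \<rho>_def field_simps)
      from Taylor_remainder_le[OF hol\<phi> le\<phi> this]
      have "cmod (\<phi> 1 - \<phi> 0 - deriv \<phi> 0) \<le> 32 * M / R^2 * norm h ^ 2" by (simp add: \<rho>_def power_divide)
      moreover have "\<phi> 1 - \<phi> 0 - deriv \<phi> 0 = l (f (z + h) - f z - blinfun_apply (fderiv f z) h)"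
        unfolding d0 \<phi>_def using bounded_clinear_bounded_linear[OF l(1)] by (simp add: linear_diff bounded_linear.linear scaleC.zero_left)
      ultimately show ?thesis by simp
    qed
    with 1 show ?thesis by blast
  qed
  have nonneg: "0 \<le> M / R * norm h" "0 \<le> 32 * M / R^2 * norm h ^ 2" using M R by simp_all
  show "norm (blinfun_apply (fderiv f z) h) \<le> M / R * norm h"
    by (rule norm_le_by_functionals[OF conjunct1[OF main] nonneg(1)])
  show "norm (f (z + h) - f z - blinfun_apply (fderiv f z) h) \<le> 32 * M / R^2 * norm h ^ 2" if "norm h \<le> R / 2"
    by (rule norm_le_by_functionals[OF mp[OF conjunct2[OF main] that] nonneg(2)])
qed

lemma bounded_clinear_diff:
  assumes "bounded_clinear A" "bounded_clinear B" shows "bounded_clinear (\<lambda>x. A x - B x)"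
  using assms by (simp add: bounded_clinear_def bounded_linear_sub scaleC.diff_right)

lemma bounded_clinear_scaleR:
  assumes "bounded_clinear A" shows "bounded_clinear (\<lambda>x. r *\<^sub>R A x)"
  using assms unfolding bounded_clinear_def
  by (auto intro: bounded_linear_compose[OF bounded_linear_scaleR_right] simp: scaleC.scaleR_right)

lemma bounded_clinear_limit:
  fixes A :: "nat \<Rightarrow> 'a::complex_normed_vector \<Rightarrow>\<^sub>L 'b::complex_normed_vector"
  assumes lim: "A \<longlonglongrightarrow> L" and cl: "\<And>n. bounded_clinear (blinfun_apply (A n))"
  shows "bounded_clinear (blinfun_apply L)"
proof -
  have pt: "(\<lambda>n. blinfun_apply (A n) x) \<longlonglongrightarrow> blinfun_apply L x" for x
    by (rule bounded_linear.tendsto[OF blinfun.bounded_linear_left lim])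
  have "blinfun_apply L (c *\<^sub>C x) = c *\<^sub>C blinfun_apply L x" for c x
  proof (rule LIMSEQ_unique[OF pt])
    show "(\<lambda>n. blinfun_apply (A n) (c *\<^sub>C x)) \<longlonglongrightarrow> c *\<^sub>C blinfun_apply L x"
      unfolding bounded_clinear_scaleC[OF cl]
      by (rule bounded_linear.tendsto[OF scaleC.bounded_linear_right pt])
  qed
  then show ?thesis by (simp add: bounded_clinear_def blinfun.bounded_linear_right)
qed

text \<open>
  Weierstrass' theorem for maps between Banach spaces: Cauchy's estimate turns uniform convergence of the
  maps into uniform convergence of their derivatives on the ball of half the radius.
\<close>

lemma holomorphic_map_on_uniform_limit:
  fixes k :: "nat \<Rightarrow> 'a::complex_normed_vector \<Rightarrow> 'b::cbanach"
  assumes hol: "\<And>n. holomorphic_map_on (k n) (ball z0 (2 * R))" and R: "0 < R"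
    and lim: "\<And>e. 0 < e \<Longrightarrow> \<exists>N. \<forall>n\<ge>N. \<forall>x\<in>ball z0 (2 * R). norm (k n x - g x) \<le> e"
  shows "holomorphic_map_on g (ball z0 R)"
proof -
  define D where "D n x = fderiv (k n) x" for n x
  have inb: "x \<in> ball z0 (2 * R)" if "x \<in> ball z0 R" for x using that R by simp
  have sub: "ball x R \<subseteq> ball z0 (2 * R)" if "x \<in> ball z0 R" for x
  proof
    fix y assume "y \<in> ball x R"
    then show "y \<in> ball z0 (2 * R)" using that dist_triangle[of z0 y x] by simp
  qed
  have cauchy: "\<exists>N. \<forall>n\<ge>N. \<forall>m\<ge>N. \<forall>x\<in>ball z0 R. norm (D n x - D m x) \<le> e" if e: "0 < e" for e
  proof -
    obtain N where N: "\<And>n x. n \<ge> N \<Longrightarrow> x \<in> ball z0 (2 * R) \<Longrightarrow> norm (k n x - g x) \<le> e * R / 2"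
      using lim[of "e * R / 2"] e R by (metis half_gt_zero mult_pos_pos)
    have "norm (D n x - D m x) \<le> e" if nm: "n \<ge> N" "m \<ge> N" and x: "x \<in> ball z0 R" for n m x
    proof (rule norm_blinfun_bound)
      fix h
      have der: "((\<lambda>x. k n x - k m x) has_derivative (\<lambda>h. blinfun_apply (D n y) h - blinfun_apply (D m y) h)) (at y)"
        if "y \<in> ball z0 (2 * R)" for y
        unfolding D_def by (intro has_derivative_diff holomorphic_map_onD(1)[OF hol that])
      have "bounded_clinear (\<lambda>h. blinfun_apply (D n y) h - blinfun_apply (D m y) h)"
        if "y \<in> ball z0 (2 * R)" for y
        unfolding D_def by (intro bounded_clinear_diff holomorphic_map_onD(2)[OF hol that])
      then have "holomorphic_map_on (\<lambda>x. k n x - k m x) (ball x R)"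
        unfolding holomorphic_map_on_def using der sub[OF x] by blast
      moreover have "norm (k n y - k m y) \<le> e * R" if "y \<in> ball x R" for y
      proof -
        have "y \<in> ball z0 (2 * R)" using sub[OF x] that by blast
        then show ?thesis
          using N[OF nm(1), of y] N[OF nm(2), of y] norm_triangle_ineq4[of "k n y - g y" "k m y - g y"] by simp
      qed
      ultimately have "norm (blinfun_apply (fderiv (\<lambda>x. k n x - k m x) x) h) \<le> e * R / R * norm h"
        by (rule cauchy_estimates(1)) (use R in auto)
      then show "norm (blinfun_apply (D n x - D m x) h) \<le> e * norm h"
        using R fderiv_eq[OF der[OF inb[OF x]]] by (simp add: blinfun.diff_left)
    qed (use e in simp)
    then show ?thesis by blast
  qed
  have "\<exists>L. (\<lambda>n. D n x) \<longlonglongrightarrow> L" if x: "x \<in> ball z0 R" for x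
  proof -
    have "Cauchy (\<lambda>n. D n x)"
    proof (rule CauchyI)
      fix e :: real assume e: "0 < e"
      obtain N where "\<forall>n\<ge>N. \<forall>m\<ge>N. \<forall>x\<in>ball z0 R. norm (D n x - D m x) \<le> e / 2"
        using cauchy[of "e / 2"] e by auto
      then have "\<forall>m\<ge>N. \<forall>n\<ge>N. norm (D m x - D n x) < e" using x e by fastforce
      then show "\<exists>M. \<forall>m\<ge>M. \<forall>n\<ge>M. norm (D m x - D n x) < e" by blast
    qed
    then show ?thesis by (simp add: Cauchy_convergent convergent_def[symmetric])
  qed
  then obtain L where L: "\<And>x. x \<in> ball z0 R \<Longrightarrow> (\<lambda>n. D n x) \<longlonglongrightarrow> L x" by metis
  have unif: "\<forall>\<^sub>F n in sequentially. \<forall>x\<in>ball z0 R. \<forall>h.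
      norm (blinfun_apply (D n x) h - blinfun_apply (L x) h) \<le> e * norm h" if e: "0 < e" for e
  proof -
    obtain N where N: "\<forall>n\<ge>N. \<forall>m\<ge>N. \<forall>x\<in>ball z0 R. norm (D n x - D m x) \<le> e"
      using cauchy[OF e] by blast
    have "norm (D n x - L x) \<le> e" if "n \<ge> N" and x: "x \<in> ball z0 R" for n x
    proof (rule tendsto_upperbound)
      show "(\<lambda>m. norm (D n x - D m x)) \<longlonglongrightarrow> norm (D n x - L x)" by (intro tendsto_intros L x)
      show "\<forall>\<^sub>F m in sequentially. norm (D n x - D m x) \<le> e"
        unfolding eventually_sequentially using N that by blast
    qed simp
    then have "norm (blinfun_apply (D n x) h - blinfun_apply (L x) h) \<le> e * norm h"
      if "n \<ge> N" "x \<in> ball z0 R" for n x h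
      using norm_blinfun[of "D n x - L x" h] mult_right_mono[of "norm (D n x - L x)" e "norm h"] that
      by (simp add: blinfun.diff_left)
    then show ?thesis unfolding eventually_sequentially by blast
  qed
  have ptlim: "(\<lambda>n. k n x) \<longlonglongrightarrow> g x" if x: "x \<in> ball z0 R" for x
  proof (rule LIMSEQ_I)
    fix e :: real assume e: "0 < e"
    obtain N where "\<forall>n\<ge>N. \<forall>x\<in>ball z0 (2 * R). norm (k n x - g x) \<le> e / 2"
      using lim[of "e / 2"] e by auto
    then have "\<forall>n\<ge>N. norm (k n x - g x) < e" using inb[OF x] e by fastforce
    then show "\<exists>N. \<forall>n\<ge>N. norm (k n x - g x) < e" by blast
  qed
  have "\<exists>g'. \<forall>x\<in>ball z0 R. (\<lambda>n. k n x) \<longlonglongrightarrow> g' x \<and> (g' has_derivative blinfun_apply (L x)) (at x within ball z0 R)"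
  proof (rule has_derivative_sequence[OF _ _ unif])
    show "(k n has_derivative blinfun_apply (D n x)) (at x within ball z0 R)" if "x \<in> ball z0 R" for n x
      unfolding D_def by (rule has_derivative_at_withinI[OF holomorphic_map_onD(1)[OF hol inb[OF that]]])
    show "z0 \<in> ball z0 R" using R by simp
    show "(\<lambda>n. k n z0) \<longlonglongrightarrow> g z0" using R by (intro ptlim) simp
  qed auto
  then obtain g' where g': "\<And>x. x \<in> ball z0 R \<Longrightarrow> (\<lambda>n. k n x) \<longlonglongrightarrow> g' x"
    "\<And>x. x \<in> ball z0 R \<Longrightarrow> (g' has_derivative blinfun_apply (L x)) (at x within ball z0 R)" by blast
  show ?thesis
    unfolding holomorphic_map_on_def
  proof (intro ballI exI conjI)
    fix x assume x: "x \<in> ball z0 R"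
    have "(g' has_derivative blinfun_apply (L x)) (at x)"
      using g'(2)[OF x] at_within_open[OF x open_ball] by simp
    then show "(g has_derivative blinfun_apply (L x)) (at x)"
      by (rule has_derivative_transform_within_open[OF _ open_ball x])
         (use LIMSEQ_unique[OF g'(1) ptlim] in blast)
    show "bounded_clinear (blinfun_apply (L x))"
      by (rule bounded_clinear_limit[OF L[OF x]])
         (unfold D_def, rule holomorphic_map_onD(2)[OF hol inb[OF x]])
  qed
qed

text \<open>
  For fixed \<open>w\<close>, the map \<open>g w = (\<lambda>z. Df(z)w)\<close> is a locally uniform limit of difference quotients of \<open>f\<close>,
  hence holomorphic, and it is bounded by a multiple of \<open>|w|\<close>. Its second-order Taylor estimate is
  therefore also uniform for \<open>|w| \<le> 1\<close>, which makes \<open>z \<mapsto> Df(z)\<close> differentiable in the operator norm.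
\<close>

theorem holomorphic_map_on_fderiv:
  fixes f :: "'a::complex_normed_vector \<Rightarrow> 'b::cbanach"
  assumes hol: "holomorphic_map_on f S" and S: "open S"
  shows "holomorphic_map_on (fderiv f) S"
  unfolding holomorphic_map_on_def
proof
  fix z0 assume z0: "z0 \<in> S"
  obtain d1 where d1: "0 < d1" "ball z0 d1 \<subseteq> S" using S z0 open_contains_ball by blast
  have "isCont f z0" using holomorphic_map_onD(1)[OF hol z0] has_derivative_continuous by blast
  then obtain d2 where d2: "0 < d2" "\<And>x. dist x z0 < d2 \<Longrightarrow> dist (f x) (f z0) < 1"
    unfolding continuous_at_eps_delta by (metis zero_less_one)
  define R M where "R = min d1 d2 / 4" and "M = norm (f z0) + 1"
  have R: "0 < R" using d1 d2 by (simp add: R_def)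
  have M: "0 \<le> M" by (simp add: M_def)
  have B4: "x \<in> S \<and> norm (f x) \<le> M" if "x \<in> ball z0 (4 * R)" for x
  proof
    have x: "dist z0 x < min d1 d2" using that by (simp add: R_def)
    then show "x \<in> S" using d1 by auto
    have "dist x z0 < d2" using x by (simp add: dist_commute)
    then have "norm (f x - f z0) < 1" using d2(2) by (simp add: dist_norm)
    then show "norm (f x) \<le> M" using norm_triangle_sub[of "f x" "f z0"] by (simp add: M_def)
  qed
  have sub: "x \<in> ball z0 (4 * R)" if "z \<in> ball z0 (2 * R)" "dist z x < 2 * R" for x z
    using that dist_triangle[of z0 x z] by simp
  have hol2: "holomorphic_map_on f (ball z (2 * R))" if "z \<in> ball z0 (2 * R)" for z
    using hol B4 sub[OF that] unfolding holomorphic_map_on_def by auto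
  have bd2: "norm (f x) \<le> M" if "z \<in> ball z0 (2 * R)" "x \<in> ball z (2 * R)" for z x
    using B4 sub that by auto
  define g where "g w z = blinfun_apply (fderiv f z) w" for w z
  have g1: "norm (g w z) \<le> M / (2 * R) * norm w" if "z \<in> ball z0 (2 * R)" for z w
    unfolding g_def by (rule cauchy_estimates(1)[OF hol2 bd2]) (use that R in auto)
  have g_hol: "holomorphic_map_on (g w) (ball z0 R)" for w
  proof -
    \<comment> \<open>Step sizes that tend to zero and satisfy \<open>|t n w| \<le> R\<close> from the start.\<close>
    define t where "t n = R / ((norm w + 1) * real (Suc n))" for n
    define k where "k n z = (1 / t n) *\<^sub>R (f (z + t n *\<^sub>R w) - f z)" for n z
    have t0: "0 < t n" for n using R by (simp add: t_def add_nonneg_pos)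
    have tw: "norm (t n *\<^sub>R w) \<le> R" for n
    proof -
      have "norm w \<le> (norm w + 1) * real (Suc n)"
        using mult_left_mono[of 1 "real (Suc n)" "norm w + 1"] by simp
      moreover have "0 < (norm w + 1) * real (Suc n)" by (simp add: add_nonneg_pos)
      ultimately show ?thesis using R unfolding t_def by (simp add: divide_le_eq mult_left_mono)
    qed
    have shift: "z + t n *\<^sub>R w \<in> ball z0 (4 * R)" if "z \<in> ball z0 (2 * R)" for n z
      by (rule sub[OF that]) (use tw[of n] R in \<open>simp add: dist_norm\<close>)
    show ?thesis
    proof (rule holomorphic_map_on_uniform_limit[OF _ R])
      show "holomorphic_map_on (k n) (ball z0 (2 * R))" for n
        unfolding holomorphic_map_on_def
      proof (intro ballI exI conjI)
        fix z assume z: "z \<in> ball z0 (2 * R)"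
        have zS: "z \<in> S" using B4 sub[OF z, of z] R by simp
        have sS: "z + t n *\<^sub>R w \<in> S" using B4 shift[OF z] by blast
        let ?D = "\<lambda>h. (1 / t n) *\<^sub>R (blinfun_apply (fderiv f (z + t n *\<^sub>R w)) h - blinfun_apply (fderiv f z) h)"
        show "bounded_clinear ?D"
          by (intro bounded_clinear_scaleR bounded_clinear_diff holomorphic_map_onD(2)[OF hol] zS sS)
        have "((\<lambda>z. z + t n *\<^sub>R w) has_derivative (\<lambda>h. h)) (at z)"
          by (auto intro!: derivative_eq_intros)
        from has_derivative_compose[OF this holomorphic_map_onD(1)[OF hol sS]]
        show "(k n has_derivative ?D) (at z)"
          unfolding k_def
          by (intro has_derivative_scaleR_right has_derivative_diff holomorphic_map_onD(1)[OF hol zS])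
      qed
      fix e :: real assume e: "0 < e"
      define C where "C = 32 * M / (2 * R)^2 * norm w ^ 2"
      have "(\<lambda>n. C * (R / (norm w + 1)) * (1 / real (Suc n))) \<longlonglongrightarrow> C * (R / (norm w + 1)) * 0"
        by (intro tendsto_intros LIMSEQ_Suc lim_1_over_n)
      then have "\<forall>\<^sub>F n in sequentially. C * (R / (norm w + 1)) * (1 / real (Suc n)) < e"
        using e by (intro order_tendstoD(2)) auto
      then obtain N where N: "\<And>n. n \<ge> N \<Longrightarrow> C * t n < e"
        unfolding eventually_sequentially t_def by (auto simp: mult.assoc)
      have "norm (k n z - g w z) \<le> e" if n: "n \<ge> N" and z: "z \<in> ball z0 (2 * R)" for n z
      proof -
        have "norm (f (z + t n *\<^sub>R w) - f z - blinfun_apply (fderiv f z) (t n *\<^sub>R w))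
            \<le> 32 * M / (2 * R)^2 * norm (t n *\<^sub>R w) ^ 2"
          by (rule cauchy_estimates(2)[OF hol2[OF z] bd2[OF z]]) (use R tw in auto)
        also have "\<dots> = C * (t n)^2" using t0[of n] by (simp add: C_def power_mult_distrib)
        finally have le: "norm (f (z + t n *\<^sub>R w) - f z - t n *\<^sub>R g w z) \<le> C * (t n)^2"
          by (simp add: blinfun.scaleR_right g_def)
        have "k n z - g w z = (1 / t n) *\<^sub>R (f (z + t n *\<^sub>R w) - f z - t n *\<^sub>R g w z)"
          using t0[of n] by (simp add: k_def scaleR_diff_right)
        then have "norm (k n z - g w z) = norm (f (z + t n *\<^sub>R w) - f z - t n *\<^sub>R g w z) / t n"
          using t0[of n] by simp
        also have "\<dots> \<le> C * (t n)^2 / t n" using le t0[of n] by (intro divide_right_mono) auto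
        also have "\<dots> = C * t n" using t0[of n] by (simp add: power2_eq_square)
        finally show ?thesis using N[OF n] by simp
      qed
      then show "\<exists>N. \<forall>n\<ge>N. \<forall>x\<in>ball z0 (2 * R). norm (k n x - g w x) \<le> e" by blast
    qed
  qed
  have gb: "norm (g w x) \<le> M / (2 * R) * norm w" if "x \<in> ball z0 R" for w x
    using that R by (intro g1) simp
  define T where "T w = blinfun_apply (fderiv (g w) z0)" for w
  have z0R: "z0 \<in> ball z0 R" using R by simp
  have Tder: "(g w has_derivative T w) (at z0)" and Tcl: "bounded_clinear (T w)" for w
    unfolding T_def by (rule holomorphic_map_onD[OF g_hol z0R])+
  define K where "K = M / (2 * R) / R"
  have K: "0 \<le> K" using M R by (simp add: K_def)
  have Tb: "norm (T w h) \<le> K * norm h * norm w" for w h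
    using cauchy_estimates(1)[OF g_hol gb R, of w h] by (simp add: T_def K_def mult_ac)
  have T2: "norm (g w (z0 + h) - g w z0 - T w h) \<le> 32 * K / R * norm h ^ 2 * norm w"
    if "norm h \<le> R / 2" for w h
    using cauchy_estimates(2)[OF g_hol gb R that, of w] by (simp add: T_def K_def power2_eq_square mult_ac)
  have Tadd: "T (v + w) h = T v h + T w h" for v w h
  proof -
    have "(g (v + w) has_derivative (\<lambda>h. T v h + T w h)) (at z0)"
      using has_derivative_add[OF Tder[of v] Tder[of w]] by (simp add: g_def[abs_def] blinfun.add_right)
    from has_derivative_unique[OF Tder this] show ?thesis by (rule fun_cong)
  qed
  have Tscale: "T (r *\<^sub>R w) h = r *\<^sub>R T w h" for r w h
  proof -
    have "(g (r *\<^sub>R w) has_derivative (\<lambda>h. r *\<^sub>R T w h)) (at z0)"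
      using has_derivative_scaleR_right[OF Tder[of w], of r] by (simp add: g_def[abs_def] blinfun.scaleR_right)
    from has_derivative_unique[OF Tder this] show ?thesis by (rule fun_cong)
  qed
  define L where "L h = Blinfun (\<lambda>w. T w h)" for h
  have Lap: "blinfun_apply (L h) w = T w h" for h w
  proof -
    have "bounded_linear (\<lambda>w. T w h)"
      by (rule bounded_linear_intro[where K = "K * norm h"]) (use Tadd Tscale Tb in \<open>auto simp: mult_ac\<close>)
    then show ?thesis by (simp add: L_def bounded_linear_Blinfun_apply)
  qed
  have "bounded_linear L"
  proof (rule bounded_linear_intro[where K = K])
    have lin: "linear (T w)" for w using Tcl by (simp add: bounded_clinear_def bounded_linear.linear)
    show "L (x + y) = L x + L y" for x y
      by (rule blinfun_eqI) (simp add: Lap blinfun.add_left linear_add[OF lin])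
    show "L (r *\<^sub>R x) = r *\<^sub>R L x" for r x
      by (rule blinfun_eqI) (simp add: Lap blinfun.scaleR_left linear_scale[OF lin])
    show "norm (L h) \<le> norm h * K" for h
      by (rule norm_blinfun_bound) (use K Tb[of _ h] in \<open>auto simp: Lap mult_ac\<close>)
  qed
  moreover have "L (c *\<^sub>C h) = c *\<^sub>C L h" for c h
    by (rule blinfun_eqI) (simp add: Lap scaleC_blinfun.rep_eq bounded_clinear_scaleC[OF Tcl])
  ultimately have Lcl: "bounded_clinear L" by (simp add: bounded_clinear_def)
  have "(fderiv f has_derivative L) (at z0)"
  proof (rule has_derivativeI_sandwich)
    show "0 < R / 2" using R by simp
    show "bounded_linear L" by fact
    show "norm (fderiv f y - fderiv f z0 - L (y - z0)) / norm (y - z0) \<le> 32 * K / R * norm (y - z0)"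
      if "y \<noteq> z0" "dist y z0 < R / 2" for y
    proof -
      define h where "h = y - z0"
      have h: "h \<noteq> 0" "norm h \<le> R / 2" using that by (auto simp: h_def dist_norm)
      have "norm (fderiv f (z0 + h) - fderiv f z0 - L h) \<le> 32 * K / R * norm h ^ 2"
        by (rule norm_blinfun_bound)
           (use T2[OF h(2)] K R in \<open>simp_all add: blinfun.diff_left Lap g_def\<close>)
      then show ?thesis using h(1) by (simp add: h_def divide_le_eq power2_eq_square mult_ac)
    qed
    have "((\<lambda>y. 32 * K / R * norm (y - z0)) \<longlongrightarrow> 32 * K / R * norm (z0 - z0)) (at z0)"
      by (intro tendsto_intros)
    then show "((\<lambda>y. 32 * K / R * norm (y - z0)) \<longlongrightarrow> 0) (at z0)" by simp
  qed
  with Lcl show "\<exists>f'. bounded_clinear f' \<and> (fderiv f has_derivative f') (at z0)" by blast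
qed

section \<open>Restriction to complex lines\<close>

text \<open>
  Both sides have the same shape, with \<open>F\<close> and \<open>l\<close> replaced by \<open>DF\<close> and \<open>A \<mapsto> l(Az)\<close> on the right;
  therefore the lemma can be iterated.
\<close>

lemma higher_deriv_slice:
  fixes F :: "'a::complex_normed_vector \<Rightarrow> 'b::complex_normed_vector"
  assumes F: "holomorphic_map_on F (ball 0 1)" and l: "bounded_clinear l"
  shows "(deriv ^^ Suc n) (\<lambda>\<zeta>. l (F (\<zeta> *\<^sub>C z)) :: complex) 0
    = (deriv ^^ n) (\<lambda>\<zeta>. l (blinfun_apply (fderiv F (\<zeta> *\<^sub>C z)) z)) 0"
  unfolding funpow_Suc_right o_def
proof (rule higher_deriv_cong_ev)
  have "open ((\<lambda>\<zeta>. \<zeta> *\<^sub>C z) -` ball 0 1)"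
    by (intro open_vimage continuous_intros scaleC.continuous_on) auto
  then have "\<forall>\<^sub>F \<zeta> in nhds 0. \<zeta> \<in> (\<lambda>\<zeta>. \<zeta> *\<^sub>C z) -` ball 0 1"
    by (rule eventually_nhds_in_open) (simp add: scaleC.zero_left)
  then show "\<forall>\<^sub>F \<zeta> in nhds 0. deriv (\<lambda>\<zeta>. l (F (\<zeta> *\<^sub>C z))) \<zeta> = l (blinfun_apply (fderiv F (\<zeta> *\<^sub>C z)) z)"
  proof eventually_elim
    case (elim \<zeta>)
    then have "0 + \<zeta> *\<^sub>C z \<in> ball 0 1" by simp
    from has_field_derivative_slice[OF holomorphic_map_onD[OF F this] l]
    show ?case by (simp add: DERIV_imp_deriv)
  qed
qed simp

lemma higher_deriv_slice_diag:
  fixes F :: "'a::cbanach \<Rightarrow> 'a" and z :: 'a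
  assumes F: "holomorphic_map_on F (ball 0 1)" and l: "bounded_clinear l"
  defines "h \<equiv> \<lambda>\<zeta>. l (F (\<zeta> *\<^sub>C z)) :: complex"
  shows "(deriv ^^ 2) h 0 = l (D2_diag F z)" "(deriv ^^ 3) h 0 = l (D3_diag F z)"
    "(deriv ^^ 4) h 0 = l (D4_diag F z)"
proof -
  note hol1 = holomorphic_map_on_fderiv[OF F open_ball]
  note hol2 = holomorphic_map_on_fderiv[OF hol1 open_ball]
  note hol3 = holomorphic_map_on_fderiv[OF hol2 open_ball]
  note l1 = bounded_clinear_compose[OF l bounded_clinear_eval[of z]]
  note l2 = bounded_clinear_compose[OF l1 bounded_clinear_eval[of z]]
  note l3 = bounded_clinear_compose[OF l2 bounded_clinear_eval[of z]]
  note step = higher_deriv_slice[OF F l, of _ z] higher_deriv_slice[OF hol1 l1, of _ z]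
    higher_deriv_slice[OF hol2 l2, of _ z] higher_deriv_slice[OF hol3 l3, of _ z]
  have n: "2 = Suc (Suc 0)" "3 = Suc (Suc (Suc 0))" "4 = Suc (Suc (Suc (Suc 0)))" by simp_all
  show "(deriv ^^ 2) h 0 = l (D2_diag F z)" "(deriv ^^ 3) h 0 = l (D3_diag F z)"
    "(deriv ^^ 4) h 0 = l (D4_diag F z)"
    unfolding h_def n step D2_diag_def D3_diag_def D4_diag_def by (simp_all add: scaleC.zero_left)
qed

lemma has_derivative_times_id:
  fixes f :: "'a::complex_normed_vector \<Rightarrow> complex"
  assumes "(f has_derivative f') (at z)"
  shows "(times_id f has_derivative (\<lambda>w. f z *\<^sub>C w + f' w *\<^sub>C z)) (at z)"
  unfolding times_id_def[abs_def] by (rule scaleC.FDERIV[OF assms has_derivative_ident])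

lemma holomorphic_map_on_times_id:
  assumes "holomorphic_map_on f S" shows "holomorphic_map_on (times_id f) S"
  unfolding holomorphic_map_on_def
proof (intro ballI exI conjI)
  fix z assume z: "z \<in> S"
  note f = holomorphic_map_onD[OF assms z]
  show der: "(times_id f has_derivative (\<lambda>w. f z *\<^sub>C w + blinfun_apply (fderiv f z) w *\<^sub>C z)) (at z)"
    by (rule has_derivative_times_id[OF f(1)])
  show "bounded_clinear (\<lambda>w. f z *\<^sub>C w + blinfun_apply (fderiv f z) w *\<^sub>C z)"
    unfolding bounded_clinear_def
    using has_derivative_bounded_linear[OF der]
    by (auto simp: bounded_clinear_scaleC[OF f(2)] scaleC_add_right scaleC_scaleC scaleC_complex_def mult.commute)
qed

text \<open>
  The function \<open>l(F(\<zeta>z))\<close> equals \<open>r\<zeta>\<phi>(r\<zeta>)\<close> with \<open>r = |z|\<close>. The extra factor \<open>\<zeta>\<close> shifts the index by one, and the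
  powers of \<open>r\<close> are those divided out in the definition of the \<open>A\<^sub>n\<close>.
\<close>

lemma A_eq_slice_coeffs:
  fixes f :: "'a::cbanach \<Rightarrow> complex"
  assumes f: "holomorphic_map_on f (ball 0 1)" and z: "z \<noteq> 0" and l: "l \<in> support_functionals z"
    and P: "(\<lambda>\<xi>. f (\<xi> *\<^sub>C ((1 / norm z) *\<^sub>R z))) has_fps_expansion P"
  shows "A2 (times_id f) l z = fps_nth P 1" "A3 (times_id f) l z = fps_nth P 2"
    "A4 (times_id f) l z = fps_nth P 3"
proof -
  define r where "r = norm z"
  have r: "0 < r" using z by (simp add: r_def)
  have lz: "bounded_clinear l" "l z = of_real r" using l by (auto simp: support_functionals_def r_def)
  define \<phi> where "\<phi> = (\<lambda>\<xi>. f (\<xi> *\<^sub>C ((1 / r) *\<^sub>R z)))"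
  define h where "h = (\<lambda>\<zeta>. l (times_id f (\<zeta> *\<^sub>C z)))"
  have h: "h \<zeta> = of_real r * (\<zeta> * (\<phi> \<circ> (\<lambda>\<zeta>. of_real r * \<zeta>)) \<zeta>)" for \<zeta>
    using r by (simp add: h_def times_id_def bounded_clinear_scaleC[OF lz(1)] lz(2) \<phi>_def
        scaleR_scaleC scaleC_scaleC) (simp add: scaleC_complex_def)
  define Q where "Q = fps_const (of_real r) * (fps_X * fps_compose P (fps_const (of_real r) * fps_X))"
  have hQ: "h has_fps_expansion Q"
    unfolding h[abs_def] \<phi>_def r_def Q_def
    by (intro fps_expansion_intros has_fps_expansion_compose P) simp
  have nth: "fps_nth Q (Suc n) = of_real r * (of_real r ^ n * fps_nth P n)" for n
    by (simp add: Q_def fps_compose_linear)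
  have "(deriv ^^ Suc n) h 0 = fact (Suc n) * (of_real r ^ Suc n * fps_nth P n)" for n
  proof -
    have "(deriv ^^ Suc n) h 0 = fact (Suc n) * fps_nth Q (Suc n)"
      unfolding fps_nth_fps_expansion[OF hQ] by (simp del: fact_Suc funpow.simps)
    then show ?thesis unfolding nth by (simp only: power_Suc mult.assoc)
  qed
  from this[of 1] this[of 2] this[of 3]
  have d: "(deriv ^^ 2) h 0 = fact 2 * (of_real r ^ 2 * fps_nth P 1)"
    "(deriv ^^ 3) h 0 = fact 3 * (of_real r ^ 3 * fps_nth P 2)"
    "(deriv ^^ 4) h 0 = fact 4 * (of_real r ^ 4 * fps_nth P 3)"
    by (simp_all only: eval_nat_numeral One_nat_def BitM.simps)
  note diag = higher_deriv_slice_diag[OF holomorphic_map_on_times_id[OF f] lz(1), of z, folded h_def]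
  show "A2 (times_id f) l z = fps_nth P 1" "A3 (times_id f) l z = fps_nth P 2"
    "A4 (times_id f) l z = fps_nth P 3"
    unfolding A2_def A3_def A4_def diag[symmetric] d using r by (simp_all add: r_def)
qed

lemma slice_has_field_derivative:
  assumes f: "holomorphic_map_on f (ball 0 1)" and u: "norm u = 1" and \<zeta>: "cmod \<zeta> < 1"
  shows "((\<lambda>\<xi>. f (\<xi> *\<^sub>C u) :: complex) has_field_derivative blinfun_apply (fderiv f (\<zeta> *\<^sub>C u)) u) (at \<zeta>)"
proof -
  have "bounded_clinear (\<lambda>x::complex. x)" by (simp add: bounded_clinear_def bounded_linear_ident)
  moreover have "0 + \<zeta> *\<^sub>C u \<in> ball 0 1" using u \<zeta> by (simp add: norm_scaleC)
  ultimately show ?thesis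
    using has_field_derivative_slice[OF holomorphic_map_onD[OF f]] by fastforce
qed

lemma A_functional_eq:
  fixes f :: "'a::cbanach \<Rightarrow> complex"
  assumes f: "holomorphic_map_on f (ball 0 1)" "f 0 = 1" and z: "z \<noteq> 0" and l: "l \<in> support_functionals z"
  defines "\<phi> \<equiv> \<lambda>\<xi>. f (\<xi> *\<^sub>C ((1 / norm z) *\<^sub>R z))"
  assumes eq: "\<And>\<zeta>. cmod \<zeta> < 1 \<Longrightarrow> \<zeta> * deriv \<phi> \<zeta> = \<phi> \<zeta> * (\<Phi> (\<omega> \<zeta>) - 1)"
    and P: "\<Phi> has_fps_expansion P" "fps_nth P 0 = 1" and W: "\<omega> has_fps_expansion W" "fps_nth W 0 = 0"
  shows "A2 (times_id f) l z * A3 (times_id f) l z - A4 (times_id f) l z =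
    - (fps_nth P 1 * fps_nth W 3 + 2 * fps_nth P 2 * fps_nth W 1 * fps_nth W 2
        + (fps_nth P 3 - fps_nth P 1 ^ 3) * fps_nth W 1 ^ 3) / 3"
proof -
  have "norm ((1 / norm z) *\<^sub>R z) = 1" using z by simp
  then have "\<phi> holomorphic_on ball 0 1"
    unfolding \<phi>_def holomorphic_on_open[OF open_ball]
    using slice_has_field_derivative[OF f(1)] by (meson mem_ball_0)
  then obtain F where F: "\<phi> has_fps_expansion F" using holomorphic_on_unit_ball_fps by blast
  have F0: "fps_nth F 0 = 1"
    using has_fps_expansion_imp_0_eq_fps_nth_0[OF F] f(2) by (simp add: \<phi>_def scaleC.zero_left)
  have "(\<lambda>\<zeta>. \<zeta> * deriv \<phi> \<zeta>) has_fps_expansion fps_X * fps_deriv F"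
    by (intro fps_expansion_intros F)
  moreover have "(\<lambda>\<zeta>. \<phi> \<zeta> * ((\<Phi> \<circ> \<omega>) \<zeta> - 1)) has_fps_expansion F * (fps_compose P W - 1)"
    by (intro fps_expansion_intros F has_fps_expansion_compose P W)
  moreover have "\<forall>\<^sub>F \<zeta> in nhds 0. \<zeta> * deriv \<phi> \<zeta> = \<phi> \<zeta> * ((\<Phi> \<circ> \<omega>) \<zeta> - 1)"
    using eventually_nhds_in_open[of "ball 0 1" "0::complex"]
    by (rule eventually_mono) (auto simp: eq)
  ultimately have "fps_X * fps_deriv F = F * (fps_compose P W - 1)"
    by (rule fps_eq_of_eventually_eq)
  from starlike_coeff_relation[OF F0 P(2) W(2) this]
  show ?thesis unfolding A_eq_slice_coeffs[OF f(1) z l F[unfolded \<phi>_def]] .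
qed

section \<open>Admissible functions and the class of mappings\<close>

lemma admissibleD:
  assumes "admissible \<Phi>"
  shows "\<Phi> holomorphic_on ball 0 1" "inj_on \<Phi> (ball 0 1)" "inv_into (ball 0 1) \<Phi> holomorphic_on \<Phi> ` ball 0 1"
    "\<Phi> 0 = 1" "\<And>\<zeta>. cmod \<zeta> < 1 \<Longrightarrow> 0 < Re (\<Phi> \<zeta>)" "0 < Re (deriv \<Phi> 0)"
  using assms by (auto simp: admissible_def biholomorphic_onto_image_def)

text \<open>
  The reflected function \<open>\<Psi>(z)\<close>, the conjugate of \<open>\<Phi>\<close> at the conjugate of \<open>z\<close>, has the same image, the same value and the
  same derivative at \<open>0\<close>. So \<open>\<Phi>\<^sup>-\<^sup>1 \<circ> \<Psi>\<close> maps the disc into itself and fixes \<open>0\<close> with derivative one, and by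
  the Schwarz lemma it is the identity.
\<close>

lemma admissible_cnj:
  assumes adm: "admissible \<Phi>" and z: "cmod \<zeta> < 1"
  shows "\<Phi> (cnj \<zeta>) = cnj (\<Phi> \<zeta>)"
proof -
  note A = admissibleD[OF adm]
  have sym: "cnj ` (\<Phi> ` ball 0 1) = \<Phi> ` ball 0 1" and d0: "deriv \<Phi> 0 \<in> \<real>" "Re (deriv \<Phi> 0) > 0"
    using adm by (auto simp: admissible_def)
  define \<Psi> where "\<Psi> = (\<lambda>z. cnj (\<Phi> (cnj z)))"
  have PsiD: "(\<Psi> has_field_derivative cnj (deriv \<Phi> (cnj z))) (at z)" if "cmod z < 1" for z
  proof -
    have "(\<Phi> has_field_derivative deriv \<Phi> (cnj z)) (at (cnj z))"
      by (rule holomorphic_derivI[OF A(1) open_ball]) (use that in simp)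
    from has_field_derivative_cnj_cnj[OF this] show ?thesis by (simp add: \<Psi>_def o_def)
  qed
  have Psi_hol: "\<Psi> holomorphic_on ball 0 1"
    unfolding holomorphic_on_open[OF open_ball] using PsiD by (meson mem_ball_0)
  have Psi_img: "\<Psi> z \<in> \<Phi> ` ball 0 1" if "cmod z < 1" for z
  proof -
    have "\<Phi> (cnj z) \<in> \<Phi> ` ball 0 1" using that by (intro imageI) simp
    then show ?thesis unfolding \<Psi>_def using sym by blast
  qed
  define \<omega> where "\<omega> = inv_into (ball 0 1) \<Phi> \<circ> \<Psi>"
  have om_hol: "\<omega> holomorphic_on ball 0 1"
    unfolding \<omega>_def by (rule holomorphic_on_compose_gen[OF Psi_hol A(3)]) (use Psi_img in auto)
  have om: "\<Phi> (\<omega> z) = \<Psi> z" "cmod (\<omega> z) < 1" if "cmod z < 1" for z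
    using f_inv_into_f[OF Psi_img[OF that]] inv_into_into[OF Psi_img[OF that]] by (simp_all add: \<omega>_def)
  have om0: "\<omega> 0 = 0"
    using inv_into_f_f[OF A(2), of 0] A(4) by (simp add: \<omega>_def \<Psi>_def)
  have "deriv \<omega> 0 = 1"
  proof -
    have d1: "(\<omega> has_field_derivative deriv \<omega> 0) (at 0)"
      by (rule holomorphic_derivI[OF om_hol open_ball]) simp
    have d2: "(\<Phi> has_field_derivative deriv \<Phi> 0) (at (\<omega> 0))"
      unfolding om0 by (rule holomorphic_derivI[OF A(1) open_ball]) simp
    have "((\<lambda>z. \<Phi> (\<omega> z)) has_field_derivative deriv \<Phi> 0 * deriv \<omega> 0) (at 0)"
      by (rule DERIV_chain2[OF d2 d1])
    then have "(\<Psi> has_field_derivative deriv \<Phi> 0 * deriv \<omega> 0) (at 0)"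
      by (rule has_field_derivative_transform_within_open[OF _ open_ball[of 0 1]]) (simp_all add: om)
    moreover have "(\<Psi> has_field_derivative deriv \<Phi> 0) (at 0)"
      using PsiD[of 0] d0(1) by (simp add: Reals_cnj_iff)
    ultimately have "deriv \<Phi> 0 * deriv \<omega> 0 = deriv \<Phi> 0" by (rule DERIV_unique)
    then show ?thesis using d0(2) by auto
  qed
  then have "\<exists>\<alpha>. (\<forall>z. cmod z < 1 \<longrightarrow> \<omega> z = \<alpha> * z) \<and> cmod \<alpha> = 1"
    by (intro Schwarz_Lemma(3)[OF om_hol om0 om(2), of 0]) auto
  then obtain \<alpha> where \<alpha>: "\<And>z. cmod z < 1 \<Longrightarrow> \<omega> z = \<alpha> * z" by blast
  have "(\<omega> has_field_derivative \<alpha>) (at 0)"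
  proof (rule has_field_derivative_transform_within_open[OF _ open_ball[of 0 1]])
    show "((\<lambda>z. \<alpha> * z) has_field_derivative \<alpha>) (at 0)" by (auto intro!: derivative_eq_intros)
  qed (simp_all add: \<alpha>)
  then have "\<alpha> = 1" using \<open>deriv \<omega> 0 = 1\<close> by (simp add: DERIV_imp_deriv)
  then have "\<Phi> \<zeta> = \<Psi> \<zeta>" using om(1)[OF z] \<alpha>[OF z] by simp
  then show ?thesis by (simp add: \<Psi>_def)
qed

lemma higher_deriv_real:
  assumes hol: "f holomorphic_on ball 0 1" and cnj: "\<And>z. cmod z < 1 \<Longrightarrow> f (cnj z) = cnj (f z)"
    and z: "cmod z < 1"
  shows "(deriv ^^ n) f (cnj z) = cnj ((deriv ^^ n) f z)"
  using z
proof (induction n arbitrary: z)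
  case (Suc n)
  define g where "g = (deriv ^^ n) f"
  have "(g has_field_derivative deriv g z) (at z)"
    unfolding g_def by (rule holomorphic_derivI[OF holomorphic_higher_deriv[OF hol open_ball] open_ball])
       (use Suc.prems in simp)
  then have "((cnj \<circ> g \<circ> cnj) has_field_derivative cnj (deriv g z)) (at (cnj z))"
    using has_field_derivative_cnj_cnj[of g "deriv g z" "cnj z"] by simp
  then have "(g has_field_derivative cnj (deriv g z)) (at (cnj z))"
  proof (rule has_field_derivative_transform_within_open[OF _ open_ball[of 0 1]])
    show "(cnj \<circ> g \<circ> cnj) x = g x" if "x \<in> ball 0 1" for x
      using Suc.IH[of x] that by (simp add: g_def)
  qed (use Suc.prems in simp)
  then show ?case by (simp add: g_def DERIV_imp_deriv)
qed (use cnj in simp)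

lemma admissible_fps:
  assumes adm: "admissible \<Phi>"
  obtains P where "\<Phi> has_fps_expansion P" "fps_nth P 0 = 1"
    "\<And>n. fps_nth P n = of_real (taylor_coeff \<Phi> n)" "0 < taylor_coeff \<Phi> 1"
proof -
  note A = admissibleD[OF adm]
  obtain P where P: "\<Phi> has_fps_expansion P" using holomorphic_on_unit_ball_fps[OF A(1)] by blast
  have "fps_nth P n = of_real (taylor_coeff \<Phi> n)" for n
  proof -
    have "(deriv ^^ n) \<Phi> 0 \<in> \<real>"
      using higher_deriv_real[OF A(1) admissible_cnj[OF adm], of 0 n] by (simp add: Reals_cnj_iff)
    moreover have "(fact n :: complex) \<in> \<real>" by (metis Reals_of_nat of_nat_fact)
    ultimately have "(deriv ^^ n) \<Phi> 0 / fact n \<in> \<real>" by (rule Reals_divide)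
    then show ?thesis unfolding fps_nth_fps_expansion[OF P] taylor_coeff_def by simp
  qed
  moreover have "fps_nth P 0 = 1" using has_fps_expansion_imp_0_eq_fps_nth_0[OF P] A(4) by simp
  ultimately show ?thesis using that P A(6) by (simp add: taylor_coeff_def)
qed

lemma fderiv_times_id:
  assumes f: "holomorphic_map_on f (ball 0 1)" and z: "z \<in> ball 0 1"
  shows "blinfun_apply (fderiv (times_id f) z) w = f z *\<^sub>C w + blinfun_apply (fderiv f z) w *\<^sub>C z"
  using fderiv_eq[OF has_derivative_times_id[OF holomorphic_map_onD(1)[OF f z]]] by (rule fun_cong)

text \<open>
  The hypothesis at \<open>\<zeta>u\<close> speaks of support functionals of \<open>\<zeta>u\<close>; one is obtained from \<open>l\<close> by a rotation.
\<close>

lemma support_functional_rotate: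
  fixes u :: "'a::complex_normed_vector"
  assumes l: "l \<in> support_functionals u" and u: "norm u = 1" and \<zeta>: "\<zeta> \<noteq> 0"
  shows "(\<lambda>x. cnj (sgn \<zeta>) * l x) \<in> support_functionals (\<zeta> *\<^sub>C u)"
proof -
  have bl: "bounded_clinear l" "l u = 1" "onorm l = 1" using l u by (auto simp: support_functionals_def)
  have s: "cmod (sgn \<zeta>) = 1" using \<zeta> by (simp add: norm_sgn)
  have "bounded_clinear (\<lambda>x. cnj (sgn \<zeta>) * l x)"
    using bounded_clinear_bounded_linear[OF bl(1)] bounded_clinear_scaleC[OF bl(1)]
    unfolding bounded_clinear_def by (auto intro: bounded_linear_mult_const bounded_linear_compose[OF bounded_linear_mult_right] simp: scaleC_complex_def)
  moreover have "cnj (sgn \<zeta>) * \<zeta> = of_real (cmod \<zeta>)"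
  proof -
    have "cnj (sgn \<zeta>) * (sgn \<zeta> * of_real (cmod \<zeta>)) = of_real (cmod \<zeta>)"
      using s complex_norm_square[of "sgn \<zeta>"] by (simp add: mult.assoc[symmetric] mult.commute)
    then show ?thesis using \<zeta> by (simp add: sgn_eq)
  qed
  then have "cnj (sgn \<zeta>) * l (\<zeta> *\<^sub>C u) = of_real (norm (\<zeta> *\<^sub>C u))"
    using u by (simp add: bounded_clinear_scaleC[OF bl(1)] bl(2) scaleC_complex_def norm_scaleC)
  moreover have "onorm (\<lambda>x. cnj (sgn \<zeta>) * l x) = 1"
    using bl(3) s by (simp add: onorm_def norm_mult)
  ultimately show ?thesis by (simp add: support_functionals_def)
qed

text \<open>
  On the line through \<open>z = \<zeta>u\<close> the operator \<open>DF(z)\<close> is multiplication by \<open>s = f(z) + Df(z)z\<close>. Injectivity gives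
  \<open>s \<noteq> 0\<close>, so the quotient in the definition of the class is \<open>s/f(z)\<close>. It lies in \<open>\<Phi>(U)\<close>, which excludes
  \<open>f(z) = 0\<close> because division by zero yields \<open>0\<close> and \<open>Re \<Phi> > 0\<close>. Then \<open>\<omega> = \<Phi>\<^sup>-\<^sup>1(1 + \<zeta>\<phi>'/\<phi>)\<close>.
\<close>

lemma class_S_slice:
  fixes f :: "'a::cbanach \<Rightarrow> complex"
  assumes adm: "admissible \<Phi>" and f: "f \<in> class_S \<Phi>" and u: "norm u = 1" and l: "l \<in> support_functionals u"
  defines "\<phi> \<equiv> \<lambda>\<xi>. f (\<xi> *\<^sub>C u)"
  obtains \<omega> where "\<omega> holomorphic_on ball 0 1" "\<omega> 0 = 0" "\<And>\<zeta>. cmod \<zeta> < 1 \<Longrightarrow> cmod (\<omega> \<zeta>) < 1"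
    "\<And>\<zeta>. cmod \<zeta> < 1 \<Longrightarrow> \<zeta> * deriv \<phi> \<zeta> = \<phi> \<zeta> * (\<Phi> (\<omega> \<zeta>) - 1)"
proof -
  note A = admissibleD[OF adm]
  have fh: "holomorphic_map_on f (ball 0 1)" and f0: "f 0 = 1"
    and bij: "\<And>z. z \<in> ball 0 1 \<Longrightarrow> bij (blinfun_apply (fderiv (times_id f) z))"
    and M: "\<And>z l. z \<in> ball 0 1 - {0} \<Longrightarrow> l \<in> support_functionals z \<Longrightarrow>
      complex_of_real (norm z) / l (inv (blinfun_apply (fderiv (times_id f) z)) (times_id f z)) \<in> \<Phi> ` ball 0 1"
    using f by (auto simp: class_S_def class_M_def boundedly_invertible_def)
  have bl: "bounded_clinear l" "l u = 1" using l u by (auto simp: support_functionals_def)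
  have \<phi>0: "\<phi> 0 = 1" by (simp add: \<phi>_def f0 scaleC.zero_left)
  have der: "(\<phi> has_field_derivative blinfun_apply (fderiv f (\<zeta> *\<^sub>C u)) u) (at \<zeta>)" if "cmod \<zeta> < 1" for \<zeta>
    unfolding \<phi>_def by (rule slice_has_field_derivative[OF fh u that])
  have img: "\<phi> \<zeta> \<noteq> 0 \<and> 1 + \<zeta> * deriv \<phi> \<zeta> / \<phi> \<zeta> \<in> \<Phi> ` ball 0 1" if \<zeta>: "cmod \<zeta> < 1" for \<zeta>
  proof (cases "\<zeta> = 0")
    case True
    have "\<Phi> 0 \<in> \<Phi> ` ball 0 1" by (intro imageI) simp
    then show ?thesis using True \<phi>0 A(4) by simp
  next
    case nz: False
    define z where "z = \<zeta> *\<^sub>C u"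
    have "norm z = cmod \<zeta>" using u by (simp add: z_def norm_scaleC)
    then have z: "z \<in> ball 0 1 - {0}" using \<zeta> nz by auto
    define T where "T = blinfun_apply (fderiv (times_id f) z)"
    define s where "s = f z + \<zeta> * deriv \<phi> \<zeta>"
    have Df: "blinfun_apply (fderiv f z) z = \<zeta> * deriv \<phi> \<zeta>"
      using z bounded_clinear_scaleC[OF holomorphic_map_onD(2)[OF fh, of z], of \<zeta> u] der[OF \<zeta>]
      by (simp add: z_def DERIV_imp_deriv scaleC_complex_def)
    have Tz: "T (c *\<^sub>C z) = (c * s) *\<^sub>C z" for c
    proof -
      have "blinfun_apply (fderiv f z) (c *\<^sub>C z) = c * (\<zeta> * deriv \<phi> \<zeta>)"
        using z bounded_clinear_scaleC[OF holomorphic_map_onD(2)[OF fh, of z], of c z]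
        by (simp add: Df scaleC_complex_def)
      moreover have "T (c *\<^sub>C z) = f z *\<^sub>C c *\<^sub>C z + blinfun_apply (fderiv f z) (c *\<^sub>C z) *\<^sub>C z"
        unfolding T_def by (rule fderiv_times_id[OF fh]) (use z in simp)
      ultimately have "T (c *\<^sub>C z) = (f z * c + c * (\<zeta> * deriv \<phi> \<zeta>)) *\<^sub>C z"
        by (simp only: scaleC_scaleC scaleC_add_left)
      also have "f z * c + c * (\<zeta> * deriv \<phi> \<zeta>) = c * s" by (simp add: s_def algebra_simps)
      finally show ?thesis .
    qed
    have inj: "inj T" using bij[of z] z by (simp add: T_def bij_is_inj)
    have "s \<noteq> 0"
    proof
      assume "s = 0"
      then have "T z = T 0" using Tz[of 1] Tz[of 0] by (simp add: scaleC.zero_left)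
      then show False using inj z by (simp add: inj_eq)
    qed
    then have "T ((f z / s) *\<^sub>C z) = times_id f z" by (simp add: Tz times_id_def)
    then have "inv T (times_id f z) = (f z / s) *\<^sub>C z" using inj by (metis inv_f_f)
    moreover define l' where "l' = (\<lambda>x. cnj (sgn \<zeta>) * l x)"
    have l': "l' \<in> support_functionals z"
      unfolding l'_def z_def by (rule support_functional_rotate[OF l u nz])
    ultimately have "complex_of_real (norm z) / l' ((f z / s) *\<^sub>C z) \<in> \<Phi> ` ball 0 1"
      using M[OF z l'] by (simp add: T_def)
    moreover have "l' ((f z / s) *\<^sub>C z) = f z / s * of_real (norm z)"
      using l' by (auto simp: support_functionals_def bounded_clinear_scaleC scaleC_complex_def)
    moreover have "complex_of_real (norm z) / (f z / s * of_real (norm z)) = s / f z" using z by simp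
    ultimately have mem: "s / f z \<in> \<Phi> ` ball 0 1" by (simp only:)
    have "f z \<noteq> 0"
    proof
      assume "f z = 0"
      then have "0 \<in> \<Phi> ` ball 0 1" using mem by simp
      then show False using A(5) by fastforce
    qed
    moreover have \<phi>z: "\<phi> \<zeta> = f z" by (simp add: \<phi>_def z_def)
    moreover have "1 + \<zeta> * deriv \<phi> \<zeta> / \<phi> \<zeta> = s / f z"
      unfolding \<phi>z s_def using \<open>f z \<noteq> 0\<close> by (simp add: add_divide_distrib)
    ultimately show ?thesis using mem by (simp only: simp_thms)
  qed
  define q where "q = (\<lambda>\<zeta>. 1 + \<zeta> * deriv \<phi> \<zeta> / \<phi> \<zeta>)"
  have q: "q \<zeta> \<in> \<Phi> ` ball 0 1" "\<phi> \<zeta> \<noteq> 0" if "cmod \<zeta> < 1" for \<zeta>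
    using img[OF that] unfolding q_def by blast+
  have hol: "\<phi> holomorphic_on ball 0 1"
    unfolding holomorphic_on_open[OF open_ball] using der by (meson mem_ball_0)
  have q_hol: "q holomorphic_on ball 0 1"
    unfolding q_def
    by (intro holomorphic_on_add holomorphic_on_divide holomorphic_on_mult holomorphic_on_const
        holomorphic_on_ident hol holomorphic_deriv[OF hol] open_ball) (simp add: q(2))
  define \<omega> where "\<omega> = inv_into (ball 0 1) \<Phi> \<circ> q"
  show ?thesis
  proof (rule that[of \<omega>])
    show "\<omega> holomorphic_on ball 0 1"
      unfolding \<omega>_def by (rule holomorphic_on_compose_gen[OF q_hol A(3)], rule image_subsetI, rule q(1), simp)
    show "\<omega> 0 = 0" using inv_into_f_f[OF A(2), of 0] A(4) by (simp add: \<omega>_def q_def)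
    fix \<zeta> :: complex assume \<zeta>: "cmod \<zeta> < 1"
    show "cmod (\<omega> \<zeta>) < 1" using inv_into_into[OF q(1)[OF \<zeta>]] by (simp add: \<omega>_def)
    have "\<Phi> (\<omega> \<zeta>) = q \<zeta>" using f_inv_into_f[OF q(1)[OF \<zeta>]] by (simp add: \<omega>_def)
    then show "\<zeta> * deriv \<phi> \<zeta> = \<phi> \<zeta> * (\<Phi> (\<omega> \<zeta>) - 1)" using q(2)[OF \<zeta>] by (simp add: q_def)
  qed
qed

section \<open>Extremal mappings\<close>

lemma norm_support_functional_le:
  assumes "l \<in> support_functionals u" shows "cmod (l x) \<le> norm x"
  using assms onorm[of l x] by (simp add: support_functionals_def bounded_clinear_def)

lemma support_functional_scaleR:
  assumes l: "l \<in> support_functionals z" and r: "0 \<le> r"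
  shows "l \<in> support_functionals (r *\<^sub>R z)"
  using l r linear_scale[of l r z]
  by (simp add: support_functionals_def bounded_clinear_def bounded_linear.linear scaleR_conv_of_real)

lemma has_derivative_functional_compose:
  fixes l :: "'a::complex_normed_vector \<Rightarrow> complex"
  assumes "(\<phi> has_field_derivative d) (at (l z))" and l: "bounded_clinear l"
  shows "((\<lambda>z. \<phi> (l z)) has_derivative (\<lambda>w. d * l w)) (at z)" "bounded_clinear (\<lambda>w. d * l w)"
proof -
  note bl = bounded_clinear_bounded_linear[OF l]
  show "((\<lambda>z. \<phi> (l z)) has_derivative (\<lambda>w. d * l w)) (at z)"
    using has_derivative_compose[OF bounded_linear_imp_has_derivative[OF bl] assms(1)[unfolded has_field_derivative_def]] .
  show "bounded_clinear (\<lambda>w. d * l w)"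
    using bounded_linear_compose[OF bounded_linear_mult_right bl] bounded_clinear_scaleC[OF l]
    by (auto simp: bounded_clinear_def scaleC_complex_def)
qed

text \<open>
  Let \<open>\<phi>\<close> be the exponential of the primitive of \<open>h(\<zeta>) = (\<Phi>(\<omega>(\<zeta>)) - 1)/\<zeta>\<close> that vanishes at \<open>0\<close>, and \<open>f = \<phi> \<circ> l\<close>.
  Then \<open>DF(z)w = f(z)(w + h(l z) l(w) z)\<close> is a rank-one perturbation of a multiple of the identity, with
  an explicit inverse because \<open>1 + l(z) h(l z) = \<Phi>(\<omega>(l z)) \<noteq> 0\<close>. It gives \<open>(DF(z))\<^sup>-\<^sup>1F(z) = z/\<Phi>(\<omega>(l z))\<close>,
  whose quotient is \<open>\<Phi>(\<omega>(l z))\<close> for every support functional of \<open>z\<close>.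
\<close>

lemma extremal_mapping:
  fixes u :: "'a::cbanach"
  assumes adm: "admissible \<Phi>" and u: "norm u = 1" and l: "l \<in> support_functionals u"
    and om: "\<omega> holomorphic_on ball 0 1" "\<omega> 0 = 0" "\<And>\<zeta>. cmod \<zeta> < 1 \<Longrightarrow> cmod (\<omega> \<zeta>) < 1"
  obtains f where "f \<in> class_S \<Phi>"
    "\<And>\<zeta>. cmod \<zeta> < 1 \<Longrightarrow>
       \<zeta> * deriv (\<lambda>\<xi>. f (\<xi> *\<^sub>C u)) \<zeta> = f (\<zeta> *\<^sub>C u) * (\<Phi> (\<omega> \<zeta>) - 1)"
proof -
  note A = admissibleD[OF adm]
  have bl: "bounded_clinear l" "l u = 1" using l u by (auto simp: support_functionals_def)
  have lin: "linear l" using bl(1) by (simp add: bounded_clinear_def bounded_linear.linear)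
  have lb: "cmod (l z) < 1" if "z \<in> ball 0 1" for z
    using norm_support_functional_le[OF l, of z] that by simp
  have l0: "l 0 = 0" using linear_0[OF lin] .
  define Q where "Q = \<Phi> \<circ> \<omega>"
  have Q_hol: "Q holomorphic_on ball 0 1"
    unfolding Q_def by (rule holomorphic_on_compose_gen[OF om(1) A(1)]) (use om(3) in auto)
  have Q_img: "Q \<zeta> \<in> \<Phi> ` ball 0 1" "Q \<zeta> \<noteq> 0" if "cmod \<zeta> < 1" for \<zeta>
  proof -
    show "Q \<zeta> \<in> \<Phi> ` ball 0 1" using om(3)[OF that] by (simp add: Q_def)
    show "Q \<zeta> \<noteq> 0" using A(5)[OF om(3)[OF that]] by (auto simp: Q_def)
  qed
  have Q0: "Q 0 = 1" using A(4) om(2) by (simp add: Q_def)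
  have "(\<lambda>\<zeta>. Q \<zeta> - 1) holomorphic_on ball 0 1" by (intro holomorphic_intros Q_hol)
  then obtain h where h: "h holomorphic_on ball 0 1" "\<And>\<zeta>. cmod \<zeta> < 1 \<Longrightarrow> Q \<zeta> - 1 = \<zeta> * h \<zeta>"
    using Schwarz3[of "\<lambda>\<zeta>. Q \<zeta> - 1" 1] Q0 by auto
  obtain g where g: "\<And>\<zeta>. \<zeta> \<in> ball 0 1 \<Longrightarrow> (g has_field_derivative h \<zeta>) (at \<zeta> within ball 0 1)"
    using holomorphic_convex_primitive'[OF convex_ball open_ball h(1)] by blast
  define \<phi> where "\<phi> = (\<lambda>\<zeta>. exp (g \<zeta> - g 0))"
  have \<phi>: "(\<phi> has_field_derivative \<phi> \<zeta> * h \<zeta>) (at \<zeta>)" if "cmod \<zeta> < 1" for \<zeta>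
  proof -
    have z: "\<zeta> \<in> ball 0 1" using that by simp
    have "(g has_field_derivative h \<zeta>) (at \<zeta>)" using g[OF z] at_within_open[OF z open_ball] by simp
    then show ?thesis unfolding \<phi>_def by (auto intro!: derivative_eq_intros)
  qed
  define f where "f = (\<lambda>z. \<phi> (l z))"
  define f' where "f' z = (\<lambda>w. \<phi> (l z) * h (l z) * l w)" for z
  have fder: "(f has_derivative f' z) (at z)" and fcl: "bounded_clinear (f' z)" if "z \<in> ball 0 1" for z
    unfolding f_def f'_def
    using has_derivative_functional_compose[OF \<phi>[OF lb[OF that]] bl(1)] by simp_all
  have f_hol: "holomorphic_map_on f (ball 0 1)"
    unfolding holomorphic_map_on_def using fder fcl by blast
  have f0: "f 0 = 1" by (simp add: f_def \<phi>_def l0)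
  have fnz: "f z \<noteq> 0" for z by (simp add: f_def \<phi>_def)
  define T where "T z = blinfun_apply (fderiv (times_id f) z)" for z
  define S where "S z y = (1 / f z) *\<^sub>C (y - (h (l z) * l y / Q (l z)) *\<^sub>C z)" for z y
  have T: "T z w = f z *\<^sub>C (w + (h (l z) * l w) *\<^sub>C z)" if z: "z \<in> ball 0 1" for z w
  proof -
    have "T z w = f z *\<^sub>C w + f' z w *\<^sub>C z"
      unfolding T_def using fderiv_times_id[OF f_hol z] fderiv_eq[OF fder[OF z]] by simp
    then show ?thesis by (simp add: f'_def f_def scaleC_add_right scaleC_scaleC mult.assoc)
  qed
  have Qh: "Q (l z) = 1 + l z * h (l z)" if "z \<in> ball 0 1" for z
    using h(2)[OF lb[OF that]] by (simp add: algebra_simps)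
  have lsc: "l (c *\<^sub>C x) = c * l x" for c x
    using bounded_clinear_scaleC[OF bl(1)] by (simp add: scaleC_complex_def)
  have TS: "T z (S z y) = y" if z: "z \<in> ball 0 1" for z y
  proof -
    define b where "b = h (l z)"
    have q: "Q (l z) \<noteq> 0" "Q (l z) = 1 + l z * b" using Q_img(2)[OF lb[OF z]] Qh[OF z] by (simp_all add: b_def)
    have e: "b * (l y - b * l y / Q (l z) * l z) = b * l y / Q (l z)"
      using q(1) unfolding q(2) by (simp add: field_simps)
    have "T z (S z y) = (y - (b * l y / Q (l z)) *\<^sub>C z) + (b * (l y - b * l y / Q (l z) * l z)) *\<^sub>C z"
      unfolding T[OF z] S_def b_def[symmetric]
      by (simp add: lsc linear_diff[OF lin] fnz scaleC_scaleC scaleC_add_right)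
    then show ?thesis unfolding e by simp
  qed
  have ST: "S z (T z w) = w" if z: "z \<in> ball 0 1" for z w
  proof -
    define b where "b = h (l z)"
    have q: "Q (l z) \<noteq> 0" "Q (l z) = 1 + l z * b" using Q_img(2)[OF lb[OF z]] Qh[OF z] by (simp_all add: b_def)
    have e: "b * (f z * (l w + b * l w * l z)) / Q (l z) = f z * (b * l w)"
      using q(1) unfolding q(2) by (simp add: field_simps)
    have "l (T z w) = f z * (l w + b * l w * l z)"
      unfolding T[OF z] b_def by (simp add: lsc linear_add[OF lin])
    then have "S z (T z w) = (1 / f z) *\<^sub>C (T z w - (f z * (b * l w)) *\<^sub>C z)"
      unfolding S_def b_def[symmetric] by (simp only: e)
    also have "\<dots> = (1 / f z) *\<^sub>C f z *\<^sub>C w"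
      unfolding T[OF z] b_def by (simp add: scaleC_add_right scaleC_scaleC)
    finally show ?thesis using fnz by (simp add: scaleC_scaleC)
  qed
  have bij: "bij (T z)" and inv: "inv (T z) = S z" if z: "z \<in> ball 0 1" for z
  proof -
    show "bij (T z)" by (rule o_bij[of "S z"]) (auto simp: fun_eq_iff TS[OF z] ST[OF z])
    show "inv (T z) = S z" by (rule inv_unique_comp) (auto simp: fun_eq_iff TS[OF z] ST[OF z])
  qed
  have S_bl: "bounded_linear (S z)" for z
  proof -
    have "bounded_linear (\<lambda>y. h (l z) * l y / Q (l z))"
      using bounded_linear_compose[OF bounded_linear_mult_right bounded_clinear_bounded_linear[OF bl(1)], of "h (l z) / Q (l z)"]
      by simp
    from bounded_linear_compose[OF scaleC.bounded_linear_left this]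
    show ?thesis
      unfolding S_def by (intro bounded_linear_compose[OF scaleC.bounded_linear_right]
          bounded_linear_sub bounded_linear_ident)
  qed
  define r where "r = (\<lambda>z. 1 / Q (l z))"
  have r_hol: "holomorphic_map_on r (ball 0 1)"
    unfolding holomorphic_map_on_def
  proof
    fix z :: 'a assume z: "z \<in> ball 0 1"
    have "(\<lambda>\<zeta>. 1 / Q \<zeta>) holomorphic_on ball 0 1" using Q_img(2) by (intro holomorphic_intros Q_hol) auto
    then have "((\<lambda>\<zeta>. 1 / Q \<zeta>) has_field_derivative deriv (\<lambda>\<zeta>. 1 / Q \<zeta>) (l z)) (at (l z))"
      by (rule holomorphic_derivI[OF _ open_ball]) (use lb[OF z] in simp)
    from has_derivative_functional_compose[OF this bl(1)]
    show "\<exists>f'. bounded_clinear f' \<and> (r has_derivative f') (at z)" unfolding r_def by blast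
  qed
  define p where "p = (\<lambda>z. inv (T z) (times_id f z))"
  have p: "p z = times_id r z" if z: "z \<in> ball 0 1" for z
  proof -
    have q: "Q (l z) \<noteq> 0" "Q (l z) = 1 + l z * h (l z)" using Q_img(2)[OF lb[OF z]] Qh[OF z] by simp_all
    have "p z = S z (f z *\<^sub>C z)" unfolding p_def inv[OF z] times_id_def ..
    also have "\<dots> = z - (h (l z) * l z / Q (l z)) *\<^sub>C z"
      unfolding S_def using fnz[of z] by (simp add: lsc scaleC.diff_right scaleC_scaleC)
    also have "\<dots> = (1 - h (l z) * l z / Q (l z)) *\<^sub>C z" by (simp add: scaleC.diff_left)
    also have "1 - h (l z) * l z / Q (l z) = 1 / Q (l z)" using q(1) unfolding q(2) by (simp add: field_simps)
    finally show ?thesis by (simp add: times_id_def r_def)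
  qed
  have p_der: "(p has_derivative blinfun_apply (fderiv (times_id r) z)) (at z)" if z: "z \<in> ball 0 1" for z
    by (rule has_derivative_transform_within_open[OF
          holomorphic_map_onD(1)[OF holomorphic_map_on_times_id[OF r_hol] z] open_ball z]) (simp add: p)
  have "p \<in> class_M \<Phi>"
    unfolding class_M_def
  proof (intro CollectI conjI ballI)
    show "holomorphic_map_on p (ball 0 1)"
      unfolding holomorphic_map_on_def
      using p_der holomorphic_map_onD(2)[OF holomorphic_map_on_times_id[OF r_hol]] by blast
    show "p 0 = 0" by (simp add: p times_id_def scaleC.zero_right)
    show "fderiv p 0 = id_blinfun"
    proof (rule blinfun_eqI)
      fix w
      have "blinfun_apply (fderiv p 0) w = blinfun_apply (fderiv (times_id r) 0) w"
        using fderiv_eq[OF p_der[of 0]] by simp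
      also have "\<dots> = w" by (subst fderiv_times_id[OF r_hol]) (simp_all add: r_def l0 Q0 scaleC.zero_right)
      finally show "blinfun_apply (fderiv p 0) w = blinfun_apply id_blinfun w" by simp
    qed
    fix z :: 'a and l' assume z: "z \<in> ball 0 1 - {0}" and l': "l' \<in> support_functionals z"
    have "l' (p z) = r z * of_real (norm z)"
      using z l' p[of z] by (auto simp: times_id_def support_functionals_def bounded_clinear_scaleC scaleC_complex_def)
    then have "complex_of_real (norm z) / l' (p z) = Q (l z)" using z by (simp add: r_def)
    then show "complex_of_real (norm z) / l' (p z) \<in> \<Phi> ` ball 0 1" using Q_img(1)[OF lb] z by simp
  qed
  then have "f \<in> class_S \<Phi>"
    unfolding class_S_def boundedly_invertible_def using f_hol f0 bij inv S_bl
    by (simp add: p_def T_def)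
  moreover have "\<zeta> * deriv (\<lambda>\<xi>. f (\<xi> *\<^sub>C u)) \<zeta> = f (\<zeta> *\<^sub>C u) * (\<Phi> (\<omega> \<zeta>) - 1)" if z: "cmod \<zeta> < 1" for \<zeta>
  proof -
    have "f (\<xi> *\<^sub>C u) = \<phi> \<xi>" for \<xi> by (simp add: f_def lsc bl(2))
    then show ?thesis using \<phi>[OF z] h(2)[OF z] by (simp add: DERIV_imp_deriv Q_def mult.left_commute)
  qed
  ultimately show ?thesis by (rule that)
qed

text \<open>
  The function is \<open>\<zeta>(t - \<sigma>\<zeta>)/(1 - \<sigma>t\<zeta>)\<close>, with Schur parameters \<open>c = t\<close>, \<open>x = -\<sigma>\<close> and \<open>y = 0\<close>. For \<open>t = 1\<close> it is the
  identity on the disc.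
\<close>

lemma extremal_schwarz_function:
  fixes t \<sigma> :: real
  assumes t: "0 \<le> t" "t \<le> 1" and \<sigma>: "\<bar>\<sigma>\<bar> = 1"
  obtains \<omega> W where "\<omega> holomorphic_on ball 0 1" "\<omega> 0 = 0" "\<And>\<zeta>. cmod \<zeta> < 1 \<Longrightarrow> cmod (\<omega> \<zeta>) < 1"
    "\<omega> has_fps_expansion W" "fps_nth W 1 = of_real t"
    "fps_nth W 2 = of_real (- \<sigma> * (1 - t^2))" "fps_nth W 3 = of_real (- t * (1 - t^2))"
proof -
  define T s :: complex where "T = of_real t" and "s = of_real \<sigma>"
  have \<sigma>1: "\<sigma> = 1 \<or> \<sigma> = -1" using \<sigma> by linarith
  then have s2: "s * s = 1" by (auto simp: s_def)
  have ns: "cmod s = 1" using \<sigma> by (simp add: s_def)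
  define \<omega> where "\<omega> = (\<lambda>\<zeta>. \<zeta> * (T - s * \<zeta>) / (1 - s * T * \<zeta>))"
  have den: "1 - s * T * \<zeta> \<noteq> 0" if "cmod \<zeta> < 1" for \<zeta>
  proof
    assume "1 - s * T * \<zeta> = 0"
    then have "cmod (s * T * \<zeta>) = 1" by simp
    then have "t * cmod \<zeta> = 1" using t by (simp add: norm_mult ns T_def)
    then show False using mult_left_le_one_le[of "cmod \<zeta>" t] t that by simp
  qed
  have hol: "\<omega> holomorphic_on ball 0 1"
    unfolding \<omega>_def using den by (intro holomorphic_intros) auto
  have lt: "cmod (\<omega> \<zeta>) < 1" if z: "cmod \<zeta> < 1" for \<zeta>
  proof -
    have "(cmod (1 - s * T * \<zeta>))^2 - (cmod (T - s * \<zeta>))^2 = (1 - t^2) * (1 - (cmod \<zeta>)^2)"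
      using \<sigma>1 unfolding cmod_power2 T_def s_def
      by (auto simp: power2_eq_square algebra_simps)
    also have "\<dots> \<ge> 0" using t z by (simp add: power_le_one)
    finally have "(cmod (T - s * \<zeta>))^2 \<le> (cmod (1 - s * T * \<zeta>))^2" by simp
    then have "cmod (T - s * \<zeta>) \<le> cmod (1 - s * T * \<zeta>)" by (rule power2_le_imp_le) simp
    then have "cmod (T - s * \<zeta>) / cmod (1 - s * T * \<zeta>) \<le> 1" using den[OF z] by simp
    then have "cmod \<zeta> * (cmod (T - s * \<zeta>) / cmod (1 - s * T * \<zeta>)) \<le> cmod \<zeta> * 1"
      by (intro mult_left_mono) auto
    then show ?thesis using z by (simp add: \<omega>_def norm_mult norm_divide)
  qed
  obtain W where W: "\<omega> has_fps_expansion W" using holomorphic_on_unit_ball_fps[OF hol] by blast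
  have "(\<lambda>\<zeta>. \<omega> \<zeta> * (1 - s * T * \<zeta>)) has_fps_expansion W * (1 - fps_const (s * T) * fps_X)"
    by (intro fps_expansion_intros W)
  moreover have "(\<lambda>\<zeta>. \<zeta> * (T - s * \<zeta>)) has_fps_expansion fps_X * (fps_const T - fps_const s * fps_X)"
    by (intro fps_expansion_intros)
  moreover have "\<forall>\<^sub>F \<zeta> in nhds 0. \<omega> \<zeta> * (1 - s * T * \<zeta>) = \<zeta> * (T - s * \<zeta>)"
    using eventually_nhds_in_open[of "ball 0 1" "0::complex"]
    by (rule eventually_mono) (use den in \<open>auto simp: \<omega>_def\<close>)
  ultimately have "W * (1 - fps_const (s * T) * fps_X) = fps_X * (fps_const T - fps_const s * fps_X)"
    by (rule fps_eq_of_eventually_eq)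
  then have E: "W - fps_const (s * T) * (W * fps_X) = fps_const T * fps_X - fps_const s * fps_X ^ 2"
    by (simp add: algebra_simps power2_eq_square)
  have W0: "fps_nth W 0 = 0" using has_fps_expansion_imp_0_eq_fps_nth_0[OF W] by (simp add: \<omega>_def)
  have W1: "fps_nth W 1 = T" using arg_cong[OF E, of "\<lambda>f. fps_nth f 1"] W0 by (simp add: fps_X_power_nth)
  have W2: "fps_nth W 2 = s * T * fps_nth W 1 - s"
    using arg_cong[OF E, of "\<lambda>f. fps_nth f 2"] by (simp add: fps_X_power_nth algebra_simps)
  have W3: "fps_nth W 3 = s * T * fps_nth W 2"
    using arg_cong[OF E, of "\<lambda>f. fps_nth f 3"] by (simp add: fps_X_power_nth algebra_simps)
  have w2: "fps_nth W 2 = - s * (1 - T^2)" unfolding W2 W1 by (simp add: power2_eq_square algebra_simps)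
  have "fps_nth W 3 = - (s * s) * T * (1 - T^2)" unfolding W3 w2 by simp
  then have w3: "fps_nth W 3 = - T * (1 - T^2)" unfolding s2 by simp
  show ?thesis
  proof (rule that[OF hol _ lt W])
    show "\<omega> 0 = 0" by (simp add: \<omega>_def)
    show "fps_nth W 1 = of_real t" unfolding W1 T_def ..
    show "fps_nth W 2 = of_real (- \<sigma> * (1 - t^2))" unfolding w2 T_def s_def by simp
    show "fps_nth W 3 = of_real (- t * (1 - t^2))" unfolding w3 T_def by simp
  qed
qed

lemma A_functional_norm:
  fixes f :: "'a::cbanach \<Rightarrow> complex"
  assumes adm: "admissible \<Phi>" and f: "f \<in> class_S \<Phi>" and z: "z \<noteq> 0" and l: "l \<in> support_functionals z"
  defines "\<phi> \<equiv> \<lambda>\<xi>. f (\<xi> *\<^sub>C ((1 / norm z) *\<^sub>R z))"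
  assumes eq: "\<And>\<zeta>. cmod \<zeta> < 1 \<Longrightarrow> \<zeta> * deriv \<phi> \<zeta> = \<phi> \<zeta> * (\<Phi> (\<omega> \<zeta>) - 1)"
    and W: "\<omega> has_fps_expansion W" and om0: "\<omega> 0 = 0"
  defines "B \<equiv> taylor_coeff \<Phi>"
  shows "cmod (A2 (times_id f) l z * A3 (times_id f) l z - A4 (times_id f) l z)
      = B 1 / 3 * cmod (fps_nth W 3 + of_real (2 * B 2 / B 1) * fps_nth W 1 * fps_nth W 2
          + of_real ((B 3 - B 1 ^ 3) / B 1) * fps_nth W 1 ^ 3)"
proof -
  obtain P where P: "\<Phi> has_fps_expansion P" "fps_nth P 0 = 1"
    "\<And>n. fps_nth P n = of_real (B n)" and B1: "0 < B 1"
    using admissible_fps[OF adm] unfolding B_def by metis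
  have W0: "fps_nth W 0 = 0" using has_fps_expansion_imp_0_eq_fps_nth_0[OF W] om0 by simp
  have f': "holomorphic_map_on f (ball 0 1)" "f 0 = 1" using f by (auto simp: class_S_def)
  define w where "w = fps_nth W 3 + of_real (2 * B 2 / B 1) * fps_nth W 1 * fps_nth W 2
      + of_real ((B 3 - B 1 ^ 3) / B 1) * fps_nth W 1 ^ 3"
  have "A2 (times_id f) l z * A3 (times_id f) l z - A4 (times_id f) l z =
    - (fps_nth P 1 * fps_nth W 3 + 2 * fps_nth P 2 * fps_nth W 1 * fps_nth W 2
        + (fps_nth P 3 - fps_nth P 1 ^ 3) * fps_nth W 1 ^ 3) / 3"
    by (rule A_functional_eq[OF f' z l eq[unfolded \<phi>_def] P(1,2) W W0])
  also have "\<dots> = - of_real (B 1 / 3) * w"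
    unfolding P(3) w_def using B1 by (simp add: field_simps)
  finally have "cmod (A2 (times_id f) l z * A3 (times_id f) l z - A4 (times_id f) l z) = B 1 / 3 * cmod w"
    using B1 by (simp add: norm_mult)
  then show ?thesis by (simp only: w_def)
qed

lemma class_S_functional_le:
  fixes f :: "'a::cbanach \<Rightarrow> complex"
  assumes adm: "admissible \<Phi>" and f: "f \<in> class_S \<Phi>" and z: "z \<noteq> 0" and l: "l \<in> support_functionals z"
  defines "B \<equiv> taylor_coeff \<Phi>"
  assumes bound: "schwarz_bound (2 * B 2 / B 1) ((B 3 - B 1 ^ 3) / B 1) K"
  shows "cmod (A2 (times_id f) l z * A3 (times_id f) l z - A4 (times_id f) l z) \<le> B 1 / 3 * K"
proof -
  have B1: "0 < B 1" using admissible_fps[OF adm] unfolding B_def by metis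
  define u where "u = (1 / norm z) *\<^sub>R z"
  have u: "norm u = 1" using z by (simp add: u_def)
  have lu: "l \<in> support_functionals u" unfolding u_def by (rule support_functional_scaleR[OF l]) simp
  obtain \<omega> where om: "\<omega> holomorphic_on ball 0 1" "\<omega> 0 = 0" "\<And>\<zeta>. cmod \<zeta> < 1 \<Longrightarrow> cmod (\<omega> \<zeta>) < 1"
    "\<And>\<zeta>. cmod \<zeta> < 1 \<Longrightarrow> \<zeta> * deriv (\<lambda>\<xi>. f (\<xi> *\<^sub>C u)) \<zeta> = f (\<zeta> *\<^sub>C u) * (\<Phi> (\<omega> \<zeta>) - 1)"
    using class_S_slice[OF adm f u lu] by blast
  obtain W where W: "\<omega> has_fps_expansion W" using holomorphic_on_unit_ball_fps[OF om(1)] by blast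
  obtain x y where xy: "cmod (fps_nth W 1) \<le> 1" "cmod x \<le> 1" "cmod y \<le> 1 - (cmod x)^2"
    "fps_nth W 2 = of_real (1 - (cmod (fps_nth W 1))^2) * x"
    "fps_nth W 3 = of_real (1 - (cmod (fps_nth W 1))^2) * (y - cnj (fps_nth W 1) * x^2)"
    using schwarz_function_coeffs[OF om(1-3) W] by blast
  define w where "w = fps_nth W 3 + of_real (2 * B 2 / B 1) * fps_nth W 1 * fps_nth W 2
      + of_real ((B 3 - B 1 ^ 3) / B 1) * fps_nth W 1 ^ 3"
  have "cmod (A2 (times_id f) l z * A3 (times_id f) l z - A4 (times_id f) l z) = B 1 / 3 * cmod w"
    unfolding w_def B_def by (rule A_functional_norm[OF adm f z l om(4)[unfolded u_def] W om(2)])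
  moreover have "cmod w \<le> K"
    using schur_parameter_functional_le[OF bound xy(1-3)] unfolding w_def xy(4,5) .
  ultimately show ?thesis using B1 by simp
qed

lemma class_S_functional_attains:
  fixes u :: "'a::cbanach"
  assumes adm: "admissible \<Phi>" and u: "norm u = 1" and l: "l \<in> support_functionals u"
    and om: "\<omega> holomorphic_on ball 0 1" "\<omega> 0 = 0" "\<And>\<zeta>. cmod \<zeta> < 1 \<Longrightarrow> cmod (\<omega> \<zeta>) < 1"
    and W: "\<omega> has_fps_expansion W"
  defines "B \<equiv> taylor_coeff \<Phi>"
  obtains f where "f \<in> class_S \<Phi>"
    "cmod (A2 (times_id f) l u * A3 (times_id f) l u - A4 (times_id f) l u)
      = B 1 / 3 * cmod (fps_nth W 3 + of_real (2 * B 2 / B 1) * fps_nth W 1 * fps_nth W 2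
          + of_real ((B 3 - B 1 ^ 3) / B 1) * fps_nth W 1 ^ 3)"
proof -
  obtain f where f: "f \<in> class_S \<Phi>" "\<And>\<zeta>. cmod \<zeta> < 1 \<Longrightarrow>
       \<zeta> * deriv (\<lambda>\<xi>. f (\<xi> *\<^sub>C u)) \<zeta> = f (\<zeta> *\<^sub>C u) * (\<Phi> (\<omega> \<zeta>) - 1)"
    using extremal_mapping[OF adm u l om] by blast
  have u0: "u \<noteq> 0" and uu: "(1 / norm u) *\<^sub>R u = u" using u by auto
  show ?thesis
    by (rule that[OF f(1)], unfold B_def)
       (rule A_functional_norm[OF adm f(1) u0 l, unfolded uu, OF f(2) W om(2)])
qed

text \<open>
  The maximum of the cubic in the normalisation of the theorem, with \<open>b = B\<^sub>1\<close>, \<open>bm = B\<^sub>1 + 2|B\<^sub>2|\<close> and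
  \<open>b(m + n) = B\<^sub>1 - B\<^sub>1\<^sup>3 + B\<^sub>3 + 2|B\<^sub>2|\<close>.
\<close>

lemma extremal_value_rescale:
  fixes b m n :: real
  assumes b: "0 < b" and m: "0 \<le> m" and n: "0 < m + n"
  shows "b / 3 * extremal_value m n = 2 * sqrt 3 * (b * m) powr (3/2) / (27 * sqrt (b * (m + n)))"
proof -
  have p: "x powr (3/2) = x * sqrt x" if "0 \<le> x" for x :: real
  proof (cases "x = 0")
    case False
    then have "0 < x" using that by simp
    then show ?thesis using powr_add[of x 1 "1/2"] by (simp add: powr_half_sqrt)
  qed simp
  have "sqrt (m / (3 * (m + n))) = sqrt m / (sqrt 3 * sqrt (m + n))"
    unfolding real_sqrt_divide real_sqrt_mult ..
  then have "b / 3 * extremal_value m n = 2 * b * m * sqrt m / (9 * sqrt 3 * sqrt (m + n))"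
    unfolding extremal_value_def by simp
  also have "\<dots> = 2 * sqrt 3 * b * m * sqrt m / (27 * sqrt (m + n))"
  proof -
    have "sqrt 3 * sqrt 3 = (3::real)" by simp
    then show ?thesis using n by (simp add: frac_eq_eq)
  qed
  also have "\<dots> = 2 * sqrt 3 * (b * m * (sqrt b * sqrt m)) / (27 * (sqrt b * sqrt (m + n)))"
    using b by simp
  also have "\<dots> = 2 * sqrt 3 * (b * m) powr (3/2) / (27 * sqrt (b * (m + n)))"
    using p[of "b * m"] b m by (simp add: real_sqrt_mult)
  finally show ?thesis .
qed

text \<open>
  The lower bound on \<open>q\<^sub>6\<close> says that the maximum point \<open>t\<close> of the cubic is at most \<open>1\<close>, so that it is
  the first coefficient of a Schwarz function. The sign \<open>\<sigma>\<close> of \<open>q\<^sub>5\<close> makes the terms \<open>c\<^sub>3\<close> and \<open>q\<^sub>5c\<^sub>1c\<^sub>2\<close> add up.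
\<close>

lemma extremal_value_attained:
  fixes q5 q6 :: real
  assumes q6: "- (2/3) * (\<bar>q5\<bar> + 1) \<le> q6"
  obtains \<omega> W where "\<omega> holomorphic_on ball 0 1" "\<omega> 0 = 0" "\<And>\<zeta>. cmod \<zeta> < 1 \<Longrightarrow> cmod (\<omega> \<zeta>) < 1"
    "\<omega> has_fps_expansion W"
    "cmod (fps_nth W 3 + of_real q5 * fps_nth W 1 * fps_nth W 2 + of_real q6 * fps_nth W 1 ^ 3)
      = extremal_value (\<bar>q5\<bar> + 1) q6"
proof -
  define m where "m = \<bar>q5\<bar> + 1"
  have m: "1 \<le> m" by (simp add: m_def)
  have q6m: "- (2/3) * m \<le> q6" using q6 by (simp add: m_def)
  then have N: "m / 3 \<le> m + q6" by simp
  define t where "t = sqrt (m / (3 * (m + q6)))"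
  have t: "0 \<le> t" "t^2 = m / (3 * (m + q6))" using m N by (simp_all add: t_def)
  have "m / (3 * (m + q6)) \<le> 1" using m N by (simp add: divide_le_eq)
  then have t1: "t \<le> 1" unfolding t_def by simp
  define \<sigma> :: real where "\<sigma> = (if 0 \<le> q5 then 1 else - 1)"
  have \<sigma>: "\<bar>\<sigma>\<bar> = 1" "q5 * \<sigma> = m - 1" by (auto simp: \<sigma>_def m_def)
  obtain \<omega> W where w: "\<omega> holomorphic_on ball 0 1" "\<omega> 0 = 0" "\<And>\<zeta>. cmod \<zeta> < 1 \<Longrightarrow> cmod (\<omega> \<zeta>) < 1"
    "\<omega> has_fps_expansion W" "fps_nth W 1 = of_real t"
    "fps_nth W 2 = of_real (- \<sigma> * (1 - t^2))" "fps_nth W 3 = of_real (- t * (1 - t^2))"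
    using extremal_schwarz_function[OF t(1) t1 \<sigma>(1)] by metis
  have "- t * (1 - t^2) + q5 * t * (- \<sigma> * (1 - t^2)) + q6 * t^3
      = - t * (1 - t^2) - (q5 * \<sigma>) * (t * (1 - t^2)) + q6 * t^3" by simp
  also have "\<dots> = - (m * t - (m + q6) * t^2 * t)"
    unfolding \<sigma>(2) by (simp add: power2_eq_square power3_eq_cube algebra_simps)
  also have "(m + q6) * t^2 = m / 3" unfolding t(2) using m N by (simp add: field_simps)
  also have "- (m * t - m / 3 * t) = - extremal_value m q6" by (simp add: extremal_value_def t_def)
  finally have e: "- t * (1 - t^2) + q5 * t * (- \<sigma> * (1 - t^2)) + q6 * t^3 = - extremal_value m q6" .
  have "fps_nth W 3 + of_real q5 * fps_nth W 1 * fps_nth W 2 + of_real q6 * fps_nth W 1 ^ 3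
      = of_real (- t * (1 - t^2) + q5 * t * (- \<sigma> * (1 - t^2)) + q6 * t^3)"
    unfolding w(5-7) by simp
  also have "\<dots> = of_real (- extremal_value m q6)" unfolding e ..
  finally have "cmod (fps_nth W 3 + of_real q5 * fps_nth W 1 * fps_nth W 2 + of_real q6 * fps_nth W 1 ^ 3)
      = \<bar>- extremal_value m q6\<bar>" by (simp only: norm_of_real)
  also have "\<dots> = extremal_value m q6" using m N by (simp add: extremal_value_def)
  finally show ?thesis using that[OF w(1-4)] by (simp add: m_def)
qed

section \<open>The sharp estimate\<close>

theorem theorem7:
  fixes \<Phi> :: "complex \<Rightarrow> complex" and B :: "nat \<Rightarrow> real" and q5 q6 :: real
  assumes nonzero: "\<exists>x::'a::cbanach. x \<noteq> 0"
    and adm: "admissible \<Phi>"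
    and B: "B = taylor_coeff \<Phi>"
    and q5: "q5 = 2 * B 2 / B 1"
    and q6: "q6 = (B 3 - B 1 ^ 3) / B 1"
  shows
    "(\<forall>(f :: 'a \<Rightarrow> complex) F z l.
        f \<in> class_S \<Phi> \<and> F = times_id f \<and> z \<noteq> 0 \<and> l \<in> support_functionals z \<longrightarrow>
          ((q5, q6) \<in> Theta1 \<union> Theta2 \<union> {(2, 1)} \<longrightarrow>
             cmod (A2 F l z * A3 F l z - A4 F l z) \<le> B 1 / 3) \<and>
          ((q5, q6) \<in> Theta3 \<union> Theta4 \<union> Theta5 \<union> Theta6 \<union> Theta7 \<longrightarrow>
             cmod (A2 F l z * A3 F l z - A4 F l z) \<le> 1/3 * \<bar>B 3 - B 1 ^ 3\<bar>) \<and>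
          ((q5, q6) \<in> Theta8 \<union> Theta9 \<longrightarrow>
             cmod (A2 F l z * A3 F l z - A4 F l z) \<le>
               2 * sqrt 3 * (B 1 + 2 * \<bar>B 2\<bar>) powr (3/2)
                 / (27 * sqrt (B 1 - B 1 ^ 3 + B 3 + 2 * \<bar>B 2\<bar>))))
     \<and>
     ((q5, q6) \<in> Theta1 \<union> Theta2 \<union> {(2, 1)} \<longrightarrow>
        (\<exists>(f :: 'a \<Rightarrow> complex) F z l.
           f \<in> class_S \<Phi> \<and> F = times_id f \<and> z \<noteq> 0 \<and> l \<in> support_functionals z \<and>
           cmod (A2 F l z * A3 F l z - A4 F l z) = B 1 / 3))
     \<and>
     ((q5, q6) \<in> Theta3 \<union> Theta4 \<union> Theta5 \<union> Theta6 \<union> Theta7 \<longrightarrow>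
        (\<exists>(f :: 'a \<Rightarrow> complex) F z l.
           f \<in> class_S \<Phi> \<and> F = times_id f \<and> z \<noteq> 0 \<and> l \<in> support_functionals z \<and>
           cmod (A2 F l z * A3 F l z - A4 F l z) = 1/3 * \<bar>B 3 - B 1 ^ 3\<bar>))
     \<and>
     ((q5, q6) \<in> Theta8 \<union> Theta9 \<longrightarrow>
        (\<exists>(f :: 'a \<Rightarrow> complex) F z l.
           f \<in> class_S \<Phi> \<and> F = times_id f \<and> z \<noteq> 0 \<and> l \<in> support_functionals z \<and>
           cmod (A2 F l z * A3 F l z - A4 F l z) =
             2 * sqrt 3 * (B 1 + 2 * \<bar>B 2\<bar>) powr (3/2)
               / (27 * sqrt (B 1 - B 1 ^ 3 + B 3 + 2 * \<bar>B 2\<bar>))))"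
proof -
  have B1: "0 < B 1" using admissible_fps[OF adm] unfolding B by metis
  have q6_abs: "B 1 / 3 * \<bar>q6\<bar> = 1/3 * \<bar>B 3 - B 1 ^ 3\<bar>" using B1 by (simp add: q6 abs_divide)
  have region: "- (2/3) * (\<bar>q5\<bar> + 1) \<le> q6" if "(q5, q6) \<in> Theta8 \<union> Theta9"
    using that by (auto simp: Theta8_def Theta9_def)
  have third: "B 1 / 3 * extremal_value (\<bar>q5\<bar> + 1) q6 =
      2 * sqrt 3 * (B 1 + 2 * \<bar>B 2\<bar>) powr (3/2) / (27 * sqrt (B 1 - B 1 ^ 3 + B 3 + 2 * \<bar>B 2\<bar>))"
    if "(q5, q6) \<in> Theta8 \<union> Theta9"
  proof -
    have m: "B 1 * (\<bar>q5\<bar> + 1) = B 1 + 2 * \<bar>B 2\<bar>"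
      using B1 by (simp add: q5 abs_divide abs_mult field_simps)
    moreover have "B 1 * q6 = B 3 - B 1 ^ 3" using B1 by (simp add: q6)
    ultimately have mn: "B 1 * (\<bar>q5\<bar> + 1 + q6) = B 1 - B 1 ^ 3 + B 3 + 2 * \<bar>B 2\<bar>"
      by (simp add: distrib_left)
    have "0 < \<bar>q5\<bar> + 1 + q6" using region[OF that] abs_ge_zero[of q5] by (simp add: field_simps)
    then show ?thesis using extremal_value_rescale[OF B1, of "\<bar>q5\<bar> + 1" q6] unfolding m mn by simp
  qed
  have upper: "cmod (A2 (times_id f) l z * A3 (times_id f) l z - A4 (times_id f) l z) \<le> B 1 / 3 * K"
    if "schwarz_bound q5 q6 K" "f \<in> class_S \<Phi>" "z \<noteq> 0" "l \<in> support_functionals z"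
    for f :: "'a \<Rightarrow> complex" and z l K
    using class_S_functional_le[OF adm that(2-4)] that(1) unfolding B q5 q6 by blast
  obtain x :: 'a where x: "x \<noteq> 0" using nonzero by blast
  define u where "u = (1 / norm x) *\<^sub>R x"
  have u: "norm u = 1" "u \<noteq> 0" using x by (auto simp: u_def)
  obtain l where l: "l \<in> support_functionals u" using support_functionals_nonempty[OF u(2)] by blast
  have sharp: "\<exists>(f :: 'a \<Rightarrow> complex) F z l.
      f \<in> class_S \<Phi> \<and> F = times_id f \<and> z \<noteq> 0 \<and> l \<in> support_functionals z \<and>
      cmod (A2 F l z * A3 F l z - A4 F l z) = v"
    if om: "\<omega> holomorphic_on ball 0 1" "\<omega> 0 = 0" "\<And>\<zeta>. cmod \<zeta> < 1 \<Longrightarrow> cmod (\<omega> \<zeta>) < 1"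
      and W: "\<omega> has_fps_expansion W"
      and v: "v = B 1 / 3 * cmod (fps_nth W 3 + of_real q5 * fps_nth W 1 * fps_nth W 2 + of_real q6 * fps_nth W 1 ^ 3)"
    for \<omega> W v
  proof -
    obtain f where "f \<in> class_S \<Phi>"
      "cmod (A2 (times_id f) l u * A3 (times_id f) l u - A4 (times_id f) l u) = v"
      using class_S_functional_attains[OF adm u(1) l om W] unfolding v q5 q6 B by blast
    then show ?thesis using u(2) l by blast
  qed
  show ?thesis
  proof (intro conjI allI impI; (elim conjE)?)
    fix f :: "'a \<Rightarrow> complex" and F l and z :: 'a
    assume reg: "(q5, q6) \<in> Theta1 \<union> Theta2 \<union> {(2, 1)}" and f: "f \<in> class_S \<Phi>" and F: "F = times_id f"
      and z: "z \<noteq> 0" and l: "l \<in> support_functionals z"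
    show "cmod (A2 F l z * A3 F l z - A4 F l z) \<le> B 1 / 3"
      using upper[OF schwarz_bound_1[OF reg] f z l] by (simp add: F)
  next
    fix f :: "'a \<Rightarrow> complex" and F l and z :: 'a
    assume reg: "(q5, q6) \<in> Theta3 \<union> Theta4 \<union> Theta5 \<union> Theta6 \<union> Theta7" and f: "f \<in> class_S \<Phi>" and F: "F = times_id f"
      and z: "z \<noteq> 0" and l: "l \<in> support_functionals z"
    show "cmod (A2 F l z * A3 F l z - A4 F l z) \<le> 1/3 * \<bar>B 3 - B 1 ^ 3\<bar>"
      using upper[OF schwarz_bound_abs_nu[OF reg] f z l] unfolding q6_abs F .
  next
    fix f :: "'a \<Rightarrow> complex" and F l and z :: 'a
    assume reg: "(q5, q6) \<in> Theta8 \<union> Theta9" and f: "f \<in> class_S \<Phi>" and F: "F = times_id f"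
      and z: "z \<noteq> 0" and l: "l \<in> support_functionals z"
    have "schwarz_bound q5 q6 (extremal_value (\<bar>q5\<bar> + 1) q6)"
      using reg schwarz_bound_Theta8 schwarz_bound_Theta9 by blast
    from upper[OF this f z l]
    show "cmod (A2 F l z * A3 F l z - A4 F l z) \<le> 2 * sqrt 3 * (B 1 + 2 * \<bar>B 2\<bar>) powr (3/2)
                 / (27 * sqrt (B 1 - B 1 ^ 3 + B 3 + 2 * \<bar>B 2\<bar>))"
      unfolding third[OF reg] F .
  next
    assume "(q5, q6) \<in> Theta1 \<union> Theta2 \<union> {(2, 1)}"
    show "\<exists>(f :: 'a \<Rightarrow> complex) F z l.
           f \<in> class_S \<Phi> \<and> F = times_id f \<and> z \<noteq> 0 \<and> l \<in> support_functionals z \<and>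
           cmod (A2 F l z * A3 F l z - A4 F l z) = B 1 / 3"
    proof (rule sharp)
      show "(\<lambda>\<zeta>. \<zeta> ^ 3) has_fps_expansion fps_X ^ 3" by (intro fps_expansion_intros)
      show "cmod (\<zeta> ^ 3) < 1" if "cmod \<zeta> < 1" for \<zeta>
        using power_decreasing[of 1 3 "cmod \<zeta>"] that by (simp add: norm_power)
    qed (auto intro!: holomorphic_intros simp: fps_X_power_nth)
  next
    assume "(q5, q6) \<in> Theta3 \<union> Theta4 \<union> Theta5 \<union> Theta6 \<union> Theta7"
    show "\<exists>(f :: 'a \<Rightarrow> complex) F z l.
           f \<in> class_S \<Phi> \<and> F = times_id f \<and> z \<noteq> 0 \<and> l \<in> support_functionals z \<and>
           cmod (A2 F l z * A3 F l z - A4 F l z) = 1/3 * \<bar>B 3 - B 1 ^ 3\<bar>"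
    proof (rule sharp)
      show "(\<lambda>\<zeta>. \<zeta>) has_fps_expansion fps_X" by (rule has_fps_expansion_fps_X)
      show "1/3 * \<bar>B 3 - B 1 ^ 3\<bar> = B 1 / 3 * cmod (fps_nth fps_X 3 + of_real q5 * fps_nth fps_X 1 * fps_nth fps_X 2
          + of_real q6 * fps_nth fps_X 1 ^ 3)"
        unfolding q6_abs[symmetric] by simp
    qed (auto intro!: holomorphic_intros)
  next
    assume reg: "(q5, q6) \<in> Theta8 \<union> Theta9"
    obtain \<omega> W where w: "\<omega> holomorphic_on ball 0 1" "\<omega> 0 = 0" "\<And>\<zeta>. cmod \<zeta> < 1 \<Longrightarrow> cmod (\<omega> \<zeta>) < 1"
      "\<omega> has_fps_expansion W"
      "cmod (fps_nth W 3 + of_real q5 * fps_nth W 1 * fps_nth W 2 + of_real q6 * fps_nth W 1 ^ 3)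
        = extremal_value (\<bar>q5\<bar> + 1) q6"
      using extremal_value_attained[OF region[OF reg]] by metis
    show "\<exists>(f :: 'a \<Rightarrow> complex) F z l.
           f \<in> class_S \<Phi> \<and> F = times_id f \<and> z \<noteq> 0 \<and> l \<in> support_functionals z \<and>
           cmod (A2 F l z * A3 F l z - A4 F l z) =
             2 * sqrt 3 * (B 1 + 2 * \<bar>B 2\<bar>) powr (3/2)
               / (27 * sqrt (B 1 - B 1 ^ 3 + B 3 + 2 * \<bar>B 2\<bar>))"
      by (rule sharp[OF w(1-4)], assumption) (unfold w(5) third[OF reg], rule refl)
  qed
qed

end
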